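(* Let $n\in\mathbb N$, $Z_0\in\mathfrak B_d(n)$ and $W_0\in M_n(\mathbb C)$. Then there exists $\Phi\in H_1^\infty(\mathfrak B_d)$ such that $\Phi(Z_0)=W_0$ if and only if the map $$P\mapsto \mathcal K(Z_0,Z_0)(P)-W_0\,\mathcal K(Z_0,Z_0)(P)\,W_0^*$$ is a completely positive map on $M_n(\mathbb C)$.
   Context: $d\in\mathbb N$ is fixed. $\mathbb M^d=\bigsqcup_{n\ge1}M_n(\mathbb C)^d$ and $\mathfrak B_d=\{X=(X_1,\dots,X_d)\in\mathbb M^d:\|\sum_jX_jX_j^*\|<1\}$, with $\mathfrak B_d(n)=\mathfrak B_d\cap M_n(\mathbb C)^d$. $\mathbb W_d$ is the free monoid (words) on $\{1,\dots,d\}$; for $\alpha=\alpha_1\cdots\alpha_p$, $Z^\alpha=Z_{\alpha_1}\cdots Z_{\alpha_p}$, and $Z^\emptyset=I$. $\mathcal K$ is the nc Drury–Arveson (Szegő) kernel on $\mathfrak B_d$: for $Z\in\mathfrak B_d(m)$, $W\in\mathfrak B_d(n)$, $P\in M_{m\times n}(\mathbb C)$, $\mathcal K(Z,W)(P)=\sum_{\alpha\in\mathbb W_d}Z^\alpha P(W^\alpha)^*$. A (scalar) nc function on $\mathfrak B_d$ is a map $f:\mathfrak B_d\to\bigsqcup_nM_n(\mathbb C)$ that is graded ($f(X)\in M_n(\mathbb C)$ for $X\in\mathfrak B_d(n)$), respects direct sums ($f(X\oplus Y)=f(X)\oplus f(Y)$) and similarities ($f(S^{-1}XS)=S^{-1}f(X)S$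 for $X\in\mathfrak B_d(n)$, $S\in M_n(\mathbb C)$ invertible with $S^{-1}XS\in\mathfrak B_d(n)$). It is free holomorphic if it is locally bounded in the free topology, i.e. the topology on $\mathbb M^d$ with basis the sets $G_\delta=\{X\in\mathbb M^d:\|\delta(X)\|<1\}$, $\delta$ a matrix of free (noncommutative) polynomials in $d$ variables ($\mathfrak B_d$ is itself such a $G_\delta$, with $\delta(x)=[x_1\cdots x_d]$). $H^\infty(\mathfrak B_d)$ is the set of bounded free holomorphic functions on $\mathfrak B_d$, and $H_1^\infty(\mathfrak B_d)=\{\Phi\in H^\infty(\mathfrak B_d):\sup_{Z\in\mathfrak B_d}\|\Phi(Z)\|\le1\}$. *)

theory Defs
  imports
    "HOL-Analysis.Analysis"
    "HOL-Library.Poly_Mapping"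
    "HOL-Library.Nonpos_Ints"
    "Jordan_Normal_Form.Schur_Decomposition"
begin

no_notation vec_nth (infixl \<open>$\<close> 90)

definition vec_norm2 :: "complex vec \<Rightarrow> real" where
  "vec_norm2 v = L2_set (\<lambda>i. cmod (v $ i)) {..<dim_vec v}"

definition op_norm :: "complex mat \<Rightarrow> real" where
  "op_norm A = (SUP v \<in> {v \<in> carrier_vec (dim_col A). vec_norm2 v \<le> 1}. vec_norm2 (A *\<^sub>v v))"

definition mat_dsum :: "complex mat \<Rightarrow> complex mat \<Rightarrow> complex mat" where
  "mat_dsum A B = four_block_mat A (0\<^sub>m (dim_row A) (dim_col B)) (0\<^sub>m (dim_row B) (dim_col A)) B"

text \<open>
  A \<open>d\<close>-tuple of matrices is a list of length \<open>d\<close>; the coordinates \<open>X_1, \<dots>, X_d\<close> and the letters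
  of words are numbered from \<open>0\<close> to \<open>d - 1\<close>.  The matrix size of a tuple is recovered from its
  first entry, which presupposes \<open>d \<ge> 1\<close>.
\<close>

definition tuple_size :: "complex mat list \<Rightarrow> nat" where
  "tuple_size X = dim_row (hd X)"

definition nc_level :: "nat \<Rightarrow> nat \<Rightarrow> complex mat list set" where
  "nc_level d n = {X. length X = d \<and> set X \<subseteq> carrier_mat n n}"

definition nc_universe :: "nat \<Rightarrow> complex mat list set" where
  "nc_universe d = (\<Union>n \<in> {1..}. nc_level d n)"

definition tuple_gram :: "nat \<Rightarrow> complex mat list \<Rightarrow> complex mat" where
  "tuple_gram n X = mat n n (\<lambda>(i, k). \<Sum>j<length X. (X ! j * mat_adjoint (X ! j)) $$ (i, k))"

definition nc_ball_level :: "nat \<Rightarrow> nat \<Rightarrow> complex mat list set" where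
  "nc_ball_level d n = {X \<in> nc_level d n. op_norm (tuple_gram n X) < 1}"

definition nc_ball :: "nat \<Rightarrow> complex mat list set" where
  "nc_ball d = (\<Union>n \<in> {1..}. nc_ball_level d n)"

definition words :: "nat \<Rightarrow> nat list set" where
  "words d = lists {..<d}"

text \<open>The size \<open>n\<close> is an argument because the empty word evaluates to the identity of size \<open>n\<close>.\<close>

definition word_eval :: "nat \<Rightarrow> complex mat list \<Rightarrow> nat list \<Rightarrow> complex mat" where
  "word_eval n X w = foldr (\<lambda>j A. X ! j * A) w (1\<^sub>m n)"

text \<open>
  For \<open>Z\<close> of size \<open>m\<close> and \<open>W\<close> of size \<open>n\<close>, \<open>P\<close> is an \<open>m \<times> n\<close> matrix.  The sum over all words is taken
  entrywise as an unordered sum; for \<open>Z\<close>, \<open>W\<close> in the row ball every entry converges absolutely.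
\<close>

definition szego_kernel ::
  "nat \<Rightarrow> complex mat list \<Rightarrow> complex mat list \<Rightarrow> complex mat \<Rightarrow> complex mat" where
  "szego_kernel d Z W P =
     mat (dim_row P) (dim_col P) (\<lambda>(i, j). \<Sum>\<^sub>\<infinity>w\<in>words d.
       (word_eval (dim_row P) Z w * P * mat_adjoint (word_eval (dim_col P) W w)) $$ (i, j))"

text \<open>A free polynomial is a finitely supported family of coefficients indexed by words.\<close>

type_synonym free_poly = "nat list \<Rightarrow>\<^sub>0 complex"

definition free_polys :: "nat \<Rightarrow> free_poly set" where
  "free_polys d = {p. Poly_Mapping.keys p \<subseteq> words d}"

definition poly_eval :: "nat \<Rightarrow> free_poly \<Rightarrow> complex mat list \<Rightarrow> complex mat" where
  "poly_eval n p X = mat n n (\<lambda>(i, j).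
     \<Sum>w\<in>Poly_Mapping.keys p. Poly_Mapping.lookup p w * word_eval n X w $$ (i, j))"

text \<open>
  An \<open>I \<times> J\<close> matrix of free polynomials evaluated at a tuple of size \<open>n\<close> is an \<open>I \<times> J\<close> block matrix
  with \<open>n \<times> n\<close> blocks.
\<close>

definition poly_mat_eval :: "nat \<Rightarrow> free_poly mat \<Rightarrow> complex mat list \<Rightarrow> complex mat" where
  "poly_mat_eval n \<delta> X = mat (dim_row \<delta> * n) (dim_col \<delta> * n) (\<lambda>(i, j).
     poly_eval n (\<delta> $$ (i div n, j div n)) X $$ (i mod n, j mod n))"

definition poly_polyhedron :: "nat \<Rightarrow> free_poly mat \<Rightarrow> complex mat list set" where
  "poly_polyhedron d \<delta> = {X \<in> nc_universe d. op_norm (poly_mat_eval (tuple_size X) \<delta> X) < 1}"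

text \<open>
  The generating family is closed under finite intersections (take block diagonal \<open>\<delta>\<close>), so it is a
  basis of the topology it generates.
\<close>

definition free_topology :: "nat \<Rightarrow> complex mat list topology" where
  "free_topology d = topology_generated_by
     {poly_polyhedron d \<delta> | \<delta>. elements_mat \<delta> \<subseteq> free_polys d}"

text \<open>
  Functions on the row ball are total functions whose values off the ball are unconstrained.
\<close>

definition nc_function :: "nat \<Rightarrow> (complex mat list \<Rightarrow> complex mat) \<Rightarrow> bool" where
  "nc_function d f \<longleftrightarrow>
     (\<forall>n\<ge>1. \<forall>X\<in>nc_ball_level d n. f X \<in> carrier_mat n n) \<and>
     (\<forall>X\<in>nc_ball d. \<forall>Y\<in>nc_ball d. f (map2 mat_dsum X Y) = mat_dsum (f X) (f Y)) \<and>
     (\<forall>n\<ge>1. \<forall>X\<in>nc_ball_level d n. \<forall>S\<in>carrier_mat n n. \<forall>T\<in>carrier_mat n n.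
        inverts_mat S T \<and> inverts_mat T S \<and> map (\<lambda>A. T * A * S) X \<in> nc_ball_level d n \<longrightarrow>
        f (map (\<lambda>A. T * A * S) X) = T * f X * S)"

definition free_holomorphic :: "nat \<Rightarrow> (complex mat list \<Rightarrow> complex mat) \<Rightarrow> bool" where
  "free_holomorphic d f \<longleftrightarrow> nc_function d f \<and>
     (\<forall>X\<in>nc_ball d. \<exists>U. openin (free_topology d) U \<and> X \<in> U \<and>
        bdd_above ((\<lambda>Y. op_norm (f Y)) ` (U \<inter> nc_ball d)))"

definition H_infty :: "nat \<Rightarrow> (complex mat list \<Rightarrow> complex mat) set" where
  "H_infty d = {f. free_holomorphic d f \<and> bdd_above ((\<lambda>Z. op_norm (f Z)) ` nc_ball d)}"

definition H_infty_1 :: "nat \<Rightarrow> (complex mat list \<Rightarrow> complex mat) set" where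
  "H_infty_1 d = {f \<in> H_infty d. (SUP Z\<in>nc_ball d. op_norm (f Z)) \<le> 1}"

definition psd_mat :: "nat \<Rightarrow> complex mat \<Rightarrow> bool" where
  "psd_mat n A \<longleftrightarrow> A \<in> carrier_mat n n \<and>
     (\<forall>v\<in>carrier_vec n. (A *\<^sub>v v) \<bullet>c v \<in> \<real>\<^sub>\<ge>\<^sub>0)"

text \<open>The \<open>k\<close>-th ampliation applies \<open>T\<close> to each \<open>n \<times> n\<close> block of a \<open>k \<times> k\<close> block matrix.\<close>

definition mat_block :: "nat \<Rightarrow> complex mat \<Rightarrow> nat \<Rightarrow> nat \<Rightarrow> complex mat" where
  "mat_block n A r s = mat n n (\<lambda>(i, j). A $$ (r * n + i, s * n + j))"

definition ampliation ::
  "nat \<Rightarrow> nat \<Rightarrow> (complex mat \<Rightarrow> complex mat) \<Rightarrow> complex mat \<Rightarrow> complex mat" where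
  "ampliation k n T A = mat (k * n) (k * n) (\<lambda>(i, j).
     T (mat_block n A (i div n) (j div n)) $$ (i mod n, j mod n))"

definition linear_mat_map :: "nat \<Rightarrow> (complex mat \<Rightarrow> complex mat) \<Rightarrow> bool" where
  "linear_mat_map n T \<longleftrightarrow>
     (\<forall>A\<in>carrier_mat n n. T A \<in> carrier_mat n n) \<and>
     (\<forall>A\<in>carrier_mat n n. \<forall>B\<in>carrier_mat n n. T (A + B) = T A + T B) \<and>
     (\<forall>c. \<forall>A\<in>carrier_mat n n. T (c \<cdot>\<^sub>m A) = c \<cdot>\<^sub>m T A)"

definition completely_positive :: "nat \<Rightarrow> (complex mat \<Rightarrow> complex mat) \<Rightarrow> bool" where
  "completely_positive n T \<longleftrightarrow> linear_mat_map n T \<and>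
     (\<forall>k\<ge>1. \<forall>A. psd_mat (k * n) A \<longrightarrow> psd_mat (k * n) (ampliation k n T A))"

end

theory Submission
  imports Defs
begin

text \<open>
  Write \<open>K\<close> for the kernel at \<open>(Z\<^sub>0, Z\<^sub>0)\<close>, so that \<open>K(P) = P + \<Sum> Z\<^sub>t K(P) Z\<^sub>t\<^sup>* = P + \<Sum> K(Z\<^sub>t P Z\<^sub>t\<^sup>*)\<close>.

  Necessity. For \<open>A \<ge> 0\<close> the ampliation \<open>G\<close> of \<open>K\<close> at \<open>A\<close> satisfies the Stein equation
  \<open>G = A + \<Sum> Y\<^sub>t G Y\<^sub>t\<^sup>*\<close> with \<open>Y = Z\<^sub>0 \<oplus> \<dots> \<oplus> Z\<^sub>0\<close>. Hence \<open>G \<ge> 0\<close>, and if \<open>G + \<epsilon> = B B\<^sup>*\<close> then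
  \<open>B\<^sup>-\<^sup>1 Y B\<close> lies in the ball. As \<open>\<Phi>(B\<^sup>-\<^sup>1 Y B) = B\<^sup>-\<^sup>1 \<Phi>(Y) B\<close> is a contraction,
  \<open>\<Phi>(Y) (G + \<epsilon>) \<Phi>(Y)\<^sup>* \<le> G + \<epsilon>\<close>, and \<open>\<epsilon> \<rightarrow> 0\<close> gives positivity of the ampliation at \<open>A\<close>.

  Sufficiency. Let \<open>\<Gamma>(P) = K(P) - W\<^sub>0 K(P) W\<^sub>0\<^sup>*\<close> have the Kraus form \<open>\<Sum> H\<^sub>k P H\<^sub>k\<^sup>*\<close>. Then
  \<open>Q + \<Sum> \<Gamma>(Z\<^sub>t Q Z\<^sub>t\<^sup>*) = W\<^sub>0 Q W\<^sub>0\<^sup>* + \<Gamma>(Q)\<close>, which is an equality of two Gram matrices and yields scalars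
  forming a contraction with \<open>W\<^sub>0 = \<alpha> + \<Sum> \<beta>\<^sub>k\<^sub>t H\<^sub>k Z\<^sub>t\<close> and \<open>H\<^sub>l = \<gamma>\<^sub>l + \<Sum> \<delta>\<^sub>l\<^sub>,\<^sub>k\<^sub>t H\<^sub>k Z\<^sub>t\<close>. For \<open>X\<close> in the
  ball the second system, with \<open>X\<close> in place of \<open>Z\<^sub>0\<close>, has a unique solution \<open>H(X)\<close>, and
  \<open>\<Phi>(X) = \<alpha> + \<Sum> \<beta>\<^sub>k\<^sub>t H\<^sub>k(X) X\<^sub>t\<close> is the interpolating function. Uniqueness of \<open>H(X)\<close> makes it respect direct
  sums and similarities.
\<close>

section \<open>Finite families of complex numbers\<close>

text \<open>Everything stays finite dimensional. A Kraus family of n^2 members is enough and the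
  Stein identity is tested on the n^2 matrix units only, so a partial isometry between finite
  dimensional spaces serves as the colligation. Matrices act on row vectors from the right, because
  the ball condition on sum X_t X_t^* says exactly that sum |y X_t|^2 <= c |y|^2 for some c < 1. As
  H_k stands to the left of X_t, the state equation splits into independent systems, one for each
  row. The obstacle in the necessity half is that G may be singular and that its Stein equation
  yields only sum Y_t G Y_t^* <= G, without the strict bound that the ball demands. Adding
  \<epsilon> cures both: the form becomes invertible, and the strict bound on Y supplies a factor
  below 1 because G is dominated by a multiple of the identity.\<close>

lemma cmod_sum_mult_le:
  fixes f g :: "'a \<Rightarrow> complex"
  shows "(cmod (\<Sum>i\<in>A. f i * g i))\<^sup>2 \<le> (\<Sum>i\<in>A. (cmod (f i))\<^sup>2) * (\<Sum>i\<in>A. (cmod (g i))\<^sup>2)"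
proof -
  have "cmod (\<Sum>i\<in>A. f i * g i) \<le> (\<Sum>i\<in>A. \<bar>cmod (f i)\<bar> * \<bar>cmod (g i)\<bar>)"
    by (rule sum_norm_le) (simp add: norm_mult)
  also have "\<dots> \<le> L2_set (\<lambda>i. cmod (f i)) A * L2_set (\<lambda>i. cmod (g i)) A"
    by (rule L2_set_mult_ineq)
  finally have "(cmod (\<Sum>i\<in>A. f i * g i))\<^sup>2 \<le> (L2_set (\<lambda>i. cmod (f i)) A * L2_set (\<lambda>i. cmod (g i)) A)\<^sup>2"
    by (intro power_mono) auto
  also have "\<dots> = (\<Sum>i\<in>A. (cmod (f i))\<^sup>2) * (\<Sum>i\<in>A. (cmod (g i))\<^sup>2)"
    unfolding L2_set_def by (simp add: power_mult_distrib sum_nonneg)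
  finally show ?thesis .
qed

text \<open>Pairing the output with its own conjugate \<open>x\<close> moves \<open>a\<close> to the
  other side, and Cauchy-Schwarz gives N^2 <= C |y|^2 N. This exchanges bounds for column vectors,
  in which \<open>op_norm\<close> is defined, with bounds for row vectors, in which the proof
  works.\<close>

lemma transpose_bound:
  fixes a :: "'a \<Rightarrow> 'b \<Rightarrow> complex"
  assumes "C \<ge> 0"
    and bd: "\<And>x. (\<Sum>p\<in>P. (cmod (\<Sum>q\<in>Q. a p q * x q))\<^sup>2) \<le> C * (\<Sum>q\<in>Q. (cmod (x q))\<^sup>2)"
  shows "(\<Sum>q\<in>Q. (cmod (\<Sum>p\<in>P. y p * a p q))\<^sup>2) \<le> C * (\<Sum>p\<in>P. (cmod (y p))\<^sup>2)"
proof -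
  define x where "x q = cnj (\<Sum>p\<in>P. y p * a p q)" for q
  define N where "N = (\<Sum>q\<in>Q. (cmod (x q))\<^sup>2)"
  have N0: "N \<ge> 0" unfolding N_def by (intro sum_nonneg) auto
  have "complex_of_real N = (\<Sum>q\<in>Q. x q * cnj (x q))"
    by (simp only: N_def of_real_sum complex_norm_square)
  also have "\<dots> = (\<Sum>q\<in>Q. (\<Sum>p\<in>P. y p * a p q) * x q)"
    by (intro sum.cong refl) (simp only: x_def complex_cnj_cnj mult.commute)
  also have "\<dots> = (\<Sum>p\<in>P. y p * (\<Sum>q\<in>Q. a p q * x q))"
    unfolding sum_distrib_left sum_distrib_right by (subst sum.swap) (simp add: mult_ac)
  finally have "N\<^sup>2 = (cmod (\<Sum>p\<in>P. y p * (\<Sum>q\<in>Q. a p q * x q)))\<^sup>2"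
    by (metis norm_of_real power2_abs)
  also have "\<dots> \<le> (\<Sum>p\<in>P. (cmod (y p))\<^sup>2) * (\<Sum>p\<in>P. (cmod (\<Sum>q\<in>Q. a p q * x q))\<^sup>2)"
    by (rule cmod_sum_mult_le)
  also have "\<dots> \<le> (\<Sum>p\<in>P. (cmod (y p))\<^sup>2) * (C * N)"
    unfolding N_def by (intro mult_left_mono bd sum_nonneg) auto
  finally have "N * N \<le> (C * (\<Sum>p\<in>P. (cmod (y p))\<^sup>2)) * N"
    by (simp add: power2_eq_square mult_ac)
  moreover have "C * (\<Sum>p\<in>P. (cmod (y p))\<^sup>2) \<ge> 0" using assms(1) by (intro mult_nonneg_nonneg sum_nonneg) auto
  ultimately have "N \<le> C * (\<Sum>p\<in>P. (cmod (y p))\<^sup>2)"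
    using N0 by (cases "N = 0") (auto simp: mult_le_cancel_right)
  then show ?thesis unfolding N_def x_def complex_mod_cnj .
qed

section \<open>Positive semidefinite forms: entries and Cholesky factorisation\<close>

lemma nonneg_Reals_iff: "z \<in> \<real>\<^sub>\<ge>\<^sub>0 \<longleftrightarrow> Im z = 0 \<and> 0 \<le> Re z"
  by (auto simp: complex_nonneg_Reals_iff)

lemma sum_two_points:
  fixes G :: "'a \<Rightarrow> 'a \<Rightarrow> complex"
  assumes "finite S" "s \<in> S" "u \<in> S" "s \<noteq> u" and x: "x = (\<lambda>i. if i = s then a else if i = u then b else 0)"
  shows "(\<Sum>i\<in>S. \<Sum>j\<in>S. x i * G i j * cnj (x j))
    = a * G s s * cnj a + a * G s u * cnj b + b * G u s * cnj a + b * G u u * cnj b"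
proof -
  have "(\<Sum>i\<in>S. \<Sum>j\<in>S. x i * G i j * cnj (x j)) = (\<Sum>i\<in>{s,u}. \<Sum>j\<in>S. x i * G i j * cnj (x j))"
    using assms by (intro sum.mono_neutral_right) auto
  also have "\<dots> = (\<Sum>i\<in>{s,u}. \<Sum>j\<in>{s,u}. x i * G i j * cnj (x j))"
    using assms by (intro sum.cong refl sum.mono_neutral_right) auto
  finally show ?thesis using assms by simp
qed

text \<open>Vectors supported on at most two indices suffice: the coefficients 1, 1 and 1, i give
  hermitian symmetry, and a nonzero entry beside a zero diagonal entry would make the form negative
  somewhere.\<close>

lemma psd_form_entries:
  fixes G :: "'a \<Rightarrow> 'a \<Rightarrow> complex"
  assumes fin: "finite S"
    and pos: "\<And>x. (\<Sum>s\<in>S. \<Sum>u\<in>S. x s * G s u * cnj (x u)) \<in> \<real>\<^sub>\<ge>\<^sub>0"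
  shows "s \<in> S \<Longrightarrow> G s s \<in> \<real>\<^sub>\<ge>\<^sub>0"
    and "s \<in> S \<Longrightarrow> u \<in> S \<Longrightarrow> G u s = cnj (G s u)"
    and "s \<in> S \<Longrightarrow> u \<in> S \<Longrightarrow> G u u = 0 \<Longrightarrow> G s u = 0"
proof -
  show diag: "G s s \<in> \<real>\<^sub>\<ge>\<^sub>0" if "s \<in> S" for s
  proof -
    let ?x = "\<lambda>i. if i = s then 1 else 0 :: complex"
    have "(\<Sum>i\<in>S. \<Sum>j\<in>S. ?x i * G i j * cnj (?x j)) = (\<Sum>i\<in>S. if i = s then G i s else 0)"
      using fin that by (intro sum.cong refl) (simp add: if_distrib cong: if_cong)
    then show ?thesis using pos[of ?x] fin that by simp
  qed
  have two: "a * G s s * cnj a + a * G s u * cnj b + b * G u s * cnj a + b * G u u * cnj b \<in> \<real>\<^sub>\<ge>\<^sub>0"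
    if "s \<in> S" "u \<in> S" "s \<noteq> u" for s u a b
    using pos[of "\<lambda>i. if i = s then a else if i = u then b else 0"] sum_two_points[OF fin that refl, of a b G]
    by simp
  show herm: "G u s = cnj (G s u)" if "s \<in> S" "u \<in> S" for s u
  proof (cases "s = u")
    case True
    then show ?thesis using diag[OF that(1)] by (simp add: nonneg_Reals_iff complex_eq_iff)
  next
    case False
    show ?thesis
      using two[OF that False, of 1 1] two[OF that False, of 1 \<i>] diag[OF that(1)] diag[OF that(2)]
      by (simp add: nonneg_Reals_iff complex_eq_iff)
  qed
  show "G s u = 0" if "s \<in> S" "u \<in> S" "G u u = 0" for s u
  proof (rule ccontr)
    assume ne: "G s u \<noteq> 0"
    then have su: "u \<noteq> s" using that by auto
    \<comment> \<open>With coefficient \<open>- t * G s u\<close> at \<open>u\<close> and 1 at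
      \<open>s\<close> the form is G s s - 2 t |G s u|^2, and this \<open>t\<close> makes it equal
      to -1.\<close>
    define t where "t = (Re (G s s) + 1) / (2 * (cmod (G s u))\<^sup>2)"
    have h: "G u s = cnj (G s u)" using herm that by blast
    have "- 2 * t * (cmod (G s u))\<^sup>2 + Re (G s s) \<ge> 0"
      using two[OF that(2,1) su, of "- t * G s u" 1] that(3)
      unfolding h cmod_power2 nonneg_Reals_iff
      by (simp add: power2_eq_square algebra_simps)
    then show False using ne by (simp add: t_def field_simps)
  qed
qed

text \<open>Cholesky factorisation by induction on the index set: the pivot \<open>z\<close>
  contributes one column, and the Schur complement \<open>C\<close> is positive again. For a zero
  pivot the row and column of \<open>z\<close> vanish, so with x / 0 = 0 the same formulas remain
  valid.\<close>

lemma psd_form_factor: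
  fixes G :: "'a \<Rightarrow> 'a \<Rightarrow> complex"
  assumes "finite S"
    and "\<And>x. (\<Sum>s\<in>S. \<Sum>u\<in>S. x s * G s u * cnj (x u)) \<in> \<real>\<^sub>\<ge>\<^sub>0"
  obtains L where "\<And>s u. s \<in> S \<Longrightarrow> u \<in> S \<Longrightarrow> G s u = (\<Sum>k\<in>S. L s k * cnj (L u k))"
proof -
  have "\<exists>L. \<forall>s\<in>S. \<forall>u\<in>S. G s u = (\<Sum>k\<in>S. L s k * cnj (L u k))"
    using assms
  proof (induction S arbitrary: G)
    case empty
    then show ?case by simp
  next
    case (insert z S)
    have fin: "finite (insert z S)" using insert.hyps by simp
    note ent = psd_form_entries[OF fin insert.prems]
    define g where "g = Re (G z z)"
    have g0: "g \<ge> 0" and Gzz: "G z z = complex_of_real g"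
      using ent(1)[of z] by (auto simp: g_def nonneg_Reals_iff complex_eq_iff)
    have Gz: "G z s = cnj (G s z)" if "s \<in> insert z S" for s using ent(2)[of s z] that by simp
    have Gz0: "G s z = 0" if "s \<in> insert z S" "g = 0" for s using ent(3)[of s z] that Gzz by simp
    define C where "C s u = G s u - G s z * G z u / g" for s u
    have "(\<Sum>s\<in>S. \<Sum>u\<in>S. x s * C s u * cnj (x u)) \<in> \<real>\<^sub>\<ge>\<^sub>0" for x
    proof -
      define p where "p = (\<Sum>s\<in>S. x s * G s z)"
      \<comment> \<open>The value \<open>- p / g\<close> completes the square in the coordinate
        \<open>z\<close>, so that the form of \<open>G\<close> at \<open>y\<close> equals the form
        of \<open>C\<close> at \<open>x\<close>.\<close>
      define y where "y = x(z := - p / g)"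
      have yS: "y s = x s" if "s \<in> S" for s using insert.hyps that by (auto simp: y_def)
      have yz: "y z = - p / g" by (simp add: y_def)
      have cp: "(\<Sum>u\<in>S. G z u * cnj (x u)) = cnj p"
        unfolding p_def by (simp add: Gz mult_ac)
      have p0: "p = 0" if "g = 0" using Gz0 that by (simp add: p_def)
      have "(\<Sum>s\<in>insert z S. \<Sum>u\<in>insert z S. y s * G s u * cnj (y u))
          = y z * G z z * cnj (y z) + y z * (\<Sum>u\<in>S. G z u * cnj (x u))
            + (\<Sum>s\<in>S. x s * G s z) * cnj (y z) + (\<Sum>s\<in>S. \<Sum>u\<in>S. x s * G s u * cnj (x u))"
        using insert.hyps
        by (simp add: sum.distrib yS sum_distrib_left sum_distrib_right algebra_simps)
      also have "\<dots> = (\<Sum>s\<in>S. \<Sum>u\<in>S. x s * G s u * cnj (x u)) - p * cnj p / g"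
        unfolding cp p_def[symmetric] yz Gzz using p0 by (cases "g = 0") (auto simp: field_simps)
      also have "p * cnj p = (\<Sum>s\<in>S. \<Sum>u\<in>S. x s * G s z * G z u * cnj (x u))"
        unfolding cp[symmetric] unfolding p_def by (simp add: sum_product mult_ac)
      also have "(\<Sum>s\<in>S. \<Sum>u\<in>S. x s * G s u * cnj (x u)) - \<dots> / g
          = (\<Sum>s\<in>S. \<Sum>u\<in>S. x s * C s u * cnj (x u))"
        unfolding C_def sum_divide_distrib by (simp add: sum_subtractf[symmetric] algebra_simps)
      finally show ?thesis using insert.prems[of y] by simp
    qed
    from insert.IH[of C, OF this] obtain L where
      L: "\<And>s u. s \<in> S \<Longrightarrow> u \<in> S \<Longrightarrow> C s u = (\<Sum>k\<in>S. L s k * cnj (L u k))"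
      by blast
    \<comment> \<open>Column \<open>z\<close> is the scaled pivot column. The earlier columns get a
      zero in row \<open>z\<close>, where \<open>G s u - G s z * G z u / g\<close> vanishes.\<close>
    define L' where "L' s k = (if k = z then G s z / sqrt g else if s = z then 0 else L s k)" for s k
    have sq: "complex_of_real (sqrt g) * complex_of_real (sqrt g) = g"
      using g0 by (simp flip: of_real_mult)
    have "G s u = (\<Sum>k\<in>insert z S. L' s k * cnj (L' u k))" if "s \<in> insert z S" "u \<in> insert z S" for s u
    proof -
      have first: "L' s z * cnj (L' u z) = G s z * G z u / g"
        using sq by (simp add: L'_def Gz[OF that(2)] field_simps)
      have rest: "(\<Sum>k\<in>S. L' s k * cnj (L' u k)) = G s u - G s z * G z u / g"
      proof (cases "s \<in> S \<and> u \<in> S")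
        case True
        then have "(\<Sum>k\<in>S. L' s k * cnj (L' u k)) = (\<Sum>k\<in>S. L s k * cnj (L u k))"
          using insert.hyps by (intro sum.cong) (auto simp: L'_def)
        then show ?thesis using L True by (simp add: C_def)
      next
        case False
        then have "s = z \<or> u = z" using that by auto
        moreover have "(\<Sum>k\<in>S. L' s k * cnj (L' u k)) = 0"
          using insert.hyps calculation by (intro sum.neutral) (auto simp: L'_def)
        moreover have "G s u = G s z * G z u / g" if "s = z \<or> u = z"
          using that Gzz Gz0[of s] Gz0[of u] Gz[OF \<open>u \<in> insert z S\<close>] \<open>s \<in> insert z S\<close> \<open>u \<in> insert z S\<close>
          by (cases "g = 0") auto
        ultimately show ?thesis by simp
      qed
      show ?thesis using insert.hyps first rest by simp
    qed
    then show ?case by blast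
  qed
  then show ?thesis using that by blast
qed

text \<open>A square linear system with trivial kernel has nonzero determinant and is therefore
  solvable. The index set is enumerated by \<open>f\<close> so that determinants of matrices
  apply.\<close>

lemma fixpoint_equation_solvable:
  fixes M :: "'a \<Rightarrow> 'a \<Rightarrow> complex"
  assumes fin: "finite S"
    and inj: "\<And>h s. (\<And>s. s \<in> S \<Longrightarrow> h s = (\<Sum>u\<in>S. h u * M u s)) \<Longrightarrow> s \<in> S \<Longrightarrow> h s = 0"
  obtains h where "\<And>s. s \<in> S \<Longrightarrow> h s = c s + (\<Sum>u\<in>S. h u * M u s)"
proof -
  define N where "N = card S"
  obtain f where f: "bij_betw f {..<N} S"
    using ex_bij_betw_nat_finite[OF fin] unfolding N_def lessThan_atLeast0 by blast
  define g where "g = inv_into {..<N} f"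
  have gf: "g (f i) = i" if "i < N" for i
    unfolding g_def using f that by (simp add: bij_betw_def)
  have g: "f (g s) = s" "g s < N" if "s \<in> S" for s
  proof -
    have s: "s \<in> f ` {..<N}" using that bij_betw_imp_surj_on[OF f] by simp
    show "f (g s) = s" unfolding g_def by (rule f_inv_into_f[OF s])
    show "g s < N" using inv_into_into[OF s] by (simp add: g_def)
  qed
  have sums: "(\<Sum>u\<in>S. F u) = (\<Sum>j<N. F (f j))" for F :: "'a \<Rightarrow> complex"
    by (rule sum.reindex_bij_betw[OF f, symmetric])
  \<comment> \<open>The unknown multiplies \<open>M\<close> from the left, whereas \<open>A\<close>
    acts on columns; hence the transposed order of the indices.\<close>
  define A where "A = mat N N (\<lambda>(i, j). (if i = j then 1 else 0) - M (f j) (f i))"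
  have A: "A \<in> carrier_mat N N" by (simp add: A_def)
  have Av: "(A *\<^sub>v v) $ i = v $ i - (\<Sum>j<N. v $ j * M (f j) (f i))"
    if "v \<in> carrier_vec N" "i < N" for v i
  proof -
    have "(A *\<^sub>v v) $ i = (\<Sum>j<N. ((if i = j then 1 else 0) - M (f j) (f i)) * v $ j)"
      using that by (simp add: A_def scalar_prod_def lessThan_atLeast0)
    also have "\<dots> = (\<Sum>j<N. (if i = j then v $ j else 0)) - (\<Sum>j<N. v $ j * M (f j) (f i))"
      by (simp only: sum_subtractf[symmetric]) (intro sum.cong, auto simp: algebra_simps)
    finally show ?thesis using that by simp
  qed
  have "det A \<noteq> 0"
  proof
    assume "det A = 0"
    then obtain v where v: "v \<in> carrier_vec N" "v \<noteq> 0\<^sub>v N" "A *\<^sub>v v = 0\<^sub>v N"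
      using det_0_iff_vec_prod_zero_field[OF A] by blast
    have eq: "v $ i = (\<Sum>j<N. v $ j * M (f j) (f i))" if "i < N" for i
      using Av[OF v(1) that] v(3) that by simp
    have "v $ g s = 0" if "s \<in> S" for s
    proof (rule inj[of "\<lambda>s. v $ g s"])
      show "v $ g s = (\<Sum>u\<in>S. v $ g u * M u s)" if "s \<in> S" for s
        using eq[OF g(2)[OF that]] g(1)[OF that] by (simp add: sums gf)
    qed (rule that)
    then have "v $ i = 0" if "i < N" for i
      using that f gf[OF that] by (metis bij_betwE lessThan_iff)
    then show False using v by (metis eq_vecI carrier_vecD index_zero_vec)
  qed
  then obtain B where B: "inverts_mat A B" "B \<in> carrier_mat N N"
    using det_non_zero_imp_unit[OF A] unfolding Units_def ring_mat_def inverts_mat_def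
    using A by auto
  define v where "v = B *\<^sub>v vec N (\<lambda>i. c (f i))"
  have v: "v \<in> carrier_vec N" using B by (simp add: v_def)
  have "A *\<^sub>v v = vec N (\<lambda>i. c (f i))"
    using B A unfolding v_def inverts_mat_def
    by (metis assoc_mult_mat_vec carrier_matD(1) one_mult_mat_vec vec_carrier)
  then have eq: "v $ i = c (f i) + (\<Sum>j<N. v $ j * M (f j) (f i))" if "i < N" for i
    using Av[OF v that] that by (simp add: algebra_simps)
  have "v $ g s = c s + (\<Sum>u\<in>S. v $ g u * M u s)" if "s \<in> S" for s
    unfolding sums eq[OF g(2)[OF that]] g(1)[OF that] by (simp add: gf)
  then show ?thesis by (rule that)
qed

text \<open>
  The invariant \<open>piso\<close> says that \<open>U\<close> is the partial isometry with initial space spanned by the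
  vectors \<open>v t\<close> and final space spanned by the vectors \<open>w t\<close>.
\<close>

lemma contraction_of_equal_gram:
  fixes v :: "'t \<Rightarrow> 'p \<Rightarrow> complex" and w :: "'t \<Rightarrow> 'r \<Rightarrow> complex"
  assumes "finite T" and finP: "finite P" and finR: "finite R"
    and "\<And>s t. s \<in> T \<Longrightarrow> t \<in> T \<Longrightarrow> (\<Sum>p\<in>P. v s p * cnj (v t p)) = (\<Sum>i\<in>R. w s i * cnj (w t i))"
  obtains U :: "'r \<Rightarrow> 'p \<Rightarrow> complex"
  where "\<And>t i. t \<in> T \<Longrightarrow> i \<in> R \<Longrightarrow> (\<Sum>p\<in>P. U i p * v t p) = w t i"
    and "\<And>x. (\<Sum>i\<in>R. (cmod (\<Sum>p\<in>P. U i p * x p))\<^sup>2) \<le> (\<Sum>p\<in>P. (cmod (x p))\<^sup>2)"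
proof -
  define ipP where "ipP x y = (\<Sum>p\<in>P. x p * cnj (y p))" for x y :: "'p \<Rightarrow> complex"
  define ipR where "ipR x y = (\<Sum>i\<in>R. x i * cnj (y i))" for x y :: "'r \<Rightarrow> complex"
  define op where "op U x = (\<lambda>i. \<Sum>p\<in>P. U i p * x p)" for U :: "'r \<Rightarrow> 'p \<Rightarrow> complex" and x
  define ad where "ad U y = (\<lambda>p. \<Sum>i\<in>R. cnj (U i p) * y i)" for U :: "'r \<Rightarrow> 'p \<Rightarrow> complex" and y
  have adj: "ipR (op U x) y = ipP x (ad U y)" for U x y
  proof -
    have "ipR (op U x) y = (\<Sum>i\<in>R. \<Sum>p\<in>P. U i p * x p * cnj (y i))"
      by (simp only: ipR_def op_def sum_distrib_right)
    also have "\<dots> = (\<Sum>p\<in>P. \<Sum>i\<in>R. U i p * x p * cnj (y i))" by (rule sum.swap)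
    also have "\<dots> = (\<Sum>p\<in>P. x p * cnj (\<Sum>i\<in>R. cnj (U i p) * y i))"
      by (simp add: sum_distrib_left mult.assoc mult.left_commute)
    finally show ?thesis by (simp only: ipP_def ad_def)
  qed
  have cP: "ipP x y = cnj (ipP y x)" and cR: "ipR x' y' = cnj (ipR y' x')" for x y x' y'
    by (simp_all add: ipP_def ipR_def mult_ac)
  have adj': "ipP (ad U y) x = ipR y (op U x)" for U x y
    by (metis adj cP cR)
  have subP: "ipP (\<lambda>p. x p - y p) z = ipP x z - ipP y z" "ipP z (\<lambda>p. x p - y p) = ipP z x - ipP z y" for x y z
    by (simp_all add: ipP_def sum_subtractf algebra_simps)
  have subR: "ipR (\<lambda>p. x p - y p) z = ipR x z - ipR y z" "ipR z (\<lambda>p. x p - y p) = ipR z x - ipR z y" for x y z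
    by (simp_all add: ipR_def sum_subtractf algebra_simps)
  have ad_sub: "ad U (\<lambda>p. x p - y p) = (\<lambda>p. ad U x p - ad U y p)" for U x y
    by (simp add: ad_def sum_subtractf algebra_simps)
  have op_sub: "op U (\<lambda>p. x p - y p) = (\<lambda>p. op U x p - op U y p)" for U x y
    by (simp add: op_def sum_subtractf algebra_simps)
  have congP: "ipP x y = ipP x' y'" if "\<And>p. p \<in> P \<Longrightarrow> x p = x' p" "\<And>p. p \<in> P \<Longrightarrow> y p = y' p" for x y x' y'
    unfolding ipP_def using that by (intro sum.cong) auto
  have congR: "ipR x y = ipR x' y'" if "\<And>p. p \<in> R \<Longrightarrow> x p = x' p" "\<And>p. p \<in> R \<Longrightarrow> y p = y' p" for x y x' y'
    unfolding ipR_def using that by (intro sum.cong) auto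
  have ipP_self: "ipP x x = complex_of_real (\<Sum>p\<in>P. (cmod (x p))\<^sup>2)" for x
    by (simp add: ipP_def complex_norm_square del: of_real_power)
  have ipR_self: "ipR x x = complex_of_real (\<Sum>p\<in>R. (cmod (x p))\<^sup>2)" for x
    by (simp add: ipR_def complex_norm_square del: of_real_power)
  have ipP_0: "x p = 0" if "ipP x x = 0" "p \<in> P" for x p
    using that finP unfolding ipP_self of_real_eq_0_iff by (simp add: sum_nonneg_eq_0_iff)
  have ipR_0: "x p = 0" if "ipR x x = 0" "p \<in> R" for x p
    using that finR unfolding ipR_self of_real_eq_0_iff by (simp add: sum_nonneg_eq_0_iff)
  have zeroP: "ipP x y = 0" if "\<And>p. p \<in> P \<Longrightarrow> y p = 0" for x y
    using that by (simp add: ipP_def)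
  have zeroR: "ipR x y = 0" if "\<And>p. p \<in> R \<Longrightarrow> y p = 0" for x y
    using that by (simp add: ipR_def)
  define piso where "piso U T \<longleftrightarrow>
      (\<forall>t\<in>T. \<forall>i\<in>R. op U (v t) i = w t i) \<and> (\<forall>t\<in>T. \<forall>p\<in>P. ad U (w t) p = v t p) \<and>
      (\<forall>x. (\<forall>t\<in>T. ipP x (v t) = 0) \<longrightarrow> (\<forall>i\<in>R. op U x i = 0)) \<and>
      (\<forall>y. (\<forall>t\<in>T. ipR y (w t) = 0) \<longrightarrow> (\<forall>p\<in>P. ad U y p = 0))" for U T
  \<comment> \<open>The adjoint of \<open>U\<close> composed with \<open>U\<close> fixes every
    \<open>v t\<close>, so it acts as the projection onto their span and leaves a remainder
    orthogonal to them.\<close>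
  have orthP: "ipP (\<lambda>p. x p - ad U (op U x) p) (v t) = 0" if "piso U T" "t \<in> T" for U T x t
  proof -
    have "ipP (ad U (op U x)) (v t) = ipR (op U x) (op U (v t))"
      by (rule adj')
    also have "\<dots> = ipR (op U x) (w t)" using that by (intro congR) (auto simp: piso_def)
    also have "\<dots> = ipP x (ad U (w t))" by (rule adj)
    also have "\<dots> = ipP x (v t)" using that by (intro congP) (auto simp: piso_def)
    finally show ?thesis by (simp add: subP)
  qed
  have "\<exists>U. piso U T"
    using assms(1,4)
  proof (induction T)
    case empty
    have "piso (\<lambda>_ _. 0) {}" by (simp add: piso_def op_def ad_def)
    then show ?case by blast
  next
    case (insert z T)
    then obtain U where U: "piso U T" by blast
    have gram: "ipP (v s) (v t) = ipR (w s) (w t)" if "s \<in> insert z T" "t \<in> insert z T" for s t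
      using insert.prems that by (simp add: ipP_def ipR_def)
    \<comment> \<open>\<open>e\<close> is the part of \<open>v z\<close> outside the initial space
      of \<open>U\<close> and \<open>f\<close> the part of \<open>w z\<close> outside the final
      space. For \<open>f\<close> this rests on the equality of Gram entries between
      \<open>z\<close> and the earlier indices.\<close>
    define e where "e = (\<lambda>p. v z p - ad U (op U (v z)) p)"
    define f where "f = (\<lambda>i. w z i - op U (v z) i)"
    have eT: "ipP e (v t) = 0" if "t \<in> T" for t unfolding e_def by (rule orthP[OF U that])
    have fT: "ipR f (w t) = 0" if "t \<in> T" for t
    proof -
      have "ipR (op U (v z)) (w t) = ipP (v z) (ad U (w t))" by (rule adj)
      also have "\<dots> = ipP (v z) (v t)" using U that by (intro congP) (auto simp: piso_def)
      finally show ?thesis by (simp add: f_def subR gram that)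
    qed
    have Ue: "op U e i = 0" if "i \<in> R" for i using U eT that unfolding piso_def by blast
    have Uf: "ad U f p = 0" if "p \<in> P" for p using U fT that unfolding piso_def by blast
    have fU: "ipR (op U x) f = 0" for x unfolding adj by (rule zeroP) (rule Uf)
    have eU: "ipP (ad U y) e = 0" for y
      unfolding adj' by (rule zeroR) (rule Ue)
    have ez: "ipP (v z) e = ipP e e" using eU by (simp add: e_def subP)
    have fz: "ipR (w z) f = ipR f f" using fU by (simp add: f_def subR)
    have "ipP e e = ipP (v z) (v z) - ipP (v z) (ad U (op U (v z)))"
      unfolding ez[symmetric] by (simp add: e_def subP)
    then have ee: "ipP e e = ipP (v z) (v z) - ipR (op U (v z)) (op U (v z))" by (simp add: adj)
    have "ipR (w z) (op U (v z)) = cnj (ipR (op U (v z)) (w z))" by (rule cR)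
    also have "ipR (op U (v z)) (w z) = ipR (op U (v z)) (\<lambda>i. f i + op U (v z) i)"
      by (simp add: f_def)
    also have "\<dots> = ipR (op U (v z)) f + ipR (op U (v z)) (op U (v z))"
      by (simp add: ipR_def sum.distrib algebra_simps)
    also have "cnj \<dots> = ipR (op U (v z)) (op U (v z))" using fU by (simp add: cR[symmetric])
    finally have "ipR f f = ipR (w z) (w z) - ipR (op U (v z)) (op U (v z))"
      unfolding fz[symmetric] by (simp add: f_def subR)
    with ee have ef: "ipP e e = ipR f f" by (simp add: gram)
    \<comment> \<open>The correction is the rank one partial isometry taking \<open>e\<close> to
      \<open>f\<close>, which have equal norms by \<open>ef\<close>. If \<open>e\<close> vanishes
      then so does \<open>f\<close>, and division by zero leaves \<open>U\<close> unchanged.\<close>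
    define U' where "U' i p = U i p + f i * cnj (e p) / ipP e e" for i p
    have opU': "op U' x i = op U x i + f i * ipP x e / ipP e e" for x i
      by (simp add: op_def U'_def ipP_def sum.distrib algebra_simps sum_distrib_left sum_divide_distrib)
    have ee_real: "cnj (ipP e e) = ipP e e" by (rule cP[symmetric])
    have adU': "ad U' y p = ad U y p + e p * ipR y f / ipP e e" for y p
      by (simp add: ad_def U'_def ipR_def sum.distrib ee_real algebra_simps sum_distrib_left sum_divide_distrib)
    have e0: "e p = 0" if "ipP e e = 0" "p \<in> P" for p using ipP_0 that .
    have f0: "f i = 0" if "ipP e e = 0" "i \<in> R" for i using ipR_0 that ef by simp
    have "piso U' (insert z T)"
      unfolding piso_def
    proof (intro conjI ballI allI impI)
      fix t i assume t: "t \<in> insert z T" and i: "i \<in> R"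
      show "op U' (v t) i = w t i"
      proof (cases "t = z")
        case True
        then show ?thesis using f0[OF _ i] unfolding opU' True ez by (cases "ipP e e = 0") (auto simp: f_def)
      next
        case False
        then have "ipP (v t) e = 0" using eT[of t] t cP[of "v t" e] by simp
        then show ?thesis using False t i U unfolding opU' by (auto simp: piso_def)
      qed
    next
      fix t p assume t: "t \<in> insert z T" and p: "p \<in> P"
      show "ad U' (w t) p = v t p"
      proof (cases "t = z")
        case True
        have "ad U (w z) p = ad U (op U (v z)) p"
          using Uf[OF p] unfolding f_def ad_sub by simp
        then show ?thesis using e0[OF _ p] unfolding adU' True fz ef[symmetric]
          by (cases "ipP e e = 0") (auto simp: e_def)
      next
        case False
        then have "ipR (w t) f = 0" using fT[of t] t cR[of "w t" f] by simp
        then show ?thesis using False t p U unfolding adU' by (auto simp: piso_def)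
      qed
    next
      fix x i assume x: "\<forall>t\<in>insert z T. ipP x (v t) = 0" and i: "i \<in> R"
      have Ux: "op U x i = 0" if "i \<in> R" for i using U x that unfolding piso_def by blast
      have "ipP x (ad U (op U (v z))) = 0"
        unfolding adj[symmetric] by (subst cR) (simp add: zeroR Ux)
      then have "ipP x e = 0" using x by (simp add: e_def subP)
      then show "op U' x i = 0" using Ux[OF i] by (simp add: opU')
    next
      fix y p assume y: "\<forall>t\<in>insert z T. ipR y (w t) = 0" and p: "p \<in> P"
      have Uy: "ad U y p = 0" if "p \<in> P" for p using U y that unfolding piso_def by blast
      have "ipR (op U (v z)) y = 0" unfolding adj by (simp add: zeroP Uy)
      then have "ipR y (op U (v z)) = 0" using cR[of y] by simp
      then have "ipR y f = 0" using y by (simp add: f_def subR)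
      then show "ad U' y p = 0" using Uy[OF p] by (simp add: adU')
    qed
    then show ?case by blast
  qed
  then obtain U where U: "piso U T" by blast
  show ?thesis
  proof (rule that)
    show "(\<Sum>p\<in>P. U i p * v t p) = w t i" if "t \<in> T" "i \<in> R" for t i
      using U that by (auto simp: piso_def op_def)
    show "(\<Sum>i\<in>R. (cmod (\<Sum>p\<in>P. U i p * x p))\<^sup>2) \<le> (\<Sum>p\<in>P. (cmod (x p))\<^sup>2)" for x
    proof -
      \<comment> \<open>\<open>a\<close> is the projection of \<open>x\<close> to the initial space;
        Pythagoras then gives |U x|^2 = |x|^2 - |e|^2.\<close>
      define a where "a = ad U (op U x)"
      define e where "e = (\<lambda>p. x p - a p)"
      have Ue: "op U e i = 0" if "i \<in> R" for i
        using U orthP[OF U, of _ x] that unfolding piso_def e_def a_def by blast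
      have "ipP e a = 0" unfolding a_def adj[symmetric] by (subst cR) (simp add: zeroR Ue)
      then have "ipP e e = ipP e x" by (subst (2) e_def) (simp add: subP)
      also have "\<dots> = ipP x x - ipP a x" by (simp add: e_def subP)
      also have "ipP a x = cnj (ipP x a)" by (rule cP)
      also have "ipP x a = ipR (op U x) (op U x)" by (simp add: a_def adj)
      also have "cnj \<dots> = ipR (op U x) (op U x)" by (rule cR[symmetric])
      finally have "ipR (op U x) (op U x) = ipP x x - ipP e e" by simp
      then have "(\<Sum>i\<in>R. (cmod (op U x i))\<^sup>2) = (\<Sum>p\<in>P. (cmod (x p))\<^sup>2) - (\<Sum>p\<in>P. (cmod (e p))\<^sup>2)"
        unfolding ipP_self ipR_self by (simp only: of_real_diff[symmetric] of_real_eq_iff)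
      moreover have "(\<Sum>p\<in>P. (cmod (e p))\<^sup>2) \<ge> 0" by (intro sum_nonneg) auto
      ultimately show ?thesis by (simp add: op_def)
    qed
  qed
qed

section \<open>Row actions, quadratic forms and the row ball\<close>

definition sqnorm :: "nat \<Rightarrow> (nat \<Rightarrow> complex) \<Rightarrow> real" where
  "sqnorm n y = (\<Sum>p<n. (cmod (y p))\<^sup>2)"

definition row_act :: "nat \<Rightarrow> (nat \<Rightarrow> complex) \<Rightarrow> complex mat \<Rightarrow> nat \<Rightarrow> complex" where
  "row_act n y A q = (\<Sum>p<n. y p * A $$ (p, q))"

definition qform :: "nat \<Rightarrow> complex mat \<Rightarrow> (nat \<Rightarrow> complex) \<Rightarrow> complex" where
  "qform n G y = (\<Sum>p<n. \<Sum>q<n. y p * G $$ (p, q) * cnj (y q))"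

text \<open>This is the inequality sum X_t X_t^* <= c between hermitian forms, evaluated at the row
  vector \<open>y\<close>. An explicit \<open>c\<close> below 1 is what geometric series and
  iterations use.\<close>

definition row_bound :: "nat \<Rightarrow> real \<Rightarrow> complex mat list \<Rightarrow> bool" where
  "row_bound n c X \<longleftrightarrow> (\<forall>y. (\<Sum>t<length X. sqnorm n (row_act n y (X ! t))) \<le> c * sqnorm n y)"

text \<open>The size is an argument so that the empty sum has a definite dimension.\<close>

definition mat_sum :: "nat \<Rightarrow> ('a \<Rightarrow> complex mat) \<Rightarrow> 'a set \<Rightarrow> complex mat" where
  "mat_sum n F S = mat n n (\<lambda>(i, j). \<Sum>s\<in>S. F s $$ (i, j))"

lemma mat_sum_carrier [simp]: "mat_sum n F S \<in> carrier_mat n n"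
  by (simp add: mat_sum_def)

lemma mat_sum_dim [simp]: "dim_row (mat_sum n F S) = n" "dim_col (mat_sum n F S) = n"
  by (simp_all add: mat_sum_def)

lemma mat_sum_index [simp]: "i < n \<Longrightarrow> j < n \<Longrightarrow> mat_sum n F S $$ (i, j) = (\<Sum>s\<in>S. F s $$ (i, j))"
  by (simp add: mat_sum_def)

lemma mat_sum_cong: "(\<And>s. s \<in> S \<Longrightarrow> F s = G s) \<Longrightarrow> mat_sum n F S = mat_sum n G S"
  by (simp add: mat_sum_def cong: sum.cong)

lemma mult_mat_index:
  assumes "A \<in> carrier_mat l m" "B \<in> carrier_mat m n" "i < l" "j < n"
  shows "(A * B) $$ (i, j) = (\<Sum>p<m. A $$ (i, p) * B $$ (p, j))"
  using assms by (simp add: scalar_prod_def lessThan_atLeast0)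

lemma mat_adjoint_carrier [simp]: "A \<in> carrier_mat m n \<Longrightarrow> mat_adjoint A \<in> carrier_mat n m"
  by (auto simp: mat_adjoint_def)

lemma mat_adjoint_index [simp]:
  "A \<in> carrier_mat m n \<Longrightarrow> i < n \<Longrightarrow> j < m \<Longrightarrow> mat_adjoint A $$ (i, j) = cnj (A $$ (j, i))"
  by (auto simp: mat_adjoint_def mat_of_rows_index)

lemma conj_mat_index:
  assumes "A \<in> carrier_mat n n" "G \<in> carrier_mat n n" "B \<in> carrier_mat n n" "i < n" "j < n"
  shows "(A * G * mat_adjoint B) $$ (i, j) = (\<Sum>p<n. \<Sum>q<n. A $$ (i, p) * G $$ (p, q) * cnj (B $$ (j, q)))"
proof -
  have "(A * G * mat_adjoint B) $$ (i, j) = (\<Sum>q<n. (A * G) $$ (i, q) * cnj (B $$ (j, q)))"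
    using assms by (subst mult_mat_index[of _ n n _ n]) auto
  also have "\<dots> = (\<Sum>q<n. \<Sum>p<n. A $$ (i, p) * G $$ (p, q) * cnj (B $$ (j, q)))"
    using assms by (intro sum.cong refl) (subst mult_mat_index[of _ n n _ n], auto simp: sum_distrib_right)
  finally show ?thesis by (subst sum.swap)
qed

lemma mat_mult_mat_sum:
  assumes "A \<in> carrier_mat n n" "\<And>s. s \<in> S \<Longrightarrow> F s \<in> carrier_mat n n"
  shows "A * mat_sum n F S = mat_sum n (\<lambda>s. A * F s) S"
proof (rule eq_matI)
  fix i j assume ij: "i < dim_row (mat_sum n (\<lambda>s. A * F s) S)" "j < dim_col (mat_sum n (\<lambda>s. A * F s) S)"
  then have ij: "i < n" "j < n" by (simp_all add: mat_sum_def)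
  have "(A * mat_sum n F S) $$ (i, j) = (\<Sum>p<n. A $$ (i, p) * (\<Sum>s\<in>S. F s $$ (p, j)))"
    using assms ij by (subst mult_mat_index[of _ n n _ n]) auto
  also have "\<dots> = (\<Sum>s\<in>S. \<Sum>p<n. A $$ (i, p) * F s $$ (p, j))"
    unfolding sum_distrib_left by (rule sum.swap)
  also have "\<dots> = (\<Sum>s\<in>S. (A * F s) $$ (i, j))"
    using assms ij by (intro sum.cong refl) (subst mult_mat_index[of _ n n _ n], auto)
  finally show "(A * mat_sum n F S) $$ (i, j) = mat_sum n (\<lambda>s. A * F s) S $$ (i, j)"
    using ij by simp
qed (use assms in \<open>auto simp: mat_sum_def\<close>)

lemma mat_sum_mult_mat:
  assumes "A \<in> carrier_mat n n" "\<And>s. s \<in> S \<Longrightarrow> F s \<in> carrier_mat n n"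
  shows "mat_sum n F S * A = mat_sum n (\<lambda>s. F s * A) S"
proof (rule eq_matI)
  fix i j assume ij: "i < dim_row (mat_sum n (\<lambda>s. F s * A) S)" "j < dim_col (mat_sum n (\<lambda>s. F s * A) S)"
  then have ij: "i < n" "j < n" by (simp_all add: mat_sum_def)
  have "(mat_sum n F S * A) $$ (i, j) = (\<Sum>p<n. (\<Sum>s\<in>S. F s $$ (i, p)) * A $$ (p, j))"
    using assms ij by (subst mult_mat_index[of _ n n _ n]) auto
  also have "\<dots> = (\<Sum>s\<in>S. \<Sum>p<n. F s $$ (i, p) * A $$ (p, j))"
    unfolding sum_distrib_right by (rule sum.swap)
  also have "\<dots> = (\<Sum>s\<in>S. (F s * A) $$ (i, j))"
    using assms ij by (intro sum.cong refl) (subst mult_mat_index[of _ n n _ n], auto)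
  finally show "(mat_sum n F S * A) $$ (i, j) = mat_sum n (\<lambda>s. F s * A) S $$ (i, j)"
    using ij by simp
qed (use assms in \<open>auto simp: mat_sum_def\<close>)

lemma sqnorm_nonneg [simp]: "0 \<le> sqnorm n y"
  by (simp add: sqnorm_def sum_nonneg)

lemma sqnorm_cong: "(\<And>p. p < n \<Longrightarrow> x p = y p) \<Longrightarrow> sqnorm n x = sqnorm n y"
  by (simp add: sqnorm_def)

lemma row_act_cong: "(\<And>p. p < n \<Longrightarrow> x p = y p) \<Longrightarrow> row_act n x A = row_act n y A"
  by (simp add: row_act_def fun_eq_iff)

lemma row_act_mult:
  assumes "A \<in> carrier_mat n n" "B \<in> carrier_mat n n" "q < n"
  shows "row_act n y (A * B) q = row_act n (row_act n y A) B q"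
proof -
  have "row_act n y (A * B) q = (\<Sum>p<n. \<Sum>r<n. y p * A $$ (p, r) * B $$ (r, q))"
    unfolding row_act_def using assms
    by (intro sum.cong refl) (subst mult_mat_index[of _ n n _ n], auto simp: sum_distrib_left mult_ac)
  also have "\<dots> = (\<Sum>r<n. \<Sum>p<n. y p * A $$ (p, r) * B $$ (r, q))" by (rule sum.swap)
  finally show ?thesis by (simp add: row_act_def sum_distrib_right)
qed

lemma row_act_one: "q < n \<Longrightarrow> row_act n y (1\<^sub>m n) q = y q"
proof -
  assume "q < n"
  have "row_act n y (1\<^sub>m n) q = (\<Sum>p<n. if p = q then y p else 0)"
    unfolding row_act_def using \<open>q < n\<close> by (intro sum.cong) auto
  then show ?thesis using \<open>q < n\<close> by simp
qed

lemma row_act_unit: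
  assumes "i < n" shows "row_act n (\<lambda>p. if p = i then 1 else 0) A q = A $$ (i, q)"
proof -
  have "row_act n (\<lambda>p. if p = i then 1 else 0) A q = (\<Sum>p<n. if p = i then A $$ (p, q) else 0)"
    unfolding row_act_def by (intro sum.cong) auto
  then show ?thesis using assms by simp
qed

lemma sum_swap_pairs:
  fixes F :: "'a \<Rightarrow> 'b \<Rightarrow> 'c \<Rightarrow> 'e \<Rightarrow> 'f::comm_monoid_add"
  shows "(\<Sum>i\<in>A. \<Sum>j\<in>B. \<Sum>p\<in>C. \<Sum>q\<in>D. F i j p q) = (\<Sum>p\<in>C. \<Sum>q\<in>D. \<Sum>i\<in>A. \<Sum>j\<in>B. F i j p q)"
proof -
  have "(\<Sum>i\<in>A. \<Sum>j\<in>B. \<Sum>p\<in>C. \<Sum>q\<in>D. F i j p q) = (\<Sum>i\<in>A. \<Sum>p\<in>C. \<Sum>j\<in>B. \<Sum>q\<in>D. F i j p q)"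
    by (intro sum.cong refl sum.swap)
  also have "\<dots> = (\<Sum>p\<in>C. \<Sum>i\<in>A. \<Sum>j\<in>B. \<Sum>q\<in>D. F i j p q)" by (rule sum.swap)
  also have "\<dots> = (\<Sum>p\<in>C. \<Sum>i\<in>A. \<Sum>q\<in>D. \<Sum>j\<in>B. F i j p q)"
    by (intro sum.cong refl sum.swap)
  also have "\<dots> = (\<Sum>p\<in>C. \<Sum>q\<in>D. \<Sum>i\<in>A. \<Sum>j\<in>B. F i j p q)"
    by (intro sum.cong refl sum.swap)
  finally show ?thesis .
qed

text \<open>Two different vectors are allowed because the Gram matrix of the lurking isometry pairs
  different rows of a Kraus operator; the quadratic case is \<open>qform_conj\<close>.\<close>

lemma sesquilinear_conj:
  assumes "A \<in> carrier_mat n n" "G \<in> carrier_mat n n"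
  shows "(\<Sum>p<n. \<Sum>q<n. x p * (A * G * mat_adjoint A) $$ (p, q) * cnj (z q))
    = (\<Sum>p<n. \<Sum>q<n. row_act n x A p * G $$ (p, q) * cnj (row_act n z A q))"
proof -
  have "(\<Sum>p<n. \<Sum>q<n. x p * (A * G * mat_adjoint A) $$ (p, q) * cnj (z q))
      = (\<Sum>i<n. \<Sum>j<n. \<Sum>p<n. \<Sum>q<n. x i * A $$ (i, p) * G $$ (p, q) * cnj (A $$ (j, q) * z j))"
    using assms
    by (intro sum.cong refl) (subst conj_mat_index[of _ n], auto simp: sum_distrib_left sum_distrib_right mult_ac)
  also have "\<dots> = (\<Sum>p<n. \<Sum>q<n. \<Sum>i<n. \<Sum>j<n. x i * A $$ (i, p) * G $$ (p, q) * cnj (A $$ (j, q) * z j))"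
    by (rule sum_swap_pairs)
  also have "\<dots> = (\<Sum>p<n. \<Sum>q<n. row_act n x A p * G $$ (p, q) * cnj (row_act n z A q))"
    unfolding row_act_def
    by (simp add: sum_distrib_left sum_distrib_right mult_ac)
  finally show ?thesis .
qed

lemma qform_conj:
  assumes "A \<in> carrier_mat n n" "G \<in> carrier_mat n n"
  shows "qform n (A * G * mat_adjoint A) y = qform n G (row_act n y A)"
  unfolding qform_def by (rule sesquilinear_conj[OF assms])

lemma qform_one: "qform n (1\<^sub>m n) y = of_real (sqnorm n y)"
proof -
  have "qform n (1\<^sub>m n) y = (\<Sum>p<n. \<Sum>q<n. if q = p then y p * cnj (y q) else 0)"
    unfolding qform_def by (intro sum.cong refl) auto
  then show ?thesis by (simp add: sqnorm_def complex_norm_square del: of_real_power)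
qed

lemma qform_add:
  assumes "A \<in> carrier_mat n n" "B \<in> carrier_mat n n"
  shows "qform n (A + B) y = qform n A y + qform n B y"
  using assms by (simp add: qform_def algebra_simps sum.distrib)

lemma qform_diff:
  assumes "A \<in> carrier_mat n n" "B \<in> carrier_mat n n"
  shows "qform n (A - B) y = qform n A y - qform n B y"
  using assms by (simp add: qform_def algebra_simps sum_subtractf)

lemma qform_smult:
  assumes "A \<in> carrier_mat n n"
  shows "qform n (c \<cdot>\<^sub>m A) y = c * qform n A y"
  using assms by (simp add: qform_def sum_distrib_left mult_ac)

lemma qform_mat_sum: "qform n (mat_sum n F S) y = (\<Sum>s\<in>S. qform n (F s) y)"
proof -
  have "qform n (mat_sum n F S) y = (\<Sum>p<n. \<Sum>q<n. \<Sum>s\<in>S. y p * F s $$ (p, q) * cnj (y q))"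
    unfolding qform_def by (intro sum.cong refl) (simp add: sum_distrib_left sum_distrib_right)
  also have "\<dots> = (\<Sum>p<n. \<Sum>s\<in>S. \<Sum>q<n. y p * F s $$ (p, q) * cnj (y q))"
    by (intro sum.cong refl sum.swap)
  also have "\<dots> = (\<Sum>s\<in>S. qform n (F s) y)" unfolding qform_def by (rule sum.swap)
  finally show ?thesis .
qed

text \<open>The row vector \<open>y\<close> is the adjoint of the column vector \<open>v\<close>,
  which turns the inner product of A v with v into the form at \<open>y\<close>.\<close>

lemma psd_mat_iff_qform:
  assumes A: "A \<in> carrier_mat n n"
  shows "psd_mat n A \<longleftrightarrow> (\<forall>y. qform n A y \<in> \<real>\<^sub>\<ge>\<^sub>0)"
proof -
  have eq: "(A *\<^sub>v v) \<bullet>c v = qform n A y" if "v \<in> carrier_vec n" "\<And>i. i < n \<Longrightarrow> v $ i = cnj (y i)" for v y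
  proof -
    have "(A *\<^sub>v v) \<bullet>c v = (\<Sum>p<n. (\<Sum>q<n. A $$ (p, q) * cnj (y q)) * y p)"
      using A that by (simp add: scalar_prod_def lessThan_atLeast0)
    then show ?thesis by (simp add: qform_def sum_distrib_left sum_distrib_right mult_ac)
  qed
  show ?thesis
  proof
    assume psd: "psd_mat n A"
    show "\<forall>y. qform n A y \<in> \<real>\<^sub>\<ge>\<^sub>0"
    proof
      fix y
      let ?v = "vec n (\<lambda>i. cnj (y i))"
      have "(A *\<^sub>v ?v) \<bullet>c ?v = qform n A y" by (rule eq) simp_all
      moreover have "(A *\<^sub>v ?v) \<bullet>c ?v \<in> \<real>\<^sub>\<ge>\<^sub>0" using psd unfolding psd_mat_def by (metis vec_carrier)
      ultimately show "qform n A y \<in> \<real>\<^sub>\<ge>\<^sub>0" by metis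
    qed
  next
    assume q: "\<forall>y. qform n A y \<in> \<real>\<^sub>\<ge>\<^sub>0"
    show "psd_mat n A"
      unfolding psd_mat_def
    proof (intro conjI ballI A)
      fix v :: "complex vec" assume "v \<in> carrier_vec n"
      then show "(A *\<^sub>v v) \<bullet>c v \<in> \<real>\<^sub>\<ge>\<^sub>0" using q eq[of v "\<lambda>i. cnj (v $ i)"] by simp
    qed
  qed
qed

section \<open>The operator norm on column vectors and on row vectors\<close>

lemma vec_norm2_power2: "v \<in> carrier_vec n \<Longrightarrow> (vec_norm2 v)\<^sup>2 = sqnorm n (\<lambda>i. v $ i)"
  by (auto simp: vec_norm2_def L2_set_def sqnorm_def sum_nonneg)

lemma vec_norm2_nonneg [simp]: "0 \<le> vec_norm2 v"
  by (simp add: vec_norm2_def)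

lemma sqnorm_mult_mat_vec:
  assumes "A \<in> carrier_mat n n" "v \<in> carrier_vec n"
  shows "sqnorm n (\<lambda>i. (A *\<^sub>v v) $ i) = (\<Sum>p<n. (cmod (\<Sum>q<n. A $$ (p, q) * v $ q))\<^sup>2)"
  using assms by (auto simp: sqnorm_def scalar_prod_def lessThan_atLeast0)

text \<open>The Hilbert-Schmidt norm is a crude bound, but it shows that the supremum defining
  \<open>op_norm\<close> is taken over a bounded set.\<close>

lemma vec_norm2_mult_le:
  assumes A: "A \<in> carrier_mat n n" and v: "v \<in> carrier_vec n"
  shows "vec_norm2 (A *\<^sub>v v) \<le> sqrt (\<Sum>p<n. \<Sum>q<n. (cmod (A $$ (p, q)))\<^sup>2) * vec_norm2 v"
proof (rule power2_le_imp_le)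
  have Av: "A *\<^sub>v v \<in> carrier_vec n" using A v by simp
  have "(\<Sum>p<n. (cmod (\<Sum>q<n. A $$ (p, q) * v $ q))\<^sup>2)
      \<le> (\<Sum>p<n. (\<Sum>q<n. (cmod (A $$ (p, q)))\<^sup>2) * (\<Sum>q<n. (cmod (v $ q))\<^sup>2))"
    by (intro sum_mono cmod_sum_mult_le)
  then show "(vec_norm2 (A *\<^sub>v v))\<^sup>2 \<le> (sqrt (\<Sum>p<n. \<Sum>q<n. (cmod (A $$ (p, q)))\<^sup>2) * vec_norm2 v)\<^sup>2"
    unfolding power_mult_distrib vec_norm2_power2[OF Av] sqnorm_mult_mat_vec[OF A v] vec_norm2_power2[OF v]
    unfolding sqnorm_def by (simp add: sum_nonneg sum_distrib_right[symmetric])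
qed (simp add: sum_nonneg)

lemma bdd_above_op_norm:
  assumes "A \<in> carrier_mat n n"
  shows "bdd_above ((\<lambda>v. vec_norm2 (A *\<^sub>v v)) ` {v \<in> carrier_vec n. vec_norm2 v \<le> 1})"
proof (rule bdd_aboveI2)
  fix v assume v: "v \<in> {v \<in> carrier_vec n. vec_norm2 v \<le> 1}"
  have "vec_norm2 (A *\<^sub>v v) \<le> sqrt (\<Sum>p<n. \<Sum>q<n. (cmod (A $$ (p, q)))\<^sup>2) * vec_norm2 v"
    using vec_norm2_mult_le assms v by blast
  also have "\<dots> \<le> sqrt (\<Sum>p<n. \<Sum>q<n. (cmod (A $$ (p, q)))\<^sup>2) * 1"
    using v by (intro mult_left_mono) (auto simp: sum_nonneg)
  finally show "vec_norm2 (A *\<^sub>v v) \<le> sqrt (\<Sum>p<n. \<Sum>q<n. (cmod (A $$ (p, q)))\<^sup>2)" by simp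
qed

lemma zero_in_unit_ball: "0\<^sub>v n \<in> {v \<in> carrier_vec n. vec_norm2 v \<le> 1}"
  by (simp add: vec_norm2_def L2_set_def)

lemma op_norm_nonneg:
  assumes "A \<in> carrier_mat n n" shows "0 \<le> op_norm A"
proof -
  have "0 \<le> vec_norm2 (A *\<^sub>v 0\<^sub>v n)" by simp
  also have "\<dots> \<le> op_norm A"
    unfolding op_norm_def using assms bdd_above_op_norm[OF assms] zero_in_unit_ball
    by (intro cSUP_upper) auto
  finally show ?thesis .
qed

lemma op_norm_leI:
  assumes A: "A \<in> carrier_mat n n" and "0 \<le> C"
    and bd: "\<And>v. v \<in> carrier_vec n \<Longrightarrow> sqnorm n (\<lambda>i. (A *\<^sub>v v) $ i) \<le> C\<^sup>2 * sqnorm n (\<lambda>i. v $ i)"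
  shows "op_norm A \<le> C"
  unfolding op_norm_def
proof (rule cSUP_least)
  show "{v \<in> carrier_vec (dim_col A). vec_norm2 v \<le> 1} \<noteq> {}" using zero_in_unit_ball by blast
  fix v assume "v \<in> {v \<in> carrier_vec (dim_col A). vec_norm2 v \<le> 1}"
  then have v: "v \<in> carrier_vec n" "vec_norm2 v \<le> 1" using A by auto
  have Av: "A *\<^sub>v v \<in> carrier_vec n" using A v by simp
  have "(vec_norm2 (A *\<^sub>v v))\<^sup>2 \<le> C\<^sup>2 * (vec_norm2 v)\<^sup>2"
    using bd[OF v(1)] by (simp add: vec_norm2_power2[OF Av] vec_norm2_power2[OF v(1)])
  also have "\<dots> \<le> C\<^sup>2 * 1" using v by (intro mult_left_mono) (auto intro: power_le_one)
  finally have "(vec_norm2 (A *\<^sub>v v))\<^sup>2 \<le> C\<^sup>2" by simp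
  then show "vec_norm2 (A *\<^sub>v v) \<le> C" using \<open>0 \<le> C\<close> by (rule power2_le_imp_le)
qed

lemma op_norm_bound:
  assumes A: "A \<in> carrier_mat n n" and v: "v \<in> carrier_vec n"
  shows "sqnorm n (\<lambda>i. (A *\<^sub>v v) $ i) \<le> (op_norm A)\<^sup>2 * sqnorm n (\<lambda>i. v $ i)"
proof -
  have Av: "A *\<^sub>v v \<in> carrier_vec n" using A v by simp
  have "vec_norm2 (A *\<^sub>v v) \<le> op_norm A * vec_norm2 v"
  proof (cases "vec_norm2 v = 0")
    case True
    then show ?thesis using vec_norm2_mult_le[OF A v] by simp
  next
    case False
    define r where "r = vec_norm2 v"
    have r: "r > 0" using False by (simp add: r_def less_le)
    define u where "u = complex_of_real (1 / r) \<cdot>\<^sub>v v"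
    have u: "u \<in> carrier_vec n" using v by (simp add: u_def)
    have scale: "vec_norm2 (complex_of_real (1 / r) \<cdot>\<^sub>v x) = vec_norm2 x / r" for x
    proof -
      have "vec_norm2 (complex_of_real (1 / r) \<cdot>\<^sub>v x) = L2_set (\<lambda>i. 1 / r * cmod (x $ i)) {..<dim_vec x}"
        unfolding vec_norm2_def using r by (intro L2_set_cong) (auto simp: norm_divide norm_mult)
      also have "\<dots> = 1 / r * vec_norm2 x"
        using r by (subst L2_set_right_distrib[symmetric]) (simp_all add: vec_norm2_def)
      finally show ?thesis by simp
    qed
    have "vec_norm2 u = 1" unfolding u_def scale using False by (simp add: r_def)
    then have "vec_norm2 (A *\<^sub>v u) \<le> op_norm A"
      unfolding op_norm_def using A u bdd_above_op_norm[OF A] by (intro cSUP_upper) auto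
    also have "A *\<^sub>v u = complex_of_real (1 / r) \<cdot>\<^sub>v (A *\<^sub>v v)"
      unfolding u_def using A v by (rule mult_mat_vec)
    finally have "vec_norm2 (A *\<^sub>v v) / r \<le> op_norm A" unfolding scale .
    then show ?thesis using r by (simp add: r_def[symmetric] field_simps)
  qed
  then have "(vec_norm2 (A *\<^sub>v v))\<^sup>2 \<le> (op_norm A * vec_norm2 v)\<^sup>2" by (intro power_mono) auto
  then show ?thesis by (simp add: power_mult_distrib vec_norm2_power2[OF Av] vec_norm2_power2[OF v])
qed

text \<open>A matrix and its transpose have the same norm, by \<open>transpose_bound\<close>;
  together with \<open>op_norm_bound_row\<close> this lets \<open>op_norm\<close> be read off the
  row action.\<close>

lemma op_norm_leI_row:
  assumes A: "A \<in> carrier_mat n n" and "0 \<le> C"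
    and bd: "\<And>y. sqnorm n (row_act n y A) \<le> C\<^sup>2 * sqnorm n y"
  shows "op_norm A \<le> C"
proof (rule op_norm_leI[OF A \<open>0 \<le> C\<close>])
  fix v :: "complex vec" assume v: "v \<in> carrier_vec n"
  have "(\<Sum>q<n. (cmod (\<Sum>p<n. v $ p * A $$ (q, p)))\<^sup>2) \<le> C\<^sup>2 * (\<Sum>p<n. (cmod (v $ p))\<^sup>2)"
    by (rule transpose_bound) (use bd in \<open>simp_all add: sqnorm_def row_act_def mult_ac\<close>)
  then show "sqnorm n (\<lambda>i. (A *\<^sub>v v) $ i) \<le> C\<^sup>2 * sqnorm n (\<lambda>i. v $ i)"
    using A v by (simp add: sqnorm_mult_mat_vec) (simp add: sqnorm_def mult_ac)
qed

lemma op_norm_bound_row: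
  assumes A: "A \<in> carrier_mat n n" and le: "op_norm A \<le> C"
  shows "sqnorm n (row_act n y A) \<le> C\<^sup>2 * sqnorm n y"
  unfolding sqnorm_def row_act_def
proof (rule transpose_bound)
  fix x :: "nat \<Rightarrow> complex"
  have "sqnorm n (\<lambda>i. (A *\<^sub>v vec n x) $ i) \<le> (op_norm A)\<^sup>2 * sqnorm n (\<lambda>i. vec n x $ i)"
    by (rule op_norm_bound[OF A]) simp
  also have "\<dots> \<le> C\<^sup>2 * sqnorm n (\<lambda>i. vec n x $ i)"
    using le op_norm_nonneg[OF A] by (intro mult_right_mono power_mono) auto
  finally show "(\<Sum>p<n. (cmod (\<Sum>q<n. A $$ (p, q) * x q))\<^sup>2) \<le> C\<^sup>2 * (\<Sum>q<n. (cmod (x q))\<^sup>2)"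
    using A by (simp add: sqnorm_mult_mat_vec) (simp add: sqnorm_def)
qed simp

section \<open>The row ball as a bound on row vectors\<close>

lemma tuple_gram_carrier [simp]: "tuple_gram n X \<in> carrier_mat n n"
  by (simp add: tuple_gram_def)

lemma tuple_gram_index:
  assumes "set X \<subseteq> carrier_mat n n" "i < n" "j < n"
  shows "tuple_gram n X $$ (i, j) = (\<Sum>t<length X. \<Sum>q<n. X ! t $$ (i, q) * cnj (X ! t $$ (j, q)))"
proof -
  have X: "X ! t \<in> carrier_mat n n" if "t < length X" for t using assms that by auto
  have "tuple_gram n X $$ (i, j) = (\<Sum>t<length X. (X ! t * mat_adjoint (X ! t)) $$ (i, j))"
    using assms by (simp add: tuple_gram_def)
  also have "\<dots> = (\<Sum>t<length X. \<Sum>q<n. X ! t $$ (i, q) * cnj (X ! t $$ (j, q)))"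
  proof (rule sum.cong[OF refl])
    fix t assume "t \<in> {..<length X}"
    then have "X ! t \<in> carrier_mat n n" using X by simp
    then show "(X ! t * mat_adjoint (X ! t)) $$ (i, j) = (\<Sum>q<n. X ! t $$ (i, q) * cnj (X ! t $$ (j, q)))"
      using assms by (subst mult_mat_index[of _ n n _ n]) auto
  qed
  finally show ?thesis .
qed

lemma tuple_gram_mult_vec:
  assumes "set X \<subseteq> carrier_mat n n" "i < n"
  shows "(\<Sum>k<n. tuple_gram n X $$ (i, k) * cnj (y k))
    = (\<Sum>t<length X. \<Sum>q<n. X ! t $$ (i, q) * cnj (row_act n y (X ! t) q))"
proof -
  have "(\<Sum>k<n. tuple_gram n X $$ (i, k) * cnj (y k))
      = (\<Sum>k<n. \<Sum>t<length X. \<Sum>q<n. X ! t $$ (i, q) * cnj (y k * X ! t $$ (k, q)))"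
    using assms by (intro sum.cong refl) (simp add: tuple_gram_index sum_distrib_left mult_ac)
  also have "\<dots> = (\<Sum>t<length X. \<Sum>k<n. \<Sum>q<n. X ! t $$ (i, q) * cnj (y k * X ! t $$ (k, q)))"
    by (rule sum.swap)
  also have "\<dots> = (\<Sum>t<length X. \<Sum>q<n. \<Sum>k<n. X ! t $$ (i, q) * cnj (y k * X ! t $$ (k, q)))"
    by (intro sum.cong refl sum.swap)
  finally show ?thesis by (simp add: row_act_def sum_distrib_left mult_ac)
qed

lemma qform_tuple_gram:
  assumes "set X \<subseteq> carrier_mat n n"
  shows "qform n (tuple_gram n X) y = of_real (\<Sum>t<length X. sqnorm n (row_act n y (X ! t)))"
proof -
  have "qform n (tuple_gram n X) y = (\<Sum>i<n. y i * (\<Sum>k<n. tuple_gram n X $$ (i, k) * cnj (y k)))"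
    by (simp add: qform_def sum_distrib_left mult_ac)
  also have "\<dots> = (\<Sum>i<n. \<Sum>t<length X. \<Sum>q<n. y i * X ! t $$ (i, q) * cnj (row_act n y (X ! t) q))"
  proof (rule sum.cong[OF refl])
    fix i assume "i \<in> {..<n}"
    then have "i < n" by simp
    show "y i * (\<Sum>k<n. tuple_gram n X $$ (i, k) * cnj (y k))
        = (\<Sum>t<length X. \<Sum>q<n. y i * X ! t $$ (i, q) * cnj (row_act n y (X ! t) q))"
      unfolding tuple_gram_mult_vec[OF assms \<open>i < n\<close>] by (simp add: sum_distrib_left mult.assoc)
  qed
  also have "\<dots> = (\<Sum>t<length X. \<Sum>i<n. \<Sum>q<n. y i * X ! t $$ (i, q) * cnj (row_act n y (X ! t) q))"
    by (rule sum.swap)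
  also have "\<dots> = (\<Sum>t<length X. \<Sum>q<n. \<Sum>i<n. y i * X ! t $$ (i, q) * cnj (row_act n y (X ! t) q))"
    by (intro sum.cong refl sum.swap)
  also have "\<dots> = (\<Sum>t<length X. \<Sum>q<n. row_act n y (X ! t) q * cnj (row_act n y (X ! t) q))"
    by (simp add: row_act_def sum_distrib_right[symmetric])
  finally show ?thesis
    by (simp add: sqnorm_def complex_norm_square del: of_real_power)
qed

text \<open>With R = [X_1 ... X_d] the Gram matrix is R R^*, and the norm of R R^* is the square of
  the norm of R. The bound \<open>c\<close> in \<open>row_bound\<close> is a bound for that
  square.\<close>

lemma nc_ball_level_iff:
  "X \<in> nc_ball_level d n \<longleftrightarrow> X \<in> nc_level d n \<and> (\<exists>c. 0 \<le> c \<and> c < 1 \<and> row_bound n c X)"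
proof (intro iffI conjI)
  assume "X \<in> nc_ball_level d n"
  then show "X \<in> nc_level d n" by (simp add: nc_ball_level_def)
  then have X: "set X \<subseteq> carrier_mat n n" by (simp add: nc_level_def)
  define M where "M = tuple_gram n X"
  have M: "M \<in> carrier_mat n n" by (simp add: M_def)
  have "row_bound n (op_norm M) X"
    unfolding row_bound_def
  proof
    fix y
    define N where "N = (\<Sum>t<length X. sqnorm n (row_act n y (X ! t)))"
    define v where "v = vec n (\<lambda>i. cnj (y i))"
    \<comment> \<open>N is the form of \<open>M\<close> at \<open>y\<close>, so Cauchy-Schwarz and
      the norm of \<open>M\<close> give N^2 <= (norm of M)^2 |y|^4.\<close>
    have "complex_of_real N = (\<Sum>i<n. y i * (M *\<^sub>v v) $ i)"
      unfolding N_def qform_tuple_gram[OF X, symmetric]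
      by (simp add: qform_def M_def[symmetric] v_def scalar_prod_def lessThan_atLeast0 sum_distrib_left mult_ac
          carrier_matD[OF M])
    then have "N\<^sup>2 = (cmod (\<Sum>i<n. y i * (M *\<^sub>v v) $ i))\<^sup>2" by (metis norm_of_real power2_abs)
    also have "\<dots> \<le> sqnorm n y * sqnorm n (\<lambda>i. (M *\<^sub>v v) $ i)"
      unfolding sqnorm_def by (rule cmod_sum_mult_le)
    also have "\<dots> \<le> sqnorm n y * ((op_norm M)\<^sup>2 * sqnorm n (\<lambda>i. v $ i))"
      by (intro mult_left_mono op_norm_bound M) (auto simp: v_def)
    also have "sqnorm n (\<lambda>i. v $ i) = sqnorm n y" by (simp add: sqnorm_def v_def)
    finally have "N\<^sup>2 \<le> (op_norm M * sqnorm n y)\<^sup>2" by (simp add: power_mult_distrib power2_eq_square mult_ac)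
    then show "N \<le> op_norm M * sqnorm n y"
      by (rule power2_le_imp_le) (simp add: op_norm_nonneg[OF M])
  qed
  then show "\<exists>c. 0 \<le> c \<and> c < 1 \<and> row_bound n c X"
    using \<open>X \<in> nc_ball_level d n\<close> op_norm_nonneg[OF M] by (auto simp: nc_ball_level_def M_def)
next
  assume "X \<in> nc_level d n \<and> (\<exists>c. 0 \<le> c \<and> c < 1 \<and> row_bound n c X)"
  then obtain c where X: "X \<in> nc_level d n" and c: "0 \<le> c" "c < 1" "row_bound n c X" by blast
  have Xs: "set X \<subseteq> carrier_mat n n" using X by (simp add: nc_level_def)
  have rb: "(\<Sum>s\<in>{..<length X} \<times> {..<n}. (cmod (\<Sum>p<n. X ! fst s $$ (p, snd s) * y p))\<^sup>2)
      \<le> c * (\<Sum>p<n. (cmod (y p))\<^sup>2)" for y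
    using c(3) by (simp add: row_bound_def sqnorm_def row_act_def sum.cartesian_product case_prod_unfold mult_ac)
  have "op_norm (tuple_gram n X) \<le> c"
  proof (rule op_norm_leI)
    fix v :: "complex vec" assume v: "v \<in> carrier_vec n"
    define y where "y i = cnj (v $ i)" for i
    define u where "u s = cnj (row_act n y (X ! fst s) (snd s))" for s
    have "sqnorm n (\<lambda>i. (tuple_gram n X *\<^sub>v v) $ i)
        = (\<Sum>i<n. (cmod (\<Sum>k<n. tuple_gram n X $$ (i, k) * cnj (y k)))\<^sup>2)"
      using v by (simp add: sqnorm_mult_mat_vec y_def)
    also have "\<dots> = (\<Sum>i<n. (cmod (\<Sum>s\<in>{..<length X} \<times> {..<n}. u s * X ! fst s $$ (i, snd s)))\<^sup>2)"
    proof (rule sum.cong[OF refl])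
      fix i assume "i \<in> {..<n}"
      then have "i < n" by simp
      show "(cmod (\<Sum>k<n. tuple_gram n X $$ (i, k) * cnj (y k)))\<^sup>2
          = (cmod (\<Sum>s\<in>{..<length X} \<times> {..<n}. u s * X ! fst s $$ (i, snd s)))\<^sup>2"
        unfolding tuple_gram_mult_vec[OF Xs \<open>i < n\<close>] sum.cartesian_product case_prod_unfold u_def
        by (simp only: mult.commute)
    qed
    \<comment> \<open>R R^* is applied in two stages, each of squared norm at most \<open>c\<close>:
      this is the stage of R, and \<open>rb\<close> itself is the stage of its adjoint.\<close>
    also have "\<dots> \<le> c * (\<Sum>s\<in>{..<length X} \<times> {..<n}. (cmod (u s))\<^sup>2)"
      by (rule transpose_bound[OF c(1) rb])
    also have "\<dots> \<le> c * (c * (\<Sum>p<n. (cmod (y p))\<^sup>2))"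
      unfolding u_def complex_mod_cnj using rb[of y] c(1)
      by (intro mult_left_mono) (simp_all add: row_act_def mult.commute)
    also have "(\<Sum>p<n. (cmod (y p))\<^sup>2) = sqnorm n (\<lambda>i. v $ i)" by (simp add: sqnorm_def y_def)
    finally show "sqnorm n (\<lambda>i. (tuple_gram n X *\<^sub>v v) $ i) \<le> c\<^sup>2 * sqnorm n (\<lambda>i. v $ i)"
      by (simp add: power2_eq_square mult_ac)
  qed (use c in auto)
  then show "X \<in> nc_ball_level d n" using X c by (simp add: nc_ball_level_def)
qed

section \<open>The Szego kernel\<close>

lemma has_sum_finite_sum:
  fixes f :: "'s \<Rightarrow> 'a \<Rightarrow> 'b::topological_comm_monoid_add"
  assumes "finite S" "\<And>s. s \<in> S \<Longrightarrow> (f s has_sum l s) A"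
  shows "((\<lambda>x. \<Sum>s\<in>S. f s x) has_sum (\<Sum>s\<in>S. l s)) A"
  using assms by (induction S) (auto intro: has_sum_add has_sum_0)

lemma mat_adjoint_mult:
  fixes A B :: "complex mat"
  assumes "A \<in> carrier_mat n n" "B \<in> carrier_mat n n"
  shows "mat_adjoint (A * B) = mat_adjoint B * mat_adjoint A"
proof (rule eq_matI)
  have AB: "A * B \<in> carrier_mat n n" using assms by simp
  have c: "mat_adjoint A \<in> carrier_mat n n" "mat_adjoint B \<in> carrier_mat n n" "mat_adjoint (A * B) \<in> carrier_mat n n"
    using assms AB by simp_all
  then show "dim_row (mat_adjoint (A * B)) = dim_row (mat_adjoint B * mat_adjoint A)"
    "dim_col (mat_adjoint (A * B)) = dim_col (mat_adjoint B * mat_adjoint A)"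
    by (simp_all only: carrier_matD index_mult_mat)
  fix i j assume "i < dim_row (mat_adjoint B * mat_adjoint A)" "j < dim_col (mat_adjoint B * mat_adjoint A)"
  then have ij: "i < n" "j < n" using c by (simp_all only: carrier_matD index_mult_mat)
  show "mat_adjoint (A * B) $$ (i, j) = (mat_adjoint B * mat_adjoint A) $$ (i, j)"
    unfolding mat_adjoint_index[OF AB ij] mult_mat_index[OF c(2) c(1) ij]
      mult_mat_index[OF assms ij(2) ij(1)]
    using assms ij by (simp add: mult.commute)
qed

lemma mat_adjoint_one: "mat_adjoint (1\<^sub>m n) = (1\<^sub>m n :: complex mat)"
proof -
  have one: "(1\<^sub>m n :: complex mat) \<in> carrier_mat n n" by simp
  show ?thesis
    using carrier_matD[OF mat_adjoint_carrier[OF one]] mat_adjoint_index[OF one] by (intro eq_matI) auto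
qed

lemma conj_mat_assoc:
  fixes A B P :: "complex mat"
  assumes "A \<in> carrier_mat n n" "B \<in> carrier_mat n n" "P \<in> carrier_mat n n"
  shows "A * B * P * mat_adjoint (A * B) = A * (B * P * mat_adjoint B) * mat_adjoint A"
proof -
  have c: "mat_adjoint A \<in> carrier_mat n n" "mat_adjoint B \<in> carrier_mat n n" using assms by simp_all
  note [simp] = mult_carrier_mat[of _ n n _ n]
  show ?thesis using assms c
    by (simp add: mat_adjoint_mult[OF assms(1,2)] assoc_mult_mat[of _ n n _ n _ n])
qed

section \<open>Words and square summability over them\<close>

lemma word_eval_Nil [simp]: "word_eval n X [] = 1\<^sub>m n"
  and word_eval_Cons [simp]: "word_eval n X (t # w) = X ! t * word_eval n X w"
  by (simp_all add: word_eval_def)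

lemma words_Nil [simp]: "[] \<in> words d"
  and words_Cons [simp]: "t # w \<in> words d \<longleftrightarrow> t < d \<and> w \<in> words d"
  and words_snoc [simp]: "w @ [t] \<in> words d \<longleftrightarrow> t < d \<and> w \<in> words d"
  by (auto simp: words_def)

lemma nc_level_nth: "X \<in> nc_level d n \<Longrightarrow> t < d \<Longrightarrow> X ! t \<in> carrier_mat n n"
  by (auto simp: nc_level_def)

lemma word_eval_carrier:
  assumes X: "X \<in> nc_level d n"
  shows "w \<in> words d \<Longrightarrow> word_eval n X w \<in> carrier_mat n n"
proof (induction w)
  case (Cons t w)
  then show ?case using nc_level_nth[OF X, of t] by (simp add: mult_carrier_mat[of _ n n _ n])
qed simp

lemma word_eval_snoc:
  assumes X: "X \<in> nc_level d n"
  shows "w \<in> words d \<Longrightarrow> t < d \<Longrightarrow> word_eval n X (w @ [t]) = word_eval n X w * X ! t"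
proof (induction w)
  case Nil
  then show ?case using nc_level_nth[OF X, of t] by simp
next
  case (Cons s w)
  then show ?case using nc_level_nth[OF X, of t] nc_level_nth[OF X, of s] word_eval_carrier[OF X, of w]
    by (simp add: assoc_mult_mat[of _ n n _ n _ n])
qed

text \<open>These finite sets split by the first letter, which permits induction, and every finite
  set of words lies in one of them.\<close>

definition short_words :: "nat \<Rightarrow> nat \<Rightarrow> nat list set" where
  "short_words d N = {w \<in> words d. length w < N}"

lemma short_words_Suc: "short_words d (Suc N) = insert [] (\<Union>t<d. (#) t ` short_words d N)"
proof (rule Set.set_eqI)
  fix w show "w \<in> short_words d (Suc N) \<longleftrightarrow> w \<in> insert [] (\<Union>t<d. (#) t ` short_words d N)"
    by (cases w) (auto simp: short_words_def)
qed

lemma finite_short_words: "finite (short_words d N)"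
  by (induction N) (simp_all add: short_words_Suc, simp add: short_words_def)

lemma sum_short_words_Suc:
  fixes f :: "nat list \<Rightarrow> real"
  shows "sum f (short_words d (Suc N)) = f [] + (\<Sum>t<d. \<Sum>w\<in>short_words d N. f (t # w))"
proof -
  have "sum f (\<Union>t<d. (#) t ` short_words d N) = (\<Sum>t<d. sum f ((#) t ` short_words d N))"
    by (rule sum.UNION_disjoint) (auto simp: finite_short_words)
  also have "\<dots> = (\<Sum>t<d. \<Sum>w\<in>short_words d N. f (t # w))"
    by (simp add: sum.reindex)
  finally show ?thesis
    unfolding short_words_Suc by (subst sum.insert) (auto simp: finite_short_words)
qed

text \<open>Splitting off the first letter \<open>t\<close> replaces \<open>y\<close> by y X_t,
  whose squared norms add up to at most c |y|^2. The bound reproduces itself since 1 + c / (1 - c) =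
  1 / (1 - c).\<close>

lemma sum_short_words_bound:
  assumes X: "X \<in> nc_level d n" and c: "0 \<le> c" "c < 1" "row_bound n c X"
  shows "(\<Sum>w\<in>short_words d N. sqnorm n (row_act n y (word_eval n X w))) \<le> sqnorm n y / (1 - c)"
proof (induction N arbitrary: y)
  case 0
  then show ?case using c by (simp add: short_words_def)
next
  case (Suc N)
  have len: "length X = d" using X by (simp add: nc_level_def)
  have "sqnorm n (row_act n y (word_eval n X (t # w))) = sqnorm n (row_act n (row_act n y (X ! t)) (word_eval n X w))"
    if "t < d" "w \<in> short_words d N" for t w
    using nc_level_nth[OF X that(1)] word_eval_carrier[OF X, of w] that(2)
    by (intro sqnorm_cong) (simp add: row_act_mult short_words_def)
  then have "(\<Sum>w\<in>short_words d (Suc N). sqnorm n (row_act n y (word_eval n X w)))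
      = sqnorm n (row_act n y (1\<^sub>m n))
        + (\<Sum>t<d. \<Sum>w\<in>short_words d N. sqnorm n (row_act n (row_act n y (X ! t)) (word_eval n X w)))"
    by (simp add: sum_short_words_Suc del: word_eval_Cons)
  also have "sqnorm n (row_act n y (1\<^sub>m n)) = sqnorm n y"
    by (intro sqnorm_cong row_act_one)
  also have "(\<Sum>t<d. \<Sum>w\<in>short_words d N. sqnorm n (row_act n (row_act n y (X ! t)) (word_eval n X w)))
      \<le> (\<Sum>t<d. sqnorm n (row_act n y (X ! t)) / (1 - c))"
    by (intro sum_mono Suc.IH)
  also have "\<dots> \<le> c * sqnorm n y / (1 - c)"
    using c(2,3) len unfolding sum_divide_distrib[symmetric] row_bound_def
    by (intro divide_right_mono) auto
  also have "sqnorm n y + c * sqnorm n y / (1 - c) = sqnorm n y / (1 - c)"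
    using c by (simp add: field_simps)
  finally show ?case by simp
qed

lemma word_eval_square_summable:
  assumes X: "X \<in> nc_ball_level d n" and ij: "i < n" "j < n"
  shows "(\<lambda>w. (cmod (word_eval n X w $$ (i, j)))\<^sup>2) summable_on words d"
proof (rule nonneg_bdd_above_summable_on)
  have lev: "X \<in> nc_level d n" using X by (simp add: nc_ball_level_iff)
  obtain c where c: "0 \<le> c" "c < 1" "row_bound n c X" using X by (auto simp: nc_ball_level_iff)
  show "bdd_above (sum (\<lambda>w. (cmod (word_eval n X w $$ (i, j)))\<^sup>2) ` {F. F \<subseteq> words d \<and> finite F})"
  proof (rule bdd_aboveI2)
    fix F assume F: "F \<in> {F. F \<subseteq> words d \<and> finite F}"
    define N where "N = Suc (Max (length ` F))"
    have FN: "F \<subseteq> short_words d N"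
      using F by (auto simp: short_words_def N_def less_Suc_eq_le)
    \<comment> \<open>The unit row vector selects row \<open>i\<close> of each word value, so the
      bound for row vectors controls the entry (i, j).\<close>
    let ?e = "\<lambda>p. if p = i then 1 else 0 :: complex"
    have "sum (\<lambda>w. (cmod (word_eval n X w $$ (i, j)))\<^sup>2) F
        \<le> (\<Sum>w\<in>F. sqnorm n (row_act n ?e (word_eval n X w)))"
    proof (intro sum_mono)
      fix w
      show "(cmod (word_eval n X w $$ (i, j)))\<^sup>2 \<le> sqnorm n (row_act n ?e (word_eval n X w))"
        unfolding sqnorm_def row_act_unit[OF ij(1)] using ij by (intro member_le_sum) auto
    qed
    also have "\<dots> \<le> (\<Sum>w\<in>short_words d N. sqnorm n (row_act n ?e (word_eval n X w)))"
      using FN by (intro sum_mono2 finite_short_words) auto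
    also have "\<dots> \<le> sqnorm n ?e / (1 - c)" by (rule sum_short_words_bound[OF lev c])
    finally show "sum (\<lambda>w. (cmod (word_eval n X w $$ (i, j)))\<^sup>2) F \<le> sqnorm n ?e / (1 - c)" .
  qed
qed auto

text \<open>Each term is a fixed finite combination of products of two entries of the word value,
  and 2 a b <= a^2 + b^2 dominates these by square summable families.\<close>

lemma kernel_term_summable:
  assumes X: "X \<in> nc_ball_level d n" and P: "P \<in> carrier_mat n n" and ij: "i < n" "j < n"
  shows "(\<lambda>w. (word_eval n X w * P * mat_adjoint (word_eval n X w)) $$ (i, j)) summable_on words d"
proof -
  have lev: "X \<in> nc_level d n" using X by (simp add: nc_ball_level_iff)
  have pair: "(\<lambda>w. word_eval n X w $$ (i, p) * cnj (word_eval n X w $$ (j, q))) summable_on words d"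
    if pq: "p < n" "q < n" for p q
  proof (rule abs_summable_summable, rule summable_on_comparison_test)
    show "(\<lambda>w. (cmod (word_eval n X w $$ (i, p)))\<^sup>2 + (cmod (word_eval n X w $$ (j, q)))\<^sup>2) summable_on words d"
      using word_eval_square_summable[OF X] ij pq by (intro summable_on_add) auto
    fix w
    have "2 * (cmod (word_eval n X w $$ (i, p)) * cmod (word_eval n X w $$ (j, q)))
        \<le> (cmod (word_eval n X w $$ (i, p)))\<^sup>2 + (cmod (word_eval n X w $$ (j, q)))\<^sup>2"
      using sum_squares_bound[of "cmod (word_eval n X w $$ (i, p))"] by (simp add: mult.assoc)
    moreover have "0 \<le> cmod (word_eval n X w $$ (i, p)) * cmod (word_eval n X w $$ (j, q))" by simp
    ultimately show "norm (word_eval n X w $$ (i, p) * cnj (word_eval n X w $$ (j, q)))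
        \<le> (cmod (word_eval n X w $$ (i, p)))\<^sup>2 + (cmod (word_eval n X w $$ (j, q)))\<^sup>2"
      unfolding norm_mult complex_mod_cnj by linarith
  qed simp
  have "((\<lambda>w. \<Sum>p<n. \<Sum>q<n. P $$ (p, q) * (word_eval n X w $$ (i, p) * cnj (word_eval n X w $$ (j, q))))
      has_sum (\<Sum>p<n. \<Sum>q<n. P $$ (p, q) * infsum (\<lambda>w. word_eval n X w $$ (i, p) * cnj (word_eval n X w $$ (j, q))) (words d)))
      (words d)"
    by (intro has_sum_finite_sum has_sum_cmult_right has_sum_infsum pair) auto
  then have "(\<lambda>w. \<Sum>p<n. \<Sum>q<n. P $$ (p, q) * (word_eval n X w $$ (i, p) * cnj (word_eval n X w $$ (j, q)))) summable_on words d"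
    by (rule has_sum_imp_summable)
  then show ?thesis
    by (rule summable_on_cong[THEN iffD1, rotated])
      (use P ij in
        \<open>simp del: index_mult_mat(1) add: conj_mat_index[of _ n]
          word_eval_carrier[OF lev] mult_ac\<close>)
qed

text \<open>A nonempty word has a unique first and a unique last letter. The two choices of
  \<open>g\<close> cover both decompositions and lead to the two Stein equations of the
  kernel.\<close>

lemma infsum_words_split:
  fixes f :: "nat list \<Rightarrow> complex"
  assumes f: "f summable_on words d"
    and g: "g = (#) \<or> g = (\<lambda>t w. w @ [t])"
  shows "infsum f (words d) = f [] + (\<Sum>t<d. infsum (\<lambda>w. f (g t w)) (words d))"
proof -
  have inj: "inj_on (g t) A" for t A using g by (auto simp: inj_on_def)
  have disj: "g s ` words d \<inter> g t ` words d = {}" if "s \<noteq> t" for s t using g that by auto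
  have split: "words d = {[]} \<union> (\<Union>t<d. g t ` words d)"
  proof (rule Set.set_eqI)
    fix w show "w \<in> words d \<longleftrightarrow> w \<in> {[]} \<union> (\<Union>t<d. g t ` words d)"
      using g
    proof
      assume "g = (#)" then show ?thesis by (cases w) auto
    next
      assume "g = (\<lambda>t w. w @ [t])" then show ?thesis by (cases w rule: rev_cases) auto
    qed
  qed
  have sub: "(\<Union>t<d. g t ` words d) \<subseteq> words d" by (subst (2) split) auto
  have "infsum f (words d) = infsum f ({[]} \<union> (\<Union>t<d. g t ` words d))"
    using split by simp
  also have "\<dots> = infsum f {[]} + infsum f (\<Union>t<d. g t ` words d)"
    by (rule infsum_Un_disjoint) (use g f sub in \<open>auto intro: summable_on_subset_banach\<close>)
  also have "infsum f (\<Union>t<d. g t ` words d) = (\<Sum>t<d. infsum f (g t ` words d))"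
    by (rule sum_infsum[symmetric]) (use f sub disj in \<open>auto intro!: summable_on_subset_banach[OF f]\<close>)
  also have "\<dots> = (\<Sum>t<d. infsum (\<lambda>w. f (g t w)) (words d))"
    by (intro sum.cong refl) (subst infsum_reindex[OF inj], simp add: o_def)
  finally show ?thesis by simp
qed

section \<open>Linearity and the two Stein equations of the kernel\<close>

context
  fixes d n :: nat and X :: "complex mat list"
  assumes X: "X \<in> nc_ball_level d n"
begin

lemma szego_kernel_carrier:
  "P \<in> carrier_mat n n \<Longrightarrow> szego_kernel d X X P \<in> carrier_mat n n"
  by (simp add: szego_kernel_def)

lemma szego_kernel_index:
  assumes "P \<in> carrier_mat n n" "i < n" "j < n"
  shows "szego_kernel d X X P $$ (i, j)
    = infsum (\<lambda>w. (word_eval n X w * P * mat_adjoint (word_eval n X w)) $$ (i, j)) (words d)"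
  using assms by (simp add: szego_kernel_def)

lemma szego_kernel_level: "X \<in> nc_level d n"
  using X by (simp add: nc_ball_level_iff)

lemma szego_kernel_add:
  assumes P: "P \<in> carrier_mat n n" and Q: "Q \<in> carrier_mat n n"
  shows "szego_kernel d X X (P + Q) = szego_kernel d X X P + szego_kernel d X X Q"
proof (rule eq_matI)
  have PQ: "P + Q \<in> carrier_mat n n" using P Q by simp
  note c = szego_kernel_carrier[OF P] szego_kernel_carrier[OF Q] szego_kernel_carrier[OF PQ]
  show "dim_row (szego_kernel d X X (P + Q)) = dim_row (szego_kernel d X X P + szego_kernel d X X Q)"
    "dim_col (szego_kernel d X X (P + Q)) = dim_col (szego_kernel d X X P + szego_kernel d X X Q)"
    using c by simp_all
  fix i j assume "i < dim_row (szego_kernel d X X P + szego_kernel d X X Q)"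
    "j < dim_col (szego_kernel d X X P + szego_kernel d X X Q)"
  then have ij: "i < n" "j < n" using c by simp_all
  have "infsum (\<lambda>w. (word_eval n X w * (P + Q) * mat_adjoint (word_eval n X w)) $$ (i, j)) (words d)
     = infsum (\<lambda>w. (word_eval n X w * P * mat_adjoint (word_eval n X w)) $$ (i, j)
       + (word_eval n X w * Q * mat_adjoint (word_eval n X w)) $$ (i, j)) (words d)"
    by (intro infsum_cong)
      (use P Q ij in
        \<open>simp del: index_mult_mat(1) add: conj_mat_index[of _ n]
          word_eval_carrier[OF szego_kernel_level] sum.distrib distrib_left distrib_right\<close>)
  also have "\<dots> = infsum (\<lambda>w. (word_eval n X w * P * mat_adjoint (word_eval n X w)) $$ (i, j)) (words d)
    + infsum (\<lambda>w. (word_eval n X w * Q * mat_adjoint (word_eval n X w)) $$ (i, j)) (words d)"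
    by (intro infsum_add kernel_term_summable[OF X] P Q ij)
  finally show "szego_kernel d X X (P + Q) $$ (i, j) = (szego_kernel d X X P + szego_kernel d X X Q) $$ (i, j)"
    using c ij P Q PQ by (simp add: szego_kernel_index)
qed

lemma szego_kernel_smult:
  assumes P: "P \<in> carrier_mat n n"
  shows "szego_kernel d X X (c \<cdot>\<^sub>m P) = c \<cdot>\<^sub>m szego_kernel d X X P"
proof (rule eq_matI)
  have cP: "c \<cdot>\<^sub>m P \<in> carrier_mat n n" using P by simp
  note c = szego_kernel_carrier[OF P] szego_kernel_carrier[OF cP]
  show "dim_row (szego_kernel d X X (c \<cdot>\<^sub>m P)) = dim_row (c \<cdot>\<^sub>m szego_kernel d X X P)"
    "dim_col (szego_kernel d X X (c \<cdot>\<^sub>m P)) = dim_col (c \<cdot>\<^sub>m szego_kernel d X X P)"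
    using c by simp_all
  fix i j assume "i < dim_row (c \<cdot>\<^sub>m szego_kernel d X X P)" "j < dim_col (c \<cdot>\<^sub>m szego_kernel d X X P)"
  then have ij: "i < n" "j < n" using c by simp_all
  have "infsum (\<lambda>w. (word_eval n X w * (c \<cdot>\<^sub>m P) * mat_adjoint (word_eval n X w)) $$ (i, j)) (words d)
     = infsum (\<lambda>w. c * (word_eval n X w * P * mat_adjoint (word_eval n X w)) $$ (i, j)) (words d)"
    by (intro infsum_cong)
      (use P ij in
        \<open>simp del: index_mult_mat(1) add: conj_mat_index[of _ n]
          word_eval_carrier[OF szego_kernel_level] sum_distrib_left mult_ac\<close>)
  also have "\<dots> = c * infsum (\<lambda>w. (word_eval n X w * P * mat_adjoint (word_eval n X w)) $$ (i, j)) (words d)"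
    by (intro infsum_cmult_right kernel_term_summable[OF X] P ij)
  finally show "szego_kernel d X X (c \<cdot>\<^sub>m P) $$ (i, j) = (c \<cdot>\<^sub>m szego_kernel d X X P) $$ (i, j)"
    using c ij P cP by (simp add: szego_kernel_index)
qed

text \<open>Splitting off the first letter leaves X_t outermost, and conjugation by X_t, a finite
  combination of entries, passes through the infinite sum. This form serves necessity.\<close>

lemma szego_kernel_left:
  assumes P: "P \<in> carrier_mat n n"
  shows "szego_kernel d X X P
    = P + mat_sum n (\<lambda>t. X ! t * szego_kernel d X X P * mat_adjoint (X ! t)) {..<d}"
    (is "?K = P + ?R")
proof (rule eq_matI)
  note c = szego_kernel_carrier[OF P]
  show "dim_row ?K = dim_row (P + ?R)" "dim_col ?K = dim_col (P + ?R)" using c by (simp_all add: mat_sum_def)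
  fix i j assume "i < dim_row (P + ?R)" "j < dim_col (P + ?R)"
  then have ij: "i < n" "j < n" by (simp_all add: mat_sum_def)
  let ?f = "\<lambda>i j w. (word_eval n X w * P * mat_adjoint (word_eval n X w)) $$ (i, j)"
  have f: "?f i j summable_on words d" if "i < n" "j < n" for i j
    by (rule kernel_term_summable[OF X P that])
  have step: "infsum (\<lambda>w. ?f i j (t # w)) (words d) = (X ! t * ?K * mat_adjoint (X ! t)) $$ (i, j)"
    if t: "t < d" for t
  proof -
    have Xt: "X ! t \<in> carrier_mat n n" by (rule nc_level_nth[OF szego_kernel_level t])
    have "infsum (\<lambda>w. ?f i j (t # w)) (words d)
        = infsum (\<lambda>w. \<Sum>p<n. \<Sum>q<n. X ! t $$ (i, p) * ?f p q w * cnj (X ! t $$ (j, q))) (words d)"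
    proof (rule infsum_cong)
      fix w assume "w \<in> words d"
      then have W: "word_eval n X w \<in> carrier_mat n n" by (rule word_eval_carrier[OF szego_kernel_level])
      then have C: "word_eval n X w * P * mat_adjoint (word_eval n X w) \<in> carrier_mat n n"
        using P by (simp add: mult_carrier_mat[of _ n n _ n])
      show "?f i j (t # w) = (\<Sum>p<n. \<Sum>q<n. X ! t $$ (i, p) * ?f p q w * cnj (X ! t $$ (j, q)))"
        unfolding word_eval_Cons conj_mat_assoc[OF Xt W P] by (rule conj_mat_index[OF Xt C Xt ij])
    qed
    also have "((\<lambda>w. \<Sum>p<n. \<Sum>q<n. X ! t $$ (i, p) * ?f p q w * cnj (X ! t $$ (j, q)))
        has_sum (\<Sum>p<n. \<Sum>q<n. X ! t $$ (i, p) * infsum (?f p q) (words d) * cnj (X ! t $$ (j, q)))) (words d)"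
      by (intro has_sum_finite_sum has_sum_cmult_right has_sum_cmult_left has_sum_infsum f) auto
    then have "infsum (\<lambda>w. \<Sum>p<n. \<Sum>q<n. X ! t $$ (i, p) * ?f p q w * cnj (X ! t $$ (j, q))) (words d)
        = (\<Sum>p<n. \<Sum>q<n. X ! t $$ (i, p) * infsum (?f p q) (words d) * cnj (X ! t $$ (j, q)))"
      by (rule infsumI)
    also have "\<dots> = (X ! t * ?K * mat_adjoint (X ! t)) $$ (i, j)"
      using Xt c P ij by (simp del: index_mult_mat(1) add: conj_mat_index[of _ n] szego_kernel_index)
    finally show ?thesis .
  qed
  have "?K $$ (i, j) = ?f i j [] + (\<Sum>t<d. infsum (\<lambda>w. ?f i j (t # w)) (words d))"
    unfolding szego_kernel_index[OF P ij] by (rule infsum_words_split[OF f[OF ij]]) simp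
  also have "?f i j [] = P $$ (i, j)"
    using P by (simp add: mat_adjoint_one)
  finally show "?K $$ (i, j) = (P + ?R) $$ (i, j)" using ij P step by (simp del: word_eval_Cons)
qed

text \<open>Splitting off the last letter leaves X_t innermost, where it is absorbed into the
  argument of the kernel. This form serves sufficiency.\<close>

lemma szego_kernel_right:
  assumes P: "P \<in> carrier_mat n n"
  shows "szego_kernel d X X P
    = P + mat_sum n (\<lambda>t. szego_kernel d X X (X ! t * P * mat_adjoint (X ! t))) {..<d}"
    (is "?K = P + ?R")
proof (rule eq_matI)
  note c = szego_kernel_carrier[OF P]
  show "dim_row ?K = dim_row (P + ?R)" "dim_col ?K = dim_col (P + ?R)" using c by (simp_all add: mat_sum_def)
  fix i j assume "i < dim_row (P + ?R)" "j < dim_col (P + ?R)"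
  then have ij: "i < n" "j < n" by (simp_all add: mat_sum_def)
  let ?f = "\<lambda>w. (word_eval n X w * P * mat_adjoint (word_eval n X w)) $$ (i, j)"
  have step: "infsum (\<lambda>w. ?f (w @ [t])) (words d) = szego_kernel d X X (X ! t * P * mat_adjoint (X ! t)) $$ (i, j)"
    if t: "t < d" for t
  proof -
    have Xt: "X ! t \<in> carrier_mat n n" by (rule nc_level_nth[OF szego_kernel_level t])
    then have Q: "X ! t * P * mat_adjoint (X ! t) \<in> carrier_mat n n"
      using P by (simp add: mult_carrier_mat[of _ n n _ n])
    show ?thesis
      unfolding szego_kernel_index[OF Q ij]
    proof (rule infsum_cong)
      fix w assume w: "w \<in> words d"
      then have W: "word_eval n X w \<in> carrier_mat n n" by (rule word_eval_carrier[OF szego_kernel_level])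
      show "?f (w @ [t]) = (word_eval n X w * (X ! t * P * mat_adjoint (X ! t)) * mat_adjoint (word_eval n X w)) $$ (i, j)"
        unfolding word_eval_snoc[OF szego_kernel_level w t] conj_mat_assoc[OF W Xt P] ..
    qed
  qed
  have "?K $$ (i, j) = ?f [] + (\<Sum>t<d. infsum (\<lambda>w. ?f (w @ [t])) (words d))"
    unfolding szego_kernel_index[OF P ij]
    by (rule infsum_words_split[OF kernel_term_summable[OF X P ij]]) simp
  also have "?f [] = P $$ (i, j)"
    using P by (simp add: mat_adjoint_one)
  finally show "?K $$ (i, j) = (P + ?R) $$ (i, j)" using ij P step by simp
qed

end

section \<open>Direct sums and ampliations\<close>

lemma sum_lessThan_add:
  fixes f :: "nat \<Rightarrow> 'a::comm_monoid_add"
  shows "(\<Sum>p<a + b. f p) = (\<Sum>p<a. f p) + (\<Sum>p<b. f (a + p))"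
  by (induction b) (simp_all add: ac_simps)

lemma mat_dsum_carrier [simp]:
  "A \<in> carrier_mat a a \<Longrightarrow> B \<in> carrier_mat b b \<Longrightarrow> mat_dsum A B \<in> carrier_mat (a + b) (a + b)"
  unfolding mat_dsum_def by simp

lemma mat_dsum_index:
  assumes "A \<in> carrier_mat a a" "B \<in> carrier_mat b b" "i < a + b" "j < a + b"
  shows "mat_dsum A B $$ (i, j) = (if i < a then if j < a then A $$ (i, j) else 0
    else if j < a then 0 else B $$ (i - a, j - a))"
  using assms unfolding mat_dsum_def by (auto simp: index_mat_four_block)

lemma mat_dsum_mult:
  assumes "A \<in> carrier_mat a a" "A' \<in> carrier_mat a a" "B \<in> carrier_mat b b" "B' \<in> carrier_mat b b"
  shows "mat_dsum A B * mat_dsum A' B' = mat_dsum (A * A') (B * B')"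
  using assms unfolding mat_dsum_def
  by (subst mult_four_block_mat[of _ a a _ b _ b _ _ a _ b]) auto

lemma sqnorm_add: "sqnorm (a + b) y = sqnorm a y + sqnorm b (\<lambda>p. y (a + p))"
  by (simp add: sqnorm_def sum_lessThan_add)

lemma row_act_dsum:
  assumes A: "A \<in> carrier_mat a a" and B: "B \<in> carrier_mat b b" and q: "q < a + b"
  shows "row_act (a + b) y (mat_dsum A B) q
    = (if q < a then row_act a y A q else row_act b (\<lambda>p. y (a + p)) B (q - a))"
  unfolding row_act_def sum_lessThan_add using q
  by (auto simp: mat_dsum_index[OF A B])

lemma map2_dsum_level:
  assumes X: "X \<in> nc_level d a" and Y: "Y \<in> nc_level d b"
  shows "map2 mat_dsum X Y \<in> nc_level d (a + b)"
    and "t < d \<Longrightarrow> map2 mat_dsum X Y ! t = mat_dsum (X ! t) (Y ! t)"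
proof -
  have len: "length X = d" "length Y = d" using X Y by (auto simp: nc_level_def)
  show nth: "map2 mat_dsum X Y ! t = mat_dsum (X ! t) (Y ! t)" if "t < d" for t
    using that len by simp
  show "map2 mat_dsum X Y \<in> nc_level d (a + b)"
    unfolding nc_level_def using len nth nc_level_nth[OF X] nc_level_nth[OF Y]
    by (auto simp: in_set_conv_nth simp del: nth_map)
qed

lemma nc_ball_level_dsum:
  assumes X: "X \<in> nc_ball_level d a" and Y: "Y \<in> nc_ball_level d b"
  shows "map2 mat_dsum X Y \<in> nc_ball_level d (a + b)"
proof -
  have XY: "X \<in> nc_level d a" "Y \<in> nc_level d b" using X Y by (simp_all add: nc_ball_level_iff)
  obtain c c' where c: "0 \<le> c" "c < 1" "row_bound a c X" and c': "0 \<le> c'" "c' < 1" "row_bound b c' Y"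
    using X Y by (auto simp: nc_ball_level_iff)
  have len: "length X = d" "length Y = d" using XY by (auto simp: nc_level_def)
  have "row_bound (a + b) (max c c') (map2 mat_dsum X Y)"
    unfolding row_bound_def
  proof
    fix y :: "nat \<Rightarrow> complex"
    let ?z = "\<lambda>p. y (a + p)"
    have "sqnorm (a + b) (row_act (a + b) y (map2 mat_dsum X Y ! t))
        = sqnorm a (row_act a y (X ! t)) + sqnorm b (row_act b ?z (Y ! t))" if "t < d" for t
      unfolding sqnorm_add map2_dsum_level(2)[OF XY that]
      using row_act_dsum[OF nc_level_nth[OF XY(1) that] nc_level_nth[OF XY(2) that]]
      by (intro arg_cong2[of _ _ _ _ "(+)"] sqnorm_cong) auto
    then have "(\<Sum>t<d. sqnorm (a + b) (row_act (a + b) y (map2 mat_dsum X Y ! t)))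
        = (\<Sum>t<d. sqnorm a (row_act a y (X ! t))) + (\<Sum>t<d. sqnorm b (row_act b ?z (Y ! t)))"
      by (simp add: sum.distrib)
    also have "\<dots> \<le> c * sqnorm a y + c' * sqnorm b ?z"
      using c(3) c'(3) len unfolding row_bound_def by (intro add_mono) auto
    also have "\<dots> \<le> max c c' * sqnorm a y + max c c' * sqnorm b ?z"
      by (intro add_mono mult_right_mono) auto
    finally show "(\<Sum>t<length (map2 mat_dsum X Y). sqnorm (a + b) (row_act (a + b) y (map2 mat_dsum X Y ! t)))
        \<le> max c c' * sqnorm (a + b) y"
      using len by (simp add: sqnorm_add distrib_left)
  qed
  then show ?thesis
    using map2_dsum_level(1)[OF XY] c c' unfolding nc_ball_level_iff
    by (intro conjI exI[of _ "max c c'"]) auto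
qed

section \<open>Iterated direct sums and their match with ampliations\<close>

text \<open>This is the tensor product of the k by k identity with \<open>A\<close>, indexed by
  \<open>div\<close> and \<open>mod\<close> exactly as \<open>ampliation\<close> indexes its
  blocks.\<close>

definition block_diag :: "nat \<Rightarrow> nat \<Rightarrow> complex mat \<Rightarrow> complex mat" where
  "block_diag k n A = mat (k * n) (k * n)
     (\<lambda>(i, j). if i div n = j div n then A $$ (i mod n, j mod n) else 0)"

lemma block_diag_carrier [simp]: "block_diag k n A \<in> carrier_mat (k * n) (k * n)"
  by (simp add: block_diag_def)

lemma block_diag_one:
  assumes "A \<in> carrier_mat n n"
  shows "block_diag (Suc 0) n A = A"
  using assms by (intro eq_matI) (auto simp: block_diag_def)

lemma block_diag_Suc:
  assumes A: "A \<in> carrier_mat n n" and n: "n \<ge> 1"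
  shows "block_diag (Suc k) n A = mat_dsum A (block_diag k n A)"
proof (rule eq_matI)
  have c: "mat_dsum A (block_diag k n A) \<in> carrier_mat (n + k * n) (n + k * n)" using A by simp
  show "dim_row (block_diag (Suc k) n A) = dim_row (mat_dsum A (block_diag k n A))"
    "dim_col (block_diag (Suc k) n A) = dim_col (mat_dsum A (block_diag k n A))"
    using c by (simp_all add: block_diag_def)
  fix i j assume "i < dim_row (mat_dsum A (block_diag k n A))" "j < dim_col (mat_dsum A (block_diag k n A))"
  then have ij: "i < n + k * n" "j < n + k * n" using c by simp_all
  have dm: "p div n = Suc ((p - n) div n)" "p mod n = (p - n) mod n" if "\<not> p < n" for p
    using that n by (simp_all add: le_div_geq le_mod_geq)
  show "block_diag (Suc k) n A $$ (i, j) = mat_dsum A (block_diag k n A) $$ (i, j)"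
    unfolding mat_dsum_index[OF A block_diag_carrier ij] using ij
    by (auto simp: block_diag_def dm)
qed

lemma map_block_diag_Suc:
  assumes X: "X \<in> nc_level d n" and n: "n \<ge> 1"
  shows "map (block_diag (Suc k) n) X = map2 mat_dsum X (map (block_diag k n) X)"
proof (rule nth_equalityI)
  fix t assume t: "t < length (map (block_diag (Suc k) n) X)"
  then have "X ! t \<in> carrier_mat n n" using X by (auto simp: nc_level_def)
  then show "map (block_diag (Suc k) n) X ! t = map2 mat_dsum X (map (block_diag k n) X) ! t"
    using t by (simp add: block_diag_Suc[OF _ n])
qed simp

text \<open>Only binary direct sums are given, so one copy of \<open>X\<close> is added at a time.
  The induction starts at one copy because the ball has no level 0.\<close>

lemma nc_function_block_diag:
  assumes f: "nc_function d f" and X: "X \<in> nc_ball_level d n" and n: "n \<ge> 1" and "k \<ge> 1"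
  shows "map (block_diag k n) X \<in> nc_ball_level d (k * n) \<and>
    f (map (block_diag k n) X) = block_diag k n (f X)"
  using \<open>k \<ge> 1\<close>
proof (induction k rule: nat_induct_at_least)
  case base
  have lev: "X \<in> nc_level d n" using X by (simp add: nc_ball_level_iff)
  have "map (block_diag (Suc 0) n) X = X"
    using lev by (intro map_idI block_diag_one) (auto simp: nc_level_def)
  moreover have "f X \<in> carrier_mat n n" using f X n by (simp add: nc_function_def)
  ultimately show ?case using X by (simp add: block_diag_one)
next
  case (Suc k)
  have lev: "X \<in> nc_level d n" using X by (simp add: nc_ball_level_iff)
  have fX: "f X \<in> carrier_mat n n" using f X n by (simp add: nc_function_def)
  have "k * n \<ge> 1" using Suc.hyps n by (simp add: Suc_le_eq)
  then have "X \<in> nc_ball d" "map (block_diag k n) X \<in> nc_ball d"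
    using X n Suc.IH by (auto simp: nc_ball_def)
  then have "f (map (block_diag (Suc k) n) X) = block_diag (Suc k) n (f X)"
    using f Suc.IH unfolding map_block_diag_Suc[OF lev n] block_diag_Suc[OF fX n] nc_function_def by auto
  moreover have "map (block_diag (Suc k) n) X \<in> nc_ball_level d (n + k * n)"
    unfolding map_block_diag_Suc[OF lev n] by (rule nc_ball_level_dsum) (use X Suc.IH in auto)
  ultimately show ?case by simp
qed

lemma sum_blocks:
  fixes f :: "nat \<Rightarrow> complex"
  assumes n: "n \<ge> 1"
  shows "(\<Sum>p<k * n. f p) = (\<Sum>r<k. \<Sum>p<n. f (r * n + p))"
proof -
  have "(\<Sum>p<k * n. f p) = (\<Sum>r<k. sum f {r * n..<r * n + n})" by (rule sum.nat_group[symmetric])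
  also have "\<dots> = (\<Sum>r<k. \<Sum>p<n. f (r * n + p))"
  proof (rule sum.cong[OF refl])
    fix r
    show "sum f {r * n..<r * n + n} = (\<Sum>p<n. f (r * n + p))"
      using sum.shift_bounds_nat_ivl[of f 0 "r * n" n] by (simp add: lessThan_atLeast0 add.commute)
  qed
  finally show ?thesis .
qed

lemma block_index_less:
  fixes r p k n :: nat
  assumes "r < k" "p < n"
  shows "r * n + p < k * n"
proof -
  have "r * n + p < Suc r * n" using assms by simp
  also have "\<dots> \<le> k * n" using assms by (intro mult_le_mono1) simp
  finally show ?thesis .
qed

lemma block_diag_row_sum:
  assumes n: "n \<ge> 1" and i: "i < k * n"
  shows "(\<Sum>p<k * n. block_diag k n A $$ (i, p) * f p)
    = (\<Sum>p<n. A $$ (i mod n, p) * f ((i div n) * n + p))"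
proof -
  have ik: "i div n < k" using i n by (simp add: less_mult_imp_div_less)
  have "(\<Sum>p<k * n. block_diag k n A $$ (i, p) * f p)
      = (\<Sum>r<k. if r = i div n then (\<Sum>p<n. A $$ (i mod n, p) * f (r * n + p)) else 0)"
    unfolding sum_blocks[OF n]
    by (intro sum.cong refl) (use i block_index_less n in \<open>auto simp: block_diag_def intro!: sum.neutral sum.cong\<close>)
  then show ?thesis using ik by simp
qed

lemma mat_block_carrier [simp]: "mat_block n A r s \<in> carrier_mat n n"
  by (simp add: mat_block_def)

lemma ampliation_carrier [simp]: "ampliation k n T A \<in> carrier_mat (k * n) (k * n)"
  by (simp add: ampliation_def)

lemma ampliation_index:
  "i < k * n \<Longrightarrow> j < k * n \<Longrightarrow>
    ampliation k n T A $$ (i, j) = T (mat_block n A (i div n) (j div n)) $$ (i mod n, j mod n)"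
  by (simp add: ampliation_def)

text \<open>Multiplication by a block diagonal matrix with equal blocks acts on every block
  separately. This turns blockwise identities for the kernel into matrix identities of size k
  n.\<close>

lemma ampliation_conj:
  assumes A: "A \<in> carrier_mat n n" and G: "G \<in> carrier_mat (k * n) (k * n)" and n: "n \<ge> 1"
  shows "ampliation k n (\<lambda>P. A * P * mat_adjoint A) G
    = block_diag k n A * G * mat_adjoint (block_diag k n A)"
proof (rule eq_matI)
  let ?D = "block_diag k n A"
  have c: "?D * G * mat_adjoint ?D \<in> carrier_mat (k * n) (k * n)"
    using G by (intro mult_carrier_mat mat_adjoint_carrier) auto
  show "dim_row (ampliation k n (\<lambda>P. A * P * mat_adjoint A) G) = dim_row (?D * G * mat_adjoint ?D)"
    "dim_col (ampliation k n (\<lambda>P. A * P * mat_adjoint A) G) = dim_col (?D * G * mat_adjoint ?D)"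
    unfolding carrier_matD[OF c] by (simp_all add: ampliation_def)
  fix i j assume "i < dim_row (?D * G * mat_adjoint ?D)" "j < dim_col (?D * G * mat_adjoint ?D)"
  then have ij: "i < k * n" "j < k * n" unfolding carrier_matD[OF c] .
  have m: "i mod n < n" "j mod n < n" using n by simp_all
  have "(?D * G * mat_adjoint ?D) $$ (i, j)
      = (\<Sum>p<k * n. ?D $$ (i, p) * (\<Sum>q<k * n. G $$ (p, q) * cnj (?D $$ (j, q))))"
    unfolding conj_mat_index[OF block_diag_carrier G block_diag_carrier ij]
    by (simp add: sum_distrib_left mult.assoc)
  \<comment> \<open>Conjugating twice brings the right factor to the shape of the left one, so that
    \<open>block_diag_row_sum\<close> applies to both.\<close>
  also have "\<dots> = (\<Sum>p<k * n. ?D $$ (i, p) * cnj (\<Sum>q<k * n. ?D $$ (j, q) * cnj (G $$ (p, q))))"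
    by (simp add: mult.commute)
  also have "\<dots> = (\<Sum>p<n. A $$ (i mod n, p) *
      cnj (\<Sum>q<n. A $$ (j mod n, q) * cnj (G $$ ((i div n) * n + p, (j div n) * n + q))))"
    unfolding block_diag_row_sum[OF n ij(1)] block_diag_row_sum[OF n ij(2)] ..
  also have "\<dots> = (\<Sum>p<n. \<Sum>q<n. A $$ (i mod n, p) * mat_block n G (i div n) (j div n) $$ (p, q)
      * cnj (A $$ (j mod n, q)))"
    by (simp add: mat_block_def sum_distrib_left mult_ac)
  also have "\<dots> = ampliation k n (\<lambda>P. A * P * mat_adjoint A) G $$ (i, j)"
    unfolding ampliation_index[OF ij] conj_mat_index[OF A mat_block_carrier A m] ..
  finally show "ampliation k n (\<lambda>P. A * P * mat_adjoint A) G $$ (i, j) = (?D * G * mat_adjoint ?D) $$ (i, j)" ..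
qed

lemma mat_block_ampliation:
  assumes T: "T (mat_block n A r s) \<in> carrier_mat n n" and r: "r < k" "s < k"
  shows "mat_block n (ampliation k n T A) r s = T (mat_block n A r s)"
proof (rule eq_matI)
  show "dim_row (mat_block n (ampliation k n T A) r s) = dim_row (T (mat_block n A r s))"
    "dim_col (mat_block n (ampliation k n T A) r s) = dim_col (T (mat_block n A r s))"
    using T by (simp_all add: mat_block_def)
  fix i j assume "i < dim_row (T (mat_block n A r s))" "j < dim_col (T (mat_block n A r s))"
  then have ij: "i < n" "j < n" using T by simp_all
  show "mat_block n (ampliation k n T A) r s $$ (i, j) = T (mat_block n A r s) $$ (i, j)"
    using ij block_index_less r by (simp add: mat_block_def[of n "ampliation k n T A"] ampliation_index)
qed

section \<open>Necessity\<close>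

text \<open>The crude constant starts the iteration for the Stein equation, and it also provides the
  multiple of the identity that dominates G.\<close>

lemma qform_bound: "cmod (qform n G y) \<le> (\<Sum>p<n. \<Sum>q<n. cmod (G $$ (p, q))) * sqnorm n y"
proof -
  have ent: "cmod (y p * G $$ (p, q) * cnj (y q)) \<le> cmod (G $$ (p, q)) * sqnorm n y"
    if "p < n" "q < n" for p q
  proof -
    have le: "(cmod (y r))\<^sup>2 \<le> sqnorm n y" if "r < n" for r
      unfolding sqnorm_def using that by (intro member_le_sum) auto
    have "2 * (cmod (y p) * cmod (y q)) \<le> (cmod (y p))\<^sup>2 + (cmod (y q))\<^sup>2"
      using sum_squares_bound[of "cmod (y p)"] by (simp add: mult.assoc)
    then have "cmod (y p) * cmod (y q) \<le> sqnorm n y" using le[OF that(1)] le[OF that(2)] by linarith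
    then have "cmod (G $$ (p, q)) * (cmod (y p) * cmod (y q)) \<le> cmod (G $$ (p, q)) * sqnorm n y"
      by (intro mult_left_mono) auto
    then show ?thesis by (simp add: norm_mult mult_ac)
  qed
  have "cmod (qform n G y) \<le> (\<Sum>p<n. \<Sum>q<n. cmod (G $$ (p, q)) * sqnorm n y)"
    unfolding qform_def by (intro sum_norm_le) (use ent in auto)
  then show ?thesis by (simp add: sum_distrib_right)
qed

text \<open>
  A lower bound \<open>- M \<bar>y\<bar>\<^sup>2\<close> on the form improves to \<open>- c M \<bar>y\<bar>\<^sup>2\<close> by the Stein equation, and so on.
\<close>

lemma stein_qform_nonneg:
  assumes c: "0 \<le> c" "c < 1" and X: "row_bound n c X"
    and stein: "\<And>y. qform n G y = qform n A y + (\<Sum>t<length X. qform n G (row_act n y (X ! t)))"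
    and A: "\<And>y. qform n A y \<in> \<real>\<^sub>\<ge>\<^sub>0"
  shows "qform n G y \<in> \<real>\<^sub>\<ge>\<^sub>0"
proof -
  define M where "M = (\<Sum>p<n. \<Sum>q<n. cmod (G $$ (p, q)))"
  have M: "0 \<le> M" by (simp add: M_def sum_nonneg)
  \<comment> \<open>The imaginary part is treated along with the lower bound: the form of
    \<open>A\<close> is real, so it obeys the same recursion and shrinks by the factor
    \<open>c\<close> as well.\<close>
  have step: "- (M * c ^ j) * sqnorm n y \<le> Re (qform n G y) \<and> \<bar>Im (qform n G y)\<bar> \<le> M * c ^ j * sqnorm n y" for j y
  proof (induction j arbitrary: y)
    case 0
    have "cmod (qform n G y) \<le> M * sqnorm n y" unfolding M_def by (rule qform_bound)
    then show ?case using abs_Re_le_cmod[of "qform n G y"] abs_Im_le_cmod[of "qform n G y"] by simp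
  next
    case (Suc j)
    have a: "0 \<le> Re (qform n A y)" "Im (qform n A y) = 0" using A[of y] by (auto simp: nonneg_Reals_iff)
    have rb: "M * c ^ j * (\<Sum>t<length X. sqnorm n (row_act n y (X ! t))) \<le> M * c ^ j * (c * sqnorm n y)"
      using X M c unfolding row_bound_def by (intro mult_left_mono) auto
    have "(\<Sum>t<length X. - (M * c ^ j) * sqnorm n (row_act n y (X ! t)))
        \<le> (\<Sum>t<length X. Re (qform n G (row_act n y (X ! t))))"
      using Suc.IH by (intro sum_mono) auto
    also have "\<dots> \<le> Re (qform n G y)" by (subst (2) stein) (use a in simp)
    finally have re: "- (M * c ^ j) * (\<Sum>t<length X. sqnorm n (row_act n y (X ! t))) \<le> Re (qform n G y)"
      by (simp add: sum_distrib_left sum_negf)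
    have "\<bar>Im (qform n G y)\<bar> \<le> (\<Sum>t<length X. \<bar>Im (qform n G (row_act n y (X ! t)))\<bar>)"
      by (subst stein) (use a in \<open>simp add: sum_abs\<close>)
    also have "\<dots> \<le> (\<Sum>t<length X. M * c ^ j * sqnorm n (row_act n y (X ! t)))"
      using Suc.IH by (intro sum_mono) auto
    finally have im: "\<bar>Im (qform n G y)\<bar> \<le> M * c ^ j * (\<Sum>t<length X. sqnorm n (row_act n y (X ! t)))"
      by (simp add: sum_distrib_left)
    show ?case using re im rb by (simp add: mult_ac)
  qed
  have lim: "(\<lambda>j. M * c ^ j * sqnorm n y) \<longlonglongrightarrow> 0"
    using c by (auto intro!: tendsto_eq_intros LIMSEQ_power_zero)
  have "\<bar>Im (qform n G y)\<bar> \<le> 0"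
    by (rule LIMSEQ_le_const[OF lim]) (use step in auto)
  moreover have "- Re (qform n G y) \<le> 0"
    by (rule LIMSEQ_le_const[OF lim], intro exI allI impI) (use step[where y = y] in \<open>simp add: minus_le_iff\<close>)
  ultimately show ?thesis by (simp add: nonneg_Reals_iff)
qed

text \<open>The Cholesky factor is square, so G = B B^*, and the lower bound \<epsilon> makes the
  map from y to y B injective, hence B invertible.\<close>

lemma positive_definite_factor:
  assumes G: "G \<in> carrier_mat n n" and "\<epsilon> > 0"
    and real: "\<And>y. Im (qform n G y) = 0"
    and pos: "\<And>y. \<epsilon> * sqnorm n y \<le> Re (qform n G y)"
  obtains B B' where "B \<in> carrier_mat n n" "B' \<in> carrier_mat n n" "B * B' = 1\<^sub>m n" "B' * B = 1\<^sub>m n"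
    "\<And>y. sqnorm n (row_act n y B) = Re (qform n G y)"
proof -
  have "qform n G y \<in> \<real>\<^sub>\<ge>\<^sub>0" for y
    using real[of y] pos[of y] \<open>\<epsilon> > 0\<close> sqnorm_nonneg[of n y]
    by (auto simp: nonneg_Reals_iff intro: order_trans[rotated])
  then have "(\<Sum>p\<in>{..<n}. \<Sum>q\<in>{..<n}. y p * G $$ (p, q) * cnj (y q)) \<in> \<real>\<^sub>\<ge>\<^sub>0" for y
    by (simp add: qform_def)
  from psd_form_factor[where G = "\<lambda>p q. G $$ (p, q)", OF finite_lessThan this] obtain L where
    L: "\<And>p q. p < n \<Longrightarrow> q < n \<Longrightarrow> G $$ (p, q) = (\<Sum>k<n. L p k * cnj (L q k))" by auto
  define B where "B = mat n n (\<lambda>(p, k). L p k)"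
  have B: "B \<in> carrier_mat n n" by (simp add: B_def)
  have q: "sqnorm n (row_act n y B) = Re (qform n G y)" for y
  proof -
    have "qform n G y = (\<Sum>p<n. \<Sum>q<n. \<Sum>k<n. (y p * L p k) * cnj (y q * L q k))"
      unfolding qform_def
      by (intro sum.cong refl) (simp add: L sum_distrib_left sum_distrib_right mult_ac)
    also have "\<dots> = (\<Sum>p<n. \<Sum>k<n. \<Sum>q<n. (y p * L p k) * cnj (y q * L q k))"
      by (intro sum.cong refl sum.swap)
    also have "\<dots> = (\<Sum>k<n. \<Sum>p<n. \<Sum>q<n. (y p * L p k) * cnj (y q * L q k))" by (rule sum.swap)
    also have "\<dots> = (\<Sum>k<n. row_act n y B k * cnj (row_act n y B k))"
      by (intro sum.cong refl) (simp add: row_act_def B_def sum_product)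
    also have "\<dots> = complex_of_real (sqnorm n (row_act n y B))"
      by (simp add: sqnorm_def complex_norm_square del: of_real_power)
    finally show ?thesis by simp
  qed
  \<comment> \<open>A row vector killed by \<open>B\<close> is a column vector killed by its
    transpose.\<close>
  have "det (transpose_mat B) \<noteq> 0"
  proof
    assume "det (transpose_mat B) = 0"
    then obtain v where v: "v \<in> carrier_vec n" "v \<noteq> 0\<^sub>v n" "transpose_mat B *\<^sub>v v = 0\<^sub>v n"
      using det_0_iff_vec_prod_zero_field[of "transpose_mat B" n] B by auto
    have "row_act n (\<lambda>p. v $ p) B k = (transpose_mat B *\<^sub>v v) $ k" if "k < n" for k
      using B v(1) that by (simp add: row_act_def scalar_prod_def lessThan_atLeast0 mult.commute)
    then have "sqnorm n (row_act n (\<lambda>p. v $ p) B) = 0"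
      using v(3) by (simp add: sqnorm_def)
    then have "\<epsilon> * sqnorm n (\<lambda>p. v $ p) \<le> 0" using q pos by metis
    then have "sqnorm n (\<lambda>p. v $ p) = 0"
      using \<open>\<epsilon> > 0\<close> by (intro antisym) (simp_all add: mult_le_0_iff)
    then have "v $ p = 0" if "p < n" for p
      using that unfolding sqnorm_def by (subst (asm) sum_nonneg_eq_0_iff) auto
    then show False using v by (metis eq_vecI carrier_vecD index_zero_vec)
  qed
  then have "det B \<noteq> 0" using det_transpose[OF B] by simp
  then obtain B' where "B' \<in> carrier_mat n n" "B * B' = 1\<^sub>m n" "B' * B = 1\<^sub>m n"
    using det_non_zero_imp_unit[OF B] unfolding Units_def ring_mat_def using B by auto
  then show ?thesis using that[OF B _ _ _ q] by blast
qed

lemma row_act_inverse: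
  assumes "B \<in> carrier_mat n n" "B' \<in> carrier_mat n n" "B * B' = 1\<^sub>m n" "q < n"
  shows "row_act n (row_act n y B) B' q = y q"
  using row_act_mult[OF assms(1,2,4), of y] row_act_one[OF assms(4), of y] assms(3) by simp

text \<open>Conjugating by a factor of G + \<epsilon> turns the norm of that form into the standard
  one, in which \<open>f\<close> is contractive on the ball; invariance under similarity carries the
  contraction back to \<open>X\<close>.\<close>

lemma nc_function_qform_le:
  assumes f: "nc_function d f" and bd: "\<And>X. X \<in> nc_ball d \<Longrightarrow> op_norm (f X) \<le> 1"
    and X: "X \<in> nc_ball_level d n" and n: "n \<ge> 1"
    and G: "G \<in> carrier_mat n n" "\<And>y. qform n G y \<in> \<real>\<^sub>\<ge>\<^sub>0"
    and stein: "\<And>y. (\<Sum>t<d. Re (qform n G (row_act n y (X ! t)))) \<le> Re (qform n G y)"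
  shows "Re (qform n G (row_act n y (f X))) \<le> Re (qform n G y)"
proof -
  have lev: "X \<in> nc_level d n" using X by (simp add: nc_ball_level_iff)
  have len: "length X = d" using lev by (simp add: nc_level_def)
  note Xt = nc_level_nth[OF lev]
  obtain c where c: "0 \<le> c" "c < 1" "row_bound n c X" using X by (auto simp: nc_ball_level_iff)
  have fX: "f X \<in> carrier_mat n n" using f X n by (simp add: nc_function_def)
  define M where "M = (\<Sum>p<n. \<Sum>q<n. cmod (G $$ (p, q)))"
  have M: "0 \<le> M" by (simp add: M_def sum_nonneg)
  have GM: "Re (qform n G z) \<le> M * sqnorm n z" for z
    unfolding M_def by (rule order_trans[OF complex_Re_le_cmod qform_bound])
  have eps: "Re (qform n G (row_act n y (f X))) \<le> Re (qform n G y) + \<epsilon> * sqnorm n y" if e: "\<epsilon> > 0" for \<epsilon>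
  proof -
    define E where "E = G + complex_of_real \<epsilon> \<cdot>\<^sub>m 1\<^sub>m n"
    have E: "E \<in> carrier_mat n n" using G by (simp add: E_def)
    have qE: "qform n E z = qform n G z + complex_of_real (\<epsilon> * sqnorm n z)" for z
      using G by (simp add: E_def qform_add[of _ n] qform_smult[of _ n] qform_one)
    have G0: "Im (qform n G z) = 0" "0 \<le> Re (qform n G z)" for z
      using G(2)[of z] by (auto simp: nonneg_Reals_iff)
    obtain B B' where B: "B \<in> carrier_mat n n" "B' \<in> carrier_mat n n" "B * B' = 1\<^sub>m n" "B' * B = 1\<^sub>m n"
      and qB: "\<And>z. sqnorm n (row_act n z B) = Re (qform n E z)"
      by (rule positive_definite_factor[OF E e]) (use G0 in \<open>auto simp: qE\<close>)
    \<comment> \<open>With g = G(z) / |z|^2 <= M, the ratio (g + \<epsilon> c) / (g + \<epsilon>)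
      increases with g; \<open>c'\<close> is its value at g = M and is below 1.\<close>
    define c' where "c' = (M + \<epsilon> * c) / (M + \<epsilon>)"
    have c': "0 \<le> c'" "c' < 1" using c M e by (simp_all add: c'_def)
    have contr: "(\<Sum>t<d. Re (qform n E (row_act n z (X ! t)))) \<le> c' * Re (qform n E z)" for z
    proof -
      have rb: "(\<Sum>t<d. sqnorm n (row_act n z (X ! t))) \<le> c * sqnorm n z"
        using c(3) len by (simp add: row_bound_def)
      have "(\<Sum>t<d. Re (qform n E (row_act n z (X ! t))))
          = (\<Sum>t<d. Re (qform n G (row_act n z (X ! t)))) + \<epsilon> * (\<Sum>t<d. sqnorm n (row_act n z (X ! t)))"
        by (simp add: qE sum.distrib sum_distrib_left)
      also have "\<dots> \<le> Re (qform n G z) + \<epsilon> * (c * sqnorm n z)"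
        using rb stein e by (intro add_mono mult_left_mono) auto
      also have "\<dots> \<le> c' * (Re (qform n G z) + \<epsilon> * sqnorm n z)"
      proof -
        \<comment> \<open>This product is exactly the difference of the two sides of the inequality
          that follows.\<close>
        have "0 \<le> (1 - c) * \<epsilon> * (M * sqnorm n z - Re (qform n G z))"
          using c e GM[of z] by simp
        then have "(M + \<epsilon>) * (Re (qform n G z) + \<epsilon> * (c * sqnorm n z))
            \<le> (M + \<epsilon> * c) * (Re (qform n G z) + \<epsilon> * sqnorm n z)"
          by (simp add: algebra_simps)
        then show ?thesis using M e by (simp add: c'_def field_simps)
      qed
      finally show ?thesis by (simp add: qE)
    qed
    define T where "T = map (\<lambda>A. B' * A * B) X"
    have T_nth: "T ! t = B' * X ! t * B" if "t < d" for t using that len by (simp add: T_def)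
    \<comment> \<open>The squared norm after \<open>B\<close> is the form of E, so the action of a
      conjugated matrix is measured by E on the unconjugated one.\<close>
    have actT: "sqnorm n (row_act n z (B' * A * B)) = Re (qform n E (row_act n (row_act n z B') A))"
      if A: "A \<in> carrier_mat n n" for z A
    proof -
      have BA: "B' * A \<in> carrier_mat n n" using A B by simp
      have "sqnorm n (row_act n z (B' * A * B)) = sqnorm n (row_act n (row_act n z (B' * A)) B)"
        by (intro sqnorm_cong row_act_mult BA B)
      also have "row_act n (row_act n z (B' * A)) B = row_act n (row_act n (row_act n z B') A) B"
        by (intro row_act_cong row_act_mult A B)
      finally show ?thesis by (simp add: qB)
    qed
    have T: "T \<in> nc_ball_level d n"
      unfolding nc_ball_level_iff
    proof (intro conjI exI[of _ c'] c')
      show "T \<in> nc_level d n" using lev B by (auto simp: nc_level_def T_def)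
      show "row_bound n c' T"
        unfolding row_bound_def
      proof
        fix z
        have "(\<Sum>t<length T. sqnorm n (row_act n z (T ! t)))
            = (\<Sum>t<d. Re (qform n E (row_act n (row_act n z B') (X ! t))))"
          using len by (intro sum.cong) (auto simp: T_nth actT[OF Xt], simp_all add: T_def)
        also have "\<dots> \<le> c' * Re (qform n E (row_act n z B'))" by (rule contr)
        also have "\<dots> = c' * sqnorm n (row_act n (row_act n z B') B)" by (simp add: qB)
        also have "sqnorm n (row_act n (row_act n z B') B) = sqnorm n z"
          by (intro sqnorm_cong row_act_inverse B)
        finally show "(\<Sum>t<length T. sqnorm n (row_act n z (T ! t))) \<le> c' * sqnorm n z" .
      qed
    qed
    have fT: "f T = B' * f X * B"
    proof -
      have "inverts_mat B B'" "inverts_mat B' B" using B by (simp_all add: inverts_mat_def)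
      then show ?thesis using f X T B n unfolding nc_function_def T_def by blast
    qed
    have "op_norm (f T) \<le> 1" using T n by (intro bd) (auto simp: nc_ball_def)
    then have contr_f: "sqnorm n (row_act n z (B' * f X * B)) \<le> sqnorm n z" for z
      using op_norm_bound_row[of "f T" n 1 z] B fX by (simp add: fT)
    \<comment> \<open>Writing y as (y B) B' makes the left side the squared norm of y B acted on by
      f(T), where the contraction applies.\<close>
    have "Re (qform n E (row_act n y (f X))) = Re (qform n E (row_act n (row_act n (row_act n y B) B') (f X)))"
      using row_act_cong[of n "row_act n (row_act n y B) B'" y "f X"] row_act_inverse[OF B(1-3)] by simp
    also have "\<dots> = sqnorm n (row_act n (row_act n y B) (B' * f X * B))" by (rule actT[OF fX, symmetric])
    also have "\<dots> \<le> sqnorm n (row_act n y B)" by (rule contr_f)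
    also have "\<dots> = Re (qform n E y)" by (rule qB)
    finally have "Re (qform n G (row_act n y (f X))) + \<epsilon> * sqnorm n (row_act n y (f X))
        \<le> Re (qform n G y) + \<epsilon> * sqnorm n y" by (simp add: qE)
    moreover have "0 \<le> \<epsilon> * sqnorm n (row_act n y (f X))" using e by simp
    ultimately show ?thesis by linarith
  qed
  show ?thesis
  proof (rule field_le_epsilon)
    fix e :: real assume "0 < e"
    \<comment> \<open>The summand 1 keeps the denominator positive when \<open>y\<close>
      vanishes.\<close>
    define \<epsilon> where "\<epsilon> = e / (sqnorm n y + 1)"
    have s: "0 < sqnorm n y + 1" by (rule add_nonneg_pos) simp_all
    have "\<epsilon> > 0" using \<open>0 < e\<close> s by (simp add: \<epsilon>_def)
    moreover have "\<epsilon> * sqnorm n y \<le> e"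
      using \<open>0 < e\<close> s by (simp add: \<epsilon>_def field_simps)
    ultimately show "Re (qform n G (row_act n y (f X))) \<le> Re (qform n G y) + e"
      using eps[of \<epsilon>] by linarith
  qed
qed

text \<open>\<open>szego_kernel_left\<close> holds in each block, and conjugating each block by X_t
  is conjugation by its block diagonal copy.\<close>

lemma ampliation_szego_kernel:
  assumes X: "X \<in> nc_ball_level d n" and n: "n \<ge> 1"
    and A: "A \<in> carrier_mat (k * n) (k * n)"
    and G: "G = ampliation k n (szego_kernel d X X) A"
  shows "G = A + mat_sum (k * n) (\<lambda>t. block_diag k n (X ! t) * G * mat_adjoint (block_diag k n (X ! t))) {..<d}"
    (is "G = A + ?S")
proof (rule eq_matI)
  have Gc: "G \<in> carrier_mat (k * n) (k * n)" by (simp add: G)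
  show "dim_row G = dim_row (A + ?S)" "dim_col G = dim_col (A + ?S)" using Gc by simp_all
  fix i j assume "i < dim_row (A + ?S)" "j < dim_col (A + ?S)"
  then have ij: "i < k * n" "j < k * n" by simp_all
  have r: "i div n < k" "j div n < k" using ij n by (simp_all add: less_mult_imp_div_less)
  have m: "i mod n < n" "j mod n < n" using n by simp_all
  let ?P = "mat_block n A (i div n) (j div n)"
  have lev: "X \<in> nc_level d n" using X by (simp add: nc_ball_level_iff)
  have blk: "mat_block n G (i div n) (j div n) = szego_kernel d X X ?P"
    unfolding G by (intro mat_block_ampliation szego_kernel_carrier[OF X] mat_block_carrier r)
  have "G $$ (i, j) = szego_kernel d X X ?P $$ (i mod n, j mod n)"
    by (simp only: G ampliation_index[OF ij])
  also have "\<dots> = ?P $$ (i mod n, j mod n)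
      + (\<Sum>t<d. (X ! t * szego_kernel d X X ?P * mat_adjoint (X ! t)) $$ (i mod n, j mod n))"
    by (subst szego_kernel_left[OF X mat_block_carrier]) (simp add: m)
  also have "?P $$ (i mod n, j mod n) = A $$ (i, j)" using m by (simp add: mat_block_def)
  also have "(\<Sum>t<d. (X ! t * szego_kernel d X X ?P * mat_adjoint (X ! t)) $$ (i mod n, j mod n))
      = (\<Sum>t<d. (block_diag k n (X ! t) * G * mat_adjoint (block_diag k n (X ! t))) $$ (i, j))"
    by (rule sum.cong[OF refl], subst ampliation_conj[symmetric, OF _ Gc n])
      (use nc_level_nth[OF lev] in \<open>auto simp: ampliation_index[OF ij] blk\<close>)
  finally show "G $$ (i, j) = (A + ?S) $$ (i, j)" using ij by simp
qed

lemma conj_mat_carrier [simp]: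
  "A \<in> carrier_mat n n \<Longrightarrow> P \<in> carrier_mat n n \<Longrightarrow> A * P * mat_adjoint A \<in> carrier_mat n n"
  by (intro mult_carrier_mat mat_adjoint_carrier)

lemma conj_mat_add:
  assumes "A \<in> carrier_mat n n" "P \<in> carrier_mat n n" "Q \<in> carrier_mat n n"
  shows "A * (P + Q) * mat_adjoint A = A * P * mat_adjoint A + A * Q * mat_adjoint A"
  using assms mat_adjoint_carrier[OF assms(1)]
  by (simp add: mult_add_distrib_mat[of _ n n _ n] add_mult_distrib_mat[of _ n n _ _ n])

lemma conj_mat_smult:
  assumes "A \<in> carrier_mat n n" "P \<in> carrier_mat n n"
  shows "A * (c \<cdot>\<^sub>m P) * mat_adjoint A = c \<cdot>\<^sub>m (A * P * mat_adjoint A)"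
  using assms mat_adjoint_carrier[OF assms(1)]
  by (simp add: mult_smult_distrib[of _ n n _ n] mult_smult_assoc_mat[of _ n n _ n])

lemma add_diff_add_mat:
  fixes A B C D :: "complex mat"
  assumes "A \<in> carrier_mat n n" "B \<in> carrier_mat n n" "C \<in> carrier_mat n n" "D \<in> carrier_mat n n"
  shows "A + B - (C + D) = (A - C) + (B - D)"
  using assms by (intro eq_matI) auto

lemma smult_diff_mat:
  fixes A B :: "complex mat"
  assumes "A \<in> carrier_mat n n" "B \<in> carrier_mat n n"
  shows "c \<cdot>\<^sub>m A - c \<cdot>\<^sub>m B = c \<cdot>\<^sub>m (A - B)"
  using assms by (intro eq_matI) (auto simp: algebra_simps)

text \<open>The value of \<open>f\<close> at k copies of \<open>X\<close> is k copies of f(X).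
  Positivity of the k-th ampliation is thus the inequality \<open>nc_function_qform_le\<close> at
  the k-fold direct sum, with G the ampliated kernel.\<close>

lemma contraction_implies_completely_positive:
  assumes f: "nc_function d f" and bd: "\<And>X. X \<in> nc_ball d \<Longrightarrow> op_norm (f X) \<le> 1"
    and X: "X \<in> nc_ball_level d n" and n: "n \<ge> 1"
  shows "completely_positive n (\<lambda>P. szego_kernel d X X P - f X * szego_kernel d X X P * mat_adjoint (f X))"
    (is "completely_positive n ?T")
proof -
  let ?K = "szego_kernel d X X" and ?W = "f X"
  have W: "?W \<in> carrier_mat n n" using f X n by (simp add: nc_function_def)
  have lev: "X \<in> nc_level d n" using X by (simp add: nc_ball_level_iff)
  have len: "length X = d" using lev by (simp add: nc_level_def)
  note K = szego_kernel_carrier[OF X]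
  have T: "?T P \<in> carrier_mat n n" if "P \<in> carrier_mat n n" for P
    by (intro minus_carrier_mat conj_mat_carrier W K that)
  have "linear_mat_map n ?T"
    unfolding linear_mat_map_def
  proof (intro conjI ballI allI)
    fix P Q :: "complex mat" assume PQ: "P \<in> carrier_mat n n" "Q \<in> carrier_mat n n"
    note c = K[OF PQ(1)] K[OF PQ(2)]
    note c' = conj_mat_carrier[OF W c(1)] conj_mat_carrier[OF W c(2)]
    show "?T (P + Q) = ?T P + ?T Q"
      unfolding szego_kernel_add[OF X PQ] conj_mat_add[OF W c] by (rule add_diff_add_mat[OF c c'])
  next
    fix a and P :: "complex mat" assume P: "P \<in> carrier_mat n n"
    show "?T (a \<cdot>\<^sub>m P) = a \<cdot>\<^sub>m ?T P"
      unfolding szego_kernel_smult[OF X P] conj_mat_smult[OF W K[OF P]]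
      by (rule smult_diff_mat[OF K[OF P] conj_mat_carrier[OF W K[OF P]]])
  qed (rule T)
  moreover have "psd_mat (k * n) (ampliation k n ?T A)" if k: "k \<ge> 1" and psd: "psd_mat (k * n) A" for k A
  proof -
    let ?N = "k * n" and ?D = "block_diag k n"
    have A: "A \<in> carrier_mat ?N ?N" using psd by (simp add: psd_mat_def)
    then have A0: "qform ?N A y \<in> \<real>\<^sub>\<ge>\<^sub>0" for y using psd psd_mat_iff_qform by blast
    define G where "G = ampliation k n ?K A"
    have G: "G \<in> carrier_mat ?N ?N" by (simp add: G_def)
    have XD: "map ?D X \<in> nc_ball_level d ?N" "f (map ?D X) = ?D ?W"
      using nc_function_block_diag[OF f X n k] by auto
    have N: "?N \<ge> 1" using n k by (simp add: Suc_le_eq)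
    obtain c where c: "0 \<le> c" "c < 1" "row_bound ?N c (map ?D X)" using XD by (auto simp: nc_ball_level_iff)
    have steinG: "qform ?N G y = qform ?N A y + (\<Sum>t<d. qform ?N G (row_act ?N y (?D (X ! t))))" for y
      by (subst ampliation_szego_kernel[OF X n A G_def])
        (simp add: qform_add[OF A] qform_mat_sum qform_conj[OF block_diag_carrier G])
    have Gpos: "qform ?N G y \<in> \<real>\<^sub>\<ge>\<^sub>0" for y
      by (rule stein_qform_nonneg[OF c _ A0]) (simp add: len steinG[symmetric])
    have "Re (qform ?N G (row_act ?N y (?D ?W))) \<le> Re (qform ?N G y)" for y
      unfolding XD(2)[symmetric]
    proof (rule nc_function_qform_le[OF f bd XD(1) N G Gpos])
      fix z
      have "0 \<le> Re (qform ?N A z)" using A0[of z] by (simp add: nonneg_Reals_iff)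
      then show "(\<Sum>t<d. Re (qform ?N G (row_act ?N z (map ?D X ! t)))) \<le> Re (qform ?N G z)"
        unfolding steinG[of z] using len by simp
    qed
    moreover have "ampliation k n ?T A = G - ?D ?W * G * mat_adjoint (?D ?W)"
    proof (rule eq_matI)
      have c: "?D ?W * G * mat_adjoint (?D ?W) \<in> carrier_mat ?N ?N" using G by simp
      show "dim_row (ampliation k n ?T A) = dim_row (G - ?D ?W * G * mat_adjoint (?D ?W))"
        "dim_col (ampliation k n ?T A) = dim_col (G - ?D ?W * G * mat_adjoint (?D ?W))"
        using carrier_matD[OF c] by (simp_all add: ampliation_def)
      fix i j assume "i < dim_row (G - ?D ?W * G * mat_adjoint (?D ?W))"
        "j < dim_col (G - ?D ?W * G * mat_adjoint (?D ?W))"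
      then have ij: "i < ?N" "j < ?N" using carrier_matD[OF c] by simp_all
      have r: "i div n < k" "j div n < k" using ij n by (simp_all add: less_mult_imp_div_less)
      have m: "i mod n < n" "j mod n < n" using n by simp_all
      let ?P = "mat_block n A (i div n) (j div n)"
      have KP: "?K ?P \<in> carrier_mat n n" by (rule K[OF mat_block_carrier])
      have blk: "mat_block n G (i div n) (j div n) = ?K ?P"
        unfolding G_def by (intro mat_block_ampliation KP r)
      have "(?D ?W * G * mat_adjoint (?D ?W)) $$ (i, j) = (?W * ?K ?P * mat_adjoint ?W) $$ (i mod n, j mod n)"
        by (simp only: ampliation_conj[symmetric, OF W G n] ampliation_index[OF ij] blk)
      moreover have "G $$ (i, j) = ?K ?P $$ (i mod n, j mod n)"
        by (simp only: G_def ampliation_index[OF ij])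
      ultimately show "ampliation k n ?T A $$ (i, j) = (G - ?D ?W * G * mat_adjoint (?D ?W)) $$ (i, j)"
        unfolding ampliation_index[OF ij]
        using ij m carrier_matD[OF c] carrier_matD[OF conj_mat_carrier[OF W KP]]
        by (simp del: index_mult_mat)
    qed
    moreover have D: "?D ?W * G * mat_adjoint (?D ?W) \<in> carrier_mat ?N ?N"
      by (rule conj_mat_carrier[OF block_diag_carrier G])
    ultimately show ?thesis
      using Gpos psd_mat_iff_qform[OF minus_carrier_mat[OF D]]
      by (simp add: qform_diff[OF G D] qform_conj[OF block_diag_carrier G] nonneg_Reals_iff)
  qed
  ultimately show ?thesis by (simp add: completely_positive_def)
qed

section \<open>Kraus operators and the lurking isometry\<close>

definition unit_mat :: "nat \<Rightarrow> nat \<Rightarrow> nat \<Rightarrow> complex mat" where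
  "unit_mat n a b = mat n n (\<lambda>(i, j). if i = a \<and> j = b then 1 else 0)"

lemma unit_mat_carrier [simp]: "unit_mat n a b \<in> carrier_mat n n"
  by (simp add: unit_mat_def)

lemma sum_unit_mat:
  assumes "a < n" "b < n"
  shows "(\<Sum>p<n. \<Sum>q<n. x p * unit_mat n a b $$ (p, q) * z q) = x a * z b"
proof -
  have "(\<Sum>p<n. \<Sum>q<n. x p * unit_mat n a b $$ (p, q) * z q)
      = (\<Sum>p<n. \<Sum>q<n. if q = b then if p = a then x a * z b else 0 else 0)"
    by (intro sum.cong refl) (auto simp: unit_mat_def)
  then show ?thesis using assms by simp
qed

lemma linear_mat_map_mat_sum:
  assumes T: "linear_mat_map n T" and "finite S" and "\<And>s. s \<in> S \<Longrightarrow> F s \<in> carrier_mat n n"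
  shows "T (mat_sum n F S) = mat_sum n (\<lambda>s. T (F s)) S"
  using assms(2,3)
proof (induction S)
  case empty
  have z: "mat_sum n (F' :: 'a \<Rightarrow> _) {} = 0\<^sub>m n n" for F' by (intro eq_matI) auto
  have "T (0 \<cdot>\<^sub>m 0\<^sub>m n n) = 0 \<cdot>\<^sub>m T (0\<^sub>m n n)"
    using T zero_carrier_mat unfolding linear_mat_map_def by blast
  moreover have "T (0\<^sub>m n n) \<in> carrier_mat n n" using T by (simp add: linear_mat_map_def)
  then have "0 \<cdot>\<^sub>m T (0\<^sub>m n n) = 0\<^sub>m n n" by (intro eq_matI) auto
  moreover have "0 \<cdot>\<^sub>m 0\<^sub>m n n = (0\<^sub>m n n :: complex mat)" by (intro eq_matI) auto
  ultimately show ?case by (simp add: z)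
next
  case (insert s S)
  have ins: "mat_sum n G (insert s S) = G s + mat_sum n G S" if "G s \<in> carrier_mat n n" for G
    using insert.hyps that by (intro eq_matI) auto
  have Fs: "F s \<in> carrier_mat n n" "T (F s) \<in> carrier_mat n n"
    using insert.prems T by (simp_all add: linear_mat_map_def)
  have "T (F s + mat_sum n F S) = T (F s) + T (mat_sum n F S)"
    using T Fs by (simp add: linear_mat_map_def)
  then show ?case using insert.IH insert.prems Fs by (simp add: ins)
qed

lemma linear_mat_map_index:
  assumes T: "linear_mat_map n T" and Q: "Q \<in> carrier_mat n n" and ij: "i < n" "j < n"
  shows "T Q $$ (i, j) = (\<Sum>p<n. \<Sum>q<n. Q $$ (p, q) * T (unit_mat n p q) $$ (i, j))"
proof -
  let ?S = "{..<n} \<times> {..<n}" and ?F = "\<lambda>s. Q $$ s \<cdot>\<^sub>m unit_mat n (fst s) (snd s)"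
  have "Q = mat_sum n ?F ?S"
  proof (rule eq_matI)
    fix i j assume "i < dim_row (mat_sum n ?F ?S)" "j < dim_col (mat_sum n ?F ?S)"
    then have ij: "i < n" "j < n" by simp_all
    have "mat_sum n ?F ?S $$ (i, j) = (\<Sum>s\<in>?S. if s = (i, j) then Q $$ (i, j) else 0)"
      unfolding mat_sum_index[OF ij] using ij by (intro sum.cong refl) (auto simp: unit_mat_def)
    then show "Q $$ (i, j) = mat_sum n ?F ?S $$ (i, j)" using ij by simp
  qed (use Q in auto)
  then have "T Q = mat_sum n (\<lambda>s. T (?F s)) ?S"
    using linear_mat_map_mat_sum[OF T, of ?S ?F] by simp
  also have "\<dots> $$ (i, j) = (\<Sum>s\<in>?S. T (?F s) $$ (i, j))" using ij by simp
  also have "\<dots> = (\<Sum>s\<in>?S. Q $$ s * T (unit_mat n (fst s) (snd s)) $$ (i, j))"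
  proof (rule sum.cong[OF refl])
    fix s
    have "T (?F s) = Q $$ s \<cdot>\<^sub>m T (unit_mat n (fst s) (snd s))" "T (unit_mat n (fst s) (snd s)) \<in> carrier_mat n n"
      using T by (simp_all add: linear_mat_map_def)
    then show "T (?F s) $$ (i, j) = Q $$ s * T (unit_mat n (fst s) (snd s)) $$ (i, j)" using ij by simp
  qed
  finally show ?thesis by (simp add: sum.cartesian_product case_prod_unfold)
qed

text \<open>Choi's argument: the ampliation of T at the matrix of all matrix units is positive, its
  factorisation has n^2 columns, and each column reshaped to an n by n matrix is a Kraus
  operator.\<close>

lemma kraus_decomposition:
  assumes cp: "completely_positive n T" and n: "n \<ge> 1"
  obtains H :: "nat \<Rightarrow> nat \<Rightarrow> nat \<Rightarrow> complex"
  where "\<And>Q i j. Q \<in> carrier_mat n n \<Longrightarrow> i < n \<Longrightarrow> j < n \<Longrightarrow>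
    T Q $$ (i, j) = (\<Sum>k<n * n. \<Sum>p<n. \<Sum>q<n. H k i p * Q $$ (p, q) * cnj (H k j q))"
proof -
  let ?N = "n * n"
  have T: "linear_mat_map n T" using cp by (simp add: completely_positive_def)
  \<comment> \<open>Block (p, q) of \<open>J\<close> is the matrix unit at (p, q). As a whole
    \<open>J\<close> is e e^* for the vector \<open>e\<close> used below, hence positive of rank
    one.\<close>
  define J :: "complex mat" where
    "J = mat ?N ?N (\<lambda>(s, u). if s div n = s mod n \<and> u div n = u mod n then 1 else 0)"
  have J: "J \<in> carrier_mat ?N ?N" by (simp add: J_def)
  have "psd_mat ?N J"
    unfolding psd_mat_iff_qform[OF J]
  proof
    fix y
    define e where "e s = (if s div n = s mod n then 1 else 0 :: complex)" for s
    have "qform ?N J y = (\<Sum>s<?N. \<Sum>u<?N. (y s * e s) * cnj (y u * e u))"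
      unfolding qform_def by (intro sum.cong refl) (auto simp: J_def e_def)
    also have "\<dots> = (\<Sum>s<?N. y s * e s) * cnj (\<Sum>s<?N. y s * e s)"
      by (simp only: sum_product cnj_sum)
    also have "\<dots> = complex_of_real ((cmod (\<Sum>s<?N. y s * e s))\<^sup>2)"
      by (rule complex_norm_square[symmetric])
    finally show "qform ?N J y \<in> \<real>\<^sub>\<ge>\<^sub>0" by (simp add: nonneg_Reals_iff del: of_real_power)
  qed
  then have psd: "psd_mat ?N (ampliation n n T J)"
    using cp n by (simp add: completely_positive_def)
  have blk: "mat_block n J p q = unit_mat n p q" if "p < n" "q < n" for p q
  proof (rule eq_matI)
    fix i j assume "i < dim_row (unit_mat n p q)" "j < dim_col (unit_mat n p q)"
    then have ij: "i < n" "j < n" by (simp_all add: unit_mat_def)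
    have "p * n + i < ?N" "q * n + j < ?N" using that ij by (simp_all add: block_index_less)
    then show "mat_block n J p q $$ (i, j) = unit_mat n p q $$ (i, j)"
      using ij by (auto simp: mat_block_def J_def unit_mat_def)
  qed (simp_all add: mat_block_def unit_mat_def)
  have "(\<Sum>s\<in>{..<?N}. \<Sum>u\<in>{..<?N}. y s * ampliation n n T J $$ (s, u) * cnj (y u)) \<in> \<real>\<^sub>\<ge>\<^sub>0" for y
    using psd unfolding psd_mat_iff_qform[OF ampliation_carrier] by (simp add: qform_def)
  from psd_form_factor[where G = "\<lambda>s u. ampliation n n T J $$ (s, u)", OF finite_lessThan this] obtain L where
    L: "\<And>s u. s < ?N \<Longrightarrow> u < ?N \<Longrightarrow> ampliation n n T J $$ (s, u) = (\<Sum>k<?N. L s k * cnj (L u k))" by auto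
  \<comment> \<open>The block index \<open>p\<close> becomes the column and the index
    \<open>i\<close> within the block becomes the row of the k-th operator.\<close>
  define H where "H k i p = L (p * n + i) k" for k i p
  have TE: "T (unit_mat n p q) $$ (i, j) = (\<Sum>k<?N. H k i p * cnj (H k j q))"
    if "p < n" "q < n" "i < n" "j < n" for p q i j
  proof -
    have b: "p * n + i < ?N" "q * n + j < ?N" using that by (simp_all add: block_index_less)
    show ?thesis using L[OF b] that by (simp add: ampliation_index[OF b] blk H_def)
  qed
  have "T Q $$ (i, j) = (\<Sum>k<?N. \<Sum>p<n. \<Sum>q<n. H k i p * Q $$ (p, q) * cnj (H k j q))"
    if Q: "Q \<in> carrier_mat n n" and ij: "i < n" "j < n" for Q i j
  proof -
    have "T Q $$ (i, j) = (\<Sum>p<n. \<Sum>q<n. \<Sum>k<?N. H k i p * Q $$ (p, q) * cnj (H k j q))"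
      unfolding linear_mat_map_index[OF T Q ij]
      by (intro sum.cong refl) (simp add: TE ij sum_distrib_left mult_ac)
    also have "\<dots> = (\<Sum>p<n. \<Sum>k<?N. \<Sum>q<n. H k i p * Q $$ (p, q) * cnj (H k j q))"
      by (intro sum.cong refl sum.swap)
    also have "\<dots> = (\<Sum>k<?N. \<Sum>p<n. \<Sum>q<n. H k i p * Q $$ (p, q) * cnj (H k j q))" by (rule sum.swap)
    finally show ?thesis .
  qed
  then show ?thesis by (rule that)
qed

lemma conj_mat_mat_sum:
  assumes A: "A \<in> carrier_mat n n" and F: "\<And>s. s \<in> S \<Longrightarrow> F s \<in> carrier_mat n n"
  shows "A * mat_sum n F S * mat_adjoint A = mat_sum n (\<lambda>s. A * F s * mat_adjoint A) S"
  using A F mat_adjoint_carrier[OF A]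
  by (simp add: mat_mult_mat_sum mat_sum_mult_mat mult_carrier_mat[of _ n n _ n])

text \<open>
  Substituting \<open>K(Q) = Q + \<Sum> K(Z\<^sub>t Q Z\<^sub>t\<^sup>*)\<close> eliminates the kernel from the Pick map.
\<close>

lemma pick_map_stein:
  assumes X: "X \<in> nc_ball_level d n" and W: "W \<in> carrier_mat n n" and Q: "Q \<in> carrier_mat n n"
    and ij: "i < n" "j < n"
    and T: "T = (\<lambda>P. szego_kernel d X X P - W * szego_kernel d X X P * mat_adjoint W)"
  shows "Q $$ (i, j) + (\<Sum>t<d. T (X ! t * Q * mat_adjoint (X ! t)) $$ (i, j))
    = (W * Q * mat_adjoint W) $$ (i, j) + T Q $$ (i, j)"
proof -
  let ?K = "szego_kernel d X X" and ?Q = "\<lambda>t. X ! t * Q * mat_adjoint (X ! t)"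
  have lev: "X \<in> nc_level d n" using X by (simp add: nc_ball_level_iff)
  have Qt: "?Q t \<in> carrier_mat n n" if "t < d" for t
    by (rule conj_mat_carrier[OF nc_level_nth[OF lev that] Q])
  have KQt: "?K (?Q t) \<in> carrier_mat n n" if "t < d" for t by (rule szego_kernel_carrier[OF X Qt[OF that]])
  have dimT: "T P $$ (i, j) = ?K P $$ (i, j) - (W * ?K P * mat_adjoint W) $$ (i, j)" if "P \<in> carrier_mat n n" for P
    using ij carrier_matD[OF conj_mat_carrier[OF W szego_kernel_carrier[OF X that]]]
    by (simp add: T del: index_mult_mat)
  have K: "?K Q = Q + mat_sum n (\<lambda>t. ?K (?Q t)) {..<d}" by (rule szego_kernel_right[OF X Q])
  have "W * ?K Q * mat_adjoint W = W * Q * mat_adjoint W + mat_sum n (\<lambda>t. W * ?K (?Q t) * mat_adjoint W) {..<d}"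
    by (subst K, subst conj_mat_add[OF W Q mat_sum_carrier], subst conj_mat_mat_sum[OF W]) (auto intro: KQt)
  then have "(W * ?K Q * mat_adjoint W) $$ (i, j)
      = (W * Q * mat_adjoint W) $$ (i, j) + (\<Sum>t<d. (W * ?K (?Q t) * mat_adjoint W) $$ (i, j))"
    using ij by (simp del: index_mult_mat)
  moreover have "?K Q $$ (i, j) = Q $$ (i, j) + (\<Sum>t<d. ?K (?Q t) $$ (i, j))"
    by (subst K) (use ij in simp)
  ultimately show ?thesis
    using dimT[OF Q] dimT[OF Qt] by (simp add: sum_subtractf del: index_mult_mat)
qed

text \<open>The lurking isometry argument: both sides of the Stein identity are Gram matrices of
  vectors indexed by matrix positions, and a contraction carrying one family to the other has as
  entries the required scalars.\<close>

lemma pick_colligation: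
  assumes X: "X \<in> nc_ball_level d n" and W: "W \<in> carrier_mat n n" and n: "n \<ge> 1"
    and cp: "completely_positive n (\<lambda>P. szego_kernel d X X P - W * szego_kernel d X X P * mat_adjoint W)"
  obtains m \<alpha> \<beta> \<gamma> \<delta> and H :: "nat \<Rightarrow> nat \<Rightarrow> nat \<Rightarrow> complex"
  where "\<And>i a. i < n \<Longrightarrow> a < n \<Longrightarrow> W $$ (i, a) = \<alpha> * (if i = a then 1 else 0)
      + (\<Sum>s\<in>{..<m} \<times> {..<d}. \<beta> s * row_act n (H (fst s) i) (X ! snd s) a)"
    and "\<And>l i a. l < m \<Longrightarrow> i < n \<Longrightarrow> a < n \<Longrightarrow> H l i a = \<gamma> l * (if i = a then 1 else 0)
      + (\<Sum>s\<in>{..<m} \<times> {..<d}. \<delta> l s * row_act n (H (fst s) i) (X ! snd s) a)"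
    and "\<And>x0 x. (cmod (\<alpha> * x0 + (\<Sum>s\<in>{..<m} \<times> {..<d}. \<beta> s * x s)))\<^sup>2
      + (\<Sum>l<m. (cmod (\<gamma> l * x0 + (\<Sum>s\<in>{..<m} \<times> {..<d}. \<delta> l s * x s)))\<^sup>2)
      \<le> (cmod x0)\<^sup>2 + (\<Sum>s\<in>{..<m} \<times> {..<d}. (cmod (x s))\<^sup>2)"
proof -
  define T where "T = (\<lambda>P. szego_kernel d X X P - W * szego_kernel d X X P * mat_adjoint W)"
  define m where "m = n * n"
  have lev: "X \<in> nc_level d n" using X by (simp add: nc_ball_level_iff)
  obtain H :: "nat \<Rightarrow> nat \<Rightarrow> nat \<Rightarrow> complex" where H: "\<And>Q i j. Q \<in> carrier_mat n n \<Longrightarrow> i < n \<Longrightarrow> j < n \<Longrightarrow>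
      T Q $$ (i, j) = (\<Sum>k<m. \<Sum>p<n. \<Sum>q<n. H k i p * Q $$ (p, q) * cnj (H k j q))"
    using kraus_decomposition[OF cp n] unfolding T_def m_def by blast
  let ?I = "{..<m} \<times> {..<d}"
  \<comment> \<open>The coordinate \<open>None\<close> carries the identity on the source side and W
    on the target side; the coordinates \<open>Some\<close> carry H_k X_t and H_k.\<close>
  define P where "P = insert None (Some ` ?I)"
  define R where "R = insert None (Some ` {..<m})"
  define v where "v z p = (case p of None \<Rightarrow> if fst z = snd z then 1 else 0
      | Some s \<Rightarrow> row_act n (H (fst s) (fst z)) (X ! snd s) (snd z))" for z :: "nat \<times> nat" and p
  define w where "w z r = (case r of None \<Rightarrow> W $$ z | Some k \<Rightarrow> H k (fst z) (snd z))" for z :: "nat \<times> nat" and r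
  have sumP: "sum f P = f None + (\<Sum>s\<in>?I. f (Some s))" for f :: "(nat \<times> nat) option \<Rightarrow> 'a::comm_monoid_add"
    unfolding P_def by (subst sum.insert) (auto simp: sum.reindex)
  have sumR: "sum f R = f None + (\<Sum>k<m. f (Some k))" for f :: "nat option \<Rightarrow> 'a::comm_monoid_add"
    unfolding R_def by (subst sum.insert) (auto simp: sum.reindex)
  have gram: "(\<Sum>p\<in>P. v y p * cnj (v z p)) = (\<Sum>r\<in>R. w y r * cnj (w z r))"
    if yz: "y \<in> {..<n} \<times> {..<n}" "z \<in> {..<n} \<times> {..<n}" for y z
  proof -
    obtain i a j b where y: "y = (i, a)" and z: "z = (j, b)" by (metis surj_pair)
    have b: "i < n" "a < n" "j < n" "b < n" using yz by (auto simp: y z)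
    \<comment> \<open>Taking the matrix unit at (a, b) and reading the entry (i, j) polarises the
      identity into inner products of the vectors at (i, a) and (j, b).\<close>
    let ?Q = "unit_mat n a b"
    have t1: "T (X ! t * ?Q * mat_adjoint (X ! t)) $$ (i, j)
        = (\<Sum>k<m. row_act n (H k i) (X ! t) a * cnj (row_act n (H k j) (X ! t) b))" if "t < d" for t
    proof -
      have Xt: "X ! t \<in> carrier_mat n n" by (rule nc_level_nth[OF lev that])
      show ?thesis
        unfolding H[OF conj_mat_carrier[OF Xt unit_mat_carrier] b(1,3)]
        by (simp only: sesquilinear_conj[OF Xt unit_mat_carrier] sum_unit_mat[OF b(2,4)])
    qed
    have t2: "T ?Q $$ (i, j) = (\<Sum>k<m. H k i a * cnj (H k j b))"
      unfolding H[OF unit_mat_carrier b(1,3)] by (simp only: sum_unit_mat[OF b(2,4)])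
    have t3: "(W * ?Q * mat_adjoint W) $$ (i, j) = W $$ (i, a) * cnj (W $$ (j, b))"
      unfolding conj_mat_index[OF W unit_mat_carrier W b(1,3)] by (rule sum_unit_mat[OF b(2,4)])
    have t4: "?Q $$ (i, j) = (if i = a then 1 else 0) * cnj (if j = b then 1 else 0)"
      using b by (simp add: unit_mat_def)
    have "(if i = a then 1 else 0) * cnj (if j = b then 1 else 0)
        + (\<Sum>t<d. \<Sum>k<m. row_act n (H k i) (X ! t) a * cnj (row_act n (H k j) (X ! t) b))
        = W $$ (i, a) * cnj (W $$ (j, b)) + (\<Sum>k<m. H k i a * cnj (H k j b))"
      using pick_map_stein[OF X W unit_mat_carrier b(1,3) T_def, of a b] unfolding t2 t3 t4
      by (simp add: t1 del: index_mult_mat)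
    moreover have "(\<Sum>t<d. \<Sum>k<m. row_act n (H k i) (X ! t) a * cnj (row_act n (H k j) (X ! t) b))
        = (\<Sum>s\<in>?I. row_act n (H (fst s) i) (X ! snd s) a * cnj (row_act n (H (fst s) j) (X ! snd s) b))"
      by (subst sum.swap) (simp add: sum.cartesian_product case_prod_unfold)
    ultimately show ?thesis
      unfolding sumP sumR by (simp add: v_def w_def y z)
  qed
  obtain U where U: "\<And>z r. z \<in> {..<n} \<times> {..<n} \<Longrightarrow> r \<in> R \<Longrightarrow> (\<Sum>p\<in>P. U r p * v z p) = w z r"
    and contr: "\<And>x. (\<Sum>r\<in>R. (cmod (\<Sum>p\<in>P. U r p * x p))\<^sup>2) \<le> (\<Sum>p\<in>P. (cmod (x p))\<^sup>2)"
    by (rule contraction_of_equal_gram[of "{..<n} \<times> {..<n}" P R v w])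
      (auto simp: gram P_def[THEN arg_cong[where f = finite]] R_def[THEN arg_cong[where f = finite]])
  show ?thesis
  proof (rule that)
    fix i a assume ia: "i < n" "a < n"
    show "W $$ (i, a) = U None None * (if i = a then 1 else 0)
      + (\<Sum>s\<in>?I. U None (Some s) * row_act n (H (fst s) i) (X ! snd s) a)"
      using U[of "(i, a)" None] ia unfolding sumP by (simp add: v_def w_def R_def)
  next
    fix l i a assume ia: "l < m" "i < n" "a < n"
    show "H l i a = U (Some l) None * (if i = a then 1 else 0)
      + (\<Sum>s\<in>?I. U (Some l) (Some s) * row_act n (H (fst s) i) (X ! snd s) a)"
      using U[of "(i, a)" "Some l"] ia unfolding sumP by (simp add: v_def w_def R_def)
  next
    fix x0 x
    show "(cmod (U None None * x0 + (\<Sum>s\<in>?I. U None (Some s) * x s)))\<^sup>2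
      + (\<Sum>l<m. (cmod (U (Some l) None * x0 + (\<Sum>s\<in>?I. U (Some l) (Some s) * x s)))\<^sup>2)
      \<le> (cmod x0)\<^sup>2 + (\<Sum>s\<in>?I. (cmod (x s))\<^sup>2)"
      using contr[of "\<lambda>p. case p of None \<Rightarrow> x0 | Some s \<Rightarrow> x s"] unfolding sumP sumR by simp
  qed
qed

section \<open>The transfer function\<close>

lemma poly_mat_eval_zero: "poly_mat_eval n (0\<^sub>m 1 1) X = 0\<^sub>m n n"
  by (intro eq_matI) (auto simp: poly_mat_eval_def poly_eval_def less_mult_imp_div_less)

text \<open>The zero polynomial defines a polyhedron containing every tuple, which makes the whole
  space available as a neighbourhood.\<close>

lemma free_topology_topspace:
  assumes "X \<in> nc_universe d"
  shows "X \<in> topspace (free_topology d)"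
proof -
  let ?\<delta> = "0\<^sub>m 1 1 :: free_poly mat"
  have "op_norm (0\<^sub>m k k) \<le> 0" for k
    by (rule op_norm_leI[of _ k]) (auto simp: sqnorm_def)
  then have "op_norm (poly_mat_eval (tuple_size X) ?\<delta> X) < 1"
    unfolding poly_mat_eval_zero by (rule le_less_trans) simp
  then have "X \<in> poly_polyhedron d ?\<delta>" using assms by (simp add: poly_polyhedron_def)
  moreover have "elements_mat ?\<delta> \<subseteq> free_polys d" by (auto simp: elements_mat_def free_polys_def)
  ultimately show ?thesis
    unfolding free_topology_def topology_generated_by_topspace by blast
qed

lemma nc_ball_subset_nc_universe: "nc_ball d \<subseteq> nc_universe d"
  by (auto simp: nc_ball_def nc_universe_def nc_ball_level_iff)

text \<open>A global bound is a local bound on the whole space. Nonemptiness of the ball lets the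
  bound pass to the supremum.\<close>

lemma contractive_nc_function_in_H_infty_1:
  assumes f: "nc_function d f" and bd: "\<And>X. X \<in> nc_ball d \<Longrightarrow> op_norm (f X) \<le> 1"
    and ne: "nc_ball d \<noteq> {}"
  shows "f \<in> H_infty_1 d"
proof -
  have bdd: "bdd_above ((\<lambda>Y. op_norm (f Y)) ` (U \<inter> nc_ball d))" for U
    by (rule bdd_aboveI2[of _ _ 1]) (use bd in auto)
  have "free_holomorphic d f"
    unfolding free_holomorphic_def
  proof (intro conjI ballI f exI)
    fix X assume "X \<in> nc_ball d"
    then show "X \<in> topspace (free_topology d)"
      using free_topology_topspace nc_ball_subset_nc_universe by blast
  qed (use bdd in auto)
  moreover have "(SUP Z\<in>nc_ball d. op_norm (f Z)) \<le> 1"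
    by (rule cSUP_least[OF ne bd])
  ultimately show ?thesis using bdd[of UNIV] by (simp add: H_infty_1_def H_infty_def)
qed

lemma mat_dsum_eqI:
  assumes A: "A \<in> carrier_mat a a" and B: "B \<in> carrier_mat b b" and M: "M \<in> carrier_mat (a + b) (a + b)"
    and eq: "\<And>i j. i < a + b \<Longrightarrow> j < a + b \<Longrightarrow> M $$ (i, j) = (if i < a then if j < a then A $$ (i, j) else 0
    else if j < a then 0 else B $$ (i - a, j - a))"
  shows "M = mat_dsum A B"
proof (rule eq_matI)
  note c = carrier_matD[OF mat_dsum_carrier[OF A B]]
  fix i j assume "i < dim_row (mat_dsum A B)" "j < dim_col (mat_dsum A B)"
  then have ij: "i < a + b" "j < a + b" using c by simp_all
  show "M $$ (i, j) = mat_dsum A B $$ (i, j)" unfolding mat_dsum_index[OF A B ij] by (rule eq[OF ij])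
qed (use carrier_matD[OF mat_dsum_carrier[OF A B]] M in auto)

text \<open>The scalars are the blocks of a contractive system matrix with rows (\<alpha>, \<beta>)
  and (\<gamma>, \<delta>), mapping one input and m d shifted states to one output and m
  states.\<close>

locale contractive_colligation =
  fixes d m :: nat and \<alpha> :: complex and \<beta> :: "nat \<times> nat \<Rightarrow> complex"
    and \<gamma> :: "nat \<Rightarrow> complex" and \<delta> :: "nat \<Rightarrow> nat \<times> nat \<Rightarrow> complex"
  assumes d: "d \<ge> 1"
    and contractive: "\<And>x0 x. (cmod (\<alpha> * x0 + (\<Sum>s\<in>{..<m} \<times> {..<d}. \<beta> s * x s)))\<^sup>2
      + (\<Sum>l<m. (cmod (\<gamma> l * x0 + (\<Sum>s\<in>{..<m} \<times> {..<d}. \<delta> l s * x s)))\<^sup>2)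
      \<le> (cmod x0)\<^sup>2 + (\<Sum>s\<in>{..<m} \<times> {..<d}. (cmod (x s))\<^sup>2)"
begin

text \<open>Output and state equations have this common shape, so compatibility with direct sums and
  similarities need be shown only once.\<close>

definition node :: "nat \<Rightarrow> complex mat list \<Rightarrow> (nat \<Rightarrow> complex mat) \<Rightarrow> complex \<Rightarrow> (nat \<times> nat \<Rightarrow> complex) \<Rightarrow> complex mat"
  where "node N X H a b = mat N N (\<lambda>(i, j). a * (if i = j then 1 else 0)
    + (\<Sum>s\<in>{..<m} \<times> {..<d}. b s * (H (fst s) * X ! snd s) $$ (i, j)))"

definition is_state :: "nat \<Rightarrow> complex mat list \<Rightarrow> (nat \<Rightarrow> complex mat) \<Rightarrow> bool" where
  "is_state N X H \<longleftrightarrow> (\<forall>l<m. H l \<in> carrier_mat N N \<and> H l = node N X H (\<gamma> l) (\<delta> l))"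

text \<open>Solving the state equation takes the place of the inverse in the usual transfer function
  formula. By \<open>is_state_unique\<close> the value on the ball does not depend on the
  choice.\<close>

definition transfer :: "complex mat list \<Rightarrow> complex mat" where
  "transfer X = node (tuple_size X) X (SOME H. is_state (tuple_size X) X H) \<alpha> \<beta>"

lemma node_carrier [simp]: "node N X H a b \<in> carrier_mat N N"
  by (simp add: node_def)

lemma node_index:
  "i < N \<Longrightarrow> j < N \<Longrightarrow> node N X H a b $$ (i, j) = a * (if i = j then 1 else 0)
    + (\<Sum>s\<in>{..<m} \<times> {..<d}. b s * (H (fst s) * X ! snd s) $$ (i, j))"
  by (simp add: node_def)

lemma row_mult_index:
  assumes "A \<in> carrier_mat N N" "B \<in> carrier_mat N N" "i < N" "q < N"
  shows "(A * B) $$ (i, q) = row_act N (\<lambda>p. A $$ (i, p)) B q"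
  unfolding row_act_def by (rule mult_mat_index[OF assms])

text \<open>The scalar contraction is applied in each column q, to the input y(q) and the entries of
  f_k X_t. Summing over q and using the row bound of \<open>X\<close> produces the factor
  \<open>c\<close> on the state energy.\<close>

lemma energy:
  assumes X: "X \<in> nc_level d N" "row_bound N c X"
  shows "(\<Sum>q<N. (cmod (\<alpha> * y q + (\<Sum>s\<in>{..<m} \<times> {..<d}. \<beta> s * row_act N (f (fst s)) (X ! snd s) q)))\<^sup>2)
    + (\<Sum>l<m. \<Sum>q<N. (cmod (\<gamma> l * y q + (\<Sum>s\<in>{..<m} \<times> {..<d}. \<delta> l s * row_act N (f (fst s)) (X ! snd s) q)))\<^sup>2)
    \<le> sqnorm N y + c * (\<Sum>k<m. sqnorm N (f k))"
proof -
  let ?I = "{..<m} \<times> {..<d}" and ?x = "\<lambda>q s. row_act N (f (fst s)) (X ! snd s) q"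
  have len: "length X = d" using X by (simp add: nc_level_def)
  have "(\<Sum>q<N. (cmod (\<alpha> * y q + (\<Sum>s\<in>?I. \<beta> s * ?x q s)))\<^sup>2)
    + (\<Sum>l<m. \<Sum>q<N. (cmod (\<gamma> l * y q + (\<Sum>s\<in>?I. \<delta> l s * ?x q s)))\<^sup>2)
    = (\<Sum>q<N. (cmod (\<alpha> * y q + (\<Sum>s\<in>?I. \<beta> s * ?x q s)))\<^sup>2
      + (\<Sum>l<m. (cmod (\<gamma> l * y q + (\<Sum>s\<in>?I. \<delta> l s * ?x q s)))\<^sup>2))"
    unfolding sum.distrib by (intro arg_cong2[of _ _ _ _ "(+)"] refl sum.swap)
  also have "\<dots> \<le> (\<Sum>q<N. (cmod (y q))\<^sup>2 + (\<Sum>s\<in>?I. (cmod (?x q s))\<^sup>2))"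
    by (intro sum_mono contractive)
  also have "\<dots> = sqnorm N y + (\<Sum>s\<in>?I. sqnorm N (row_act N (f (fst s)) (X ! snd s)))"
    unfolding sum.distrib sqnorm_def by (intro arg_cong2[of _ _ _ _ "(+)"] refl sum.swap)
  also have "(\<Sum>s\<in>?I. sqnorm N (row_act N (f (fst s)) (X ! snd s)))
      = (\<Sum>k<m. \<Sum>t<d. sqnorm N (row_act N (f k) (X ! t)))"
    by (simp add: sum.cartesian_product case_prod_unfold)
  also have "sqnorm N y + \<dots> \<le> sqnorm N y + (\<Sum>k<m. c * sqnorm N (f k))"
    using X(2) len unfolding row_bound_def by (intro add_left_mono sum_mono) auto
  finally show ?thesis by (simp add: sum_distrib_left)
qed

text \<open>At zero input the energy inequality reads E <= c E with c < 1, which forces the state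
  energy E to vanish.\<close>

lemma homogeneous_state_zero:
  assumes X: "X \<in> nc_ball_level d N"
    and eq: "\<And>l q. l < m \<Longrightarrow> q < N \<Longrightarrow> f l q = (\<Sum>s\<in>{..<m} \<times> {..<d}. \<delta> l s * row_act N (f (fst s)) (X ! snd s) q)"
    and l: "l < m" "q < N"
  shows "f l q = 0"
proof -
  obtain c where c: "0 \<le> c" "c < 1" "row_bound N c X" using X by (auto simp: nc_ball_level_iff)
  have lev: "X \<in> nc_level d N" using X by (simp add: nc_ball_level_iff)
  define E where "E = (\<Sum>k<m. sqnorm N (f k))"
  have "E = (\<Sum>l<m. \<Sum>q<N. (cmod (\<Sum>s\<in>{..<m} \<times> {..<d}. \<delta> l s * row_act N (f (fst s)) (X ! snd s) q))\<^sup>2)"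
    unfolding E_def sqnorm_def using eq by (intro sum.cong refl) auto
  also have "\<dots> \<le> c * E"
  proof -
    have "0 \<le> (\<Sum>q<N. (cmod (\<Sum>s\<in>{..<m} \<times> {..<d}. \<beta> s * row_act N (f (fst s)) (X ! snd s) q))\<^sup>2)"
      by (intro sum_nonneg) auto
    then show ?thesis
      using energy[OF lev c(3), of "\<lambda>_. 0" f] by (simp add: E_def sqnorm_def)
  qed
  finally have "(1 - c) * E \<le> 0" by (simp add: algebra_simps)
  then have "E \<le> 0" using c by (simp add: mult_le_0_iff)
  moreover have "(cmod (f l q))\<^sup>2 \<le> sqnorm N (f l)"
    unfolding sqnorm_def using l by (intro member_le_sum) auto
  moreover have "sqnorm N (f l) \<le> E"
    unfolding E_def using l by (intro member_le_sum) auto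
  ultimately have "(cmod (f l q))\<^sup>2 \<le> 0" by linarith
  then show ?thesis by simp
qed

text \<open>Right multiplication by X_t keeps rows apart, so each row of the difference of two
  solutions solves the homogeneous system.\<close>

lemma is_state_unique:
  assumes X: "X \<in> nc_ball_level d N" and H: "is_state N X H" "is_state N X H'" and l: "l < m"
  shows "H l = H' l"
proof (rule eq_matI)
  have lev: "X \<in> nc_level d N" using X by (simp add: nc_ball_level_iff)
  have c: "H k \<in> carrier_mat N N" "H' k \<in> carrier_mat N N" if "k < m" for k
    using H that by (auto simp: is_state_def)
  show "dim_row (H l) = dim_row (H' l)" "dim_col (H l) = dim_col (H' l)" using c[OF l] by auto
  fix i j assume "i < dim_row (H' l)" "j < dim_col (H' l)"
  then have ij: "i < N" "j < N" using c[OF l] by auto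
  define f where "f k q = H k $$ (i, q) - H' k $$ (i, q)" for k q
  have ent: "G l $$ (i, q) = \<gamma> l * (if i = q then 1 else 0)
      + (\<Sum>s\<in>{..<m} \<times> {..<d}. \<delta> l s * row_act N (\<lambda>p. G (fst s) $$ (i, p)) (X ! snd s) q)"
    if G: "is_state N X G" and lq: "l < m" "q < N" for G l q
  proof -
    have "G l $$ (i, q) = node N X G (\<gamma> l) (\<delta> l) $$ (i, q)" using G lq by (simp add: is_state_def)
    also have "\<dots> = \<gamma> l * (if i = q then 1 else 0)
      + (\<Sum>s\<in>{..<m} \<times> {..<d}. \<delta> l s * row_act N (\<lambda>p. G (fst s) $$ (i, p)) (X ! snd s) q)"
      unfolding node_index[OF ij(1) lq(2)]
      using G by (intro arg_cong2[of _ _ _ _ "(+)"] sum.cong refl)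
        (auto simp: is_state_def intro!: row_mult_index nc_level_nth[OF lev] ij lq)
    finally show ?thesis .
  qed
  have "f l j = 0"
  proof (rule homogeneous_state_zero[OF X _ l ij(2)])
    fix l q assume lq: "l < m" "q < N"
    have sub: "row_act N (f k) A q = row_act N (\<lambda>p. H k $$ (i, p)) A q - row_act N (\<lambda>p. H' k $$ (i, p)) A q" for k A
      by (simp add: row_act_def f_def algebra_simps sum_subtractf)
    show "f l q = (\<Sum>s\<in>{..<m} \<times> {..<d}. \<delta> l s * row_act N (f (fst s)) (X ! snd s) q)"
      unfolding f_def[of l q] ent[OF H(1) lq] ent[OF H(2) lq]
      by (simp add: sub right_diff_distrib sum_subtractf)
  qed
  then show "H l $$ (i, j) = H' l $$ (i, j)" by (simp add: f_def)
qed

text \<open>For each row the state equation is a square system in m N unknowns, and triviality of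
  its kernel gives solvability.\<close>

lemma is_state_exists:
  assumes X: "X \<in> nc_ball_level d N"
  shows "\<exists>H. is_state N X H"
proof -
  have lev: "X \<in> nc_level d N" using X by (simp add: nc_ball_level_iff)
  let ?S = "{..<m} \<times> {..<N}" and ?I = "{..<m} \<times> {..<d}"
  \<comment> \<open>\<open>M u s\<close> is the coefficient with which the entry at u = (k, p) of a
    row enters the equation for the entry at s = (l, q).\<close>
  define M where "M u s = (\<Sum>t<d. \<delta> (fst s) (fst u, t) * X ! t $$ (snd u, snd s))" for u s :: "nat \<times> nat"
  have sumM: "(\<Sum>u\<in>?S. h u * M u (l, q)) = (\<Sum>s\<in>?I. \<delta> l s * row_act N (\<lambda>p. h (fst s, p)) (X ! snd s) q)"
    for h l q
  proof -
    have "(\<Sum>u\<in>?S. h u * M u (l, q)) = (\<Sum>(k, p)\<in>?S. \<Sum>t<d. \<delta> l (k, t) * (h (k, p) * X ! t $$ (p, q)))"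
      by (intro sum.cong refl) (auto simp: M_def sum_distrib_left mult_ac)
    also have "\<dots> = (\<Sum>k<m. \<Sum>p<N. \<Sum>t<d. \<delta> l (k, t) * (h (k, p) * X ! t $$ (p, q)))"
      by (rule sum.cartesian_product[symmetric])
    also have "\<dots> = (\<Sum>k<m. \<Sum>t<d. \<Sum>p<N. \<delta> l (k, t) * (h (k, p) * X ! t $$ (p, q)))"
      by (intro sum.cong refl sum.swap)
    also have "\<dots> = (\<Sum>(k, t)\<in>?I. \<Sum>p<N. \<delta> l (k, t) * (h (k, p) * X ! t $$ (p, q)))"
      by (rule sum.cartesian_product)
    finally show ?thesis
      by (simp add: row_act_def case_prod_unfold sum_distrib_left)
  qed
  have "\<exists>h. \<forall>s\<in>?S. h s = \<gamma> (fst s) * (if i = snd s then 1 else 0) + (\<Sum>u\<in>?S. h u * M u s)" for i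
  proof -
    have inj: "h s = 0" if h: "\<And>s. s \<in> ?S \<Longrightarrow> h s = (\<Sum>u\<in>?S. h u * M u s)" and s: "s \<in> ?S" for h s
    proof -
      obtain l q where lq: "s = (l, q)" "l < m" "q < N" using s by auto
      have "h (l, q) = 0"
      proof (rule homogeneous_state_zero[OF X _ lq(2,3), where f = "\<lambda>k p. h (k, p)"])
        fix l q assume "l < m" "q < N"
        then have "(l, q) \<in> ?S" by simp
        then show "h (l, q) = (\<Sum>s\<in>?I. \<delta> l s * row_act N (\<lambda>p. h (fst s, p)) (X ! snd s) q)"
          unfolding sumM[symmetric] by (rule h)
      qed
      then show ?thesis using lq by simp
    qed
    show ?thesis
    proof (rule fixpoint_equation_solvable[where S = ?S and M = M
          and c = "\<lambda>s. \<gamma> (fst s) * (if i = snd s then 1 else 0)"])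
      show "finite ?S" by simp
    qed (use inj in blast)+
  qed
  then have "\<exists>h. \<forall>i. \<forall>s\<in>?S. h i s = \<gamma> (fst s) * (if i = snd s then 1 else 0) + (\<Sum>u\<in>?S. h i u * M u s)"
    by (intro choice allI)
  then obtain h where
    h: "\<forall>i. \<forall>s\<in>?S. h i s = \<gamma> (fst s) * (if i = snd s then 1 else 0) + (\<Sum>u\<in>?S. h i u * M u s)" ..
  define H where "H l = mat N N (\<lambda>(i, q). h i (l, q))" for l
  have Hc: "H l \<in> carrier_mat N N" for l by (simp add: H_def)
  have "H l = node N X H (\<gamma> l) (\<delta> l)" if l: "l < m" for l
  proof (rule eq_matI)
    fix i q assume "i < dim_row (node N X H (\<gamma> l) (\<delta> l))" "q < dim_col (node N X H (\<gamma> l) (\<delta> l))"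
    then have iq: "i < N" "q < N" by (simp_all add: node_def)
    have "H l $$ (i, q) = \<gamma> l * (if i = q then 1 else 0)
        + (\<Sum>s\<in>?I. \<delta> l s * row_act N (\<lambda>p. h i (fst s, p)) (X ! snd s) q)"
      using h[rule_format, of "(l, q)" i] l iq unfolding sumM by (simp add: H_def)
    also have "(\<Sum>s\<in>?I. \<delta> l s * row_act N (\<lambda>p. h i (fst s, p)) (X ! snd s) q)
        = (\<Sum>s\<in>?I. \<delta> l s * (H (fst s) * X ! snd s) $$ (i, q))"
    proof (rule sum.cong[OF refl])
      fix s assume "s \<in> ?I"
      then have Xs: "X ! snd s \<in> carrier_mat N N" using nc_level_nth[OF lev] by auto
      have "row_act N (\<lambda>p. h i (fst s, p)) (X ! snd s) = row_act N (\<lambda>p. H (fst s) $$ (i, p)) (X ! snd s)"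
        using iq by (intro row_act_cong) (simp add: H_def)
      then show "\<delta> l s * row_act N (\<lambda>p. h i (fst s, p)) (X ! snd s) q = \<delta> l s * (H (fst s) * X ! snd s) $$ (i, q)"
        by (simp only: row_mult_index[OF Hc Xs iq])
    qed
    finally show "H l $$ (i, q) = node N X H (\<gamma> l) (\<delta> l) $$ (i, q)" by (simp only: node_index[OF iq])
  qed (simp_all add: node_def H_def)
  then show ?thesis using Hc unfolding is_state_def by blast
qed

lemma tuple_size_eq: "X \<in> nc_level d N \<Longrightarrow> tuple_size X = N"
  using d by (cases X) (auto simp: nc_level_def tuple_size_def)

lemma node_cong: "(\<And>k. k < m \<Longrightarrow> H k = H' k) \<Longrightarrow> node N X H a b = node N X H' a b"
  unfolding node_def by (intro arg_cong[of _ _ "mat N N"] ext) (auto intro!: sum.cong)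

lemma transfer_eq:
  assumes X: "X \<in> nc_ball_level d N" and H: "is_state N X H"
  shows "transfer X = node N X H \<alpha> \<beta>"
proof -
  have sz: "tuple_size X = N" using X by (intro tuple_size_eq) (simp add: nc_ball_level_iff)
  have "is_state N X (SOME H. is_state N X H)" by (rule someI[of _ H]) (rule H)
  then show ?thesis
    unfolding transfer_def sz by (intro node_cong is_state_unique[OF X _ H])
qed

text \<open>Applying the row vector \<open>y\<close> to the state and output equations gives a
  system with input \<open>y\<close> and states y H_k, to which the energy inequality
  applies.\<close>

lemma transfer_contractive:
  assumes X: "X \<in> nc_ball_level d N"
  shows "op_norm (transfer X) \<le> 1"
proof -
  obtain c where c: "0 \<le> c" "c < 1" "row_bound N c X" using X by (auto simp: nc_ball_level_iff)
  have lev: "X \<in> nc_level d N" using X by (simp add: nc_ball_level_iff)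
  obtain H where H: "is_state N X H" using is_state_exists[OF X] by blast
  have Hc: "H k \<in> carrier_mat N N" if "k < m" for k using H that by (auto simp: is_state_def)
  have "sqnorm N (row_act N y (transfer X)) \<le> 1\<^sup>2 * sqnorm N y" for y
  proof -
    let ?I = "{..<m} \<times> {..<d}" and ?f = "\<lambda>k. row_act N y (H k)"
    have act: "row_act N y (node N X H a b) q = a * y q + (\<Sum>s\<in>?I. b s * row_act N (?f (fst s)) (X ! snd s) q)"
      if q: "q < N" for a b q
    proof -
      have "row_act N y (node N X H a b) q
          = (\<Sum>p<N. (if p = q then a * y q else 0) + (\<Sum>s\<in>?I. y p * (b s * (H (fst s) * X ! snd s) $$ (p, q))))"
        unfolding row_act_def using q
        by (intro sum.cong refl) (auto simp: node_index distrib_left sum_distrib_left simp del: index_mult_mat)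
      also have "\<dots> = a * y q + (\<Sum>p<N. \<Sum>s\<in>?I. y p * (b s * (H (fst s) * X ! snd s) $$ (p, q)))"
        using q by (simp add: sum.distrib)
      also have "(\<Sum>p<N. \<Sum>s\<in>?I. y p * (b s * (H (fst s) * X ! snd s) $$ (p, q)))
          = (\<Sum>s\<in>?I. \<Sum>p<N. y p * (b s * (H (fst s) * X ! snd s) $$ (p, q)))" by (rule sum.swap)
      also have "\<dots> = (\<Sum>s\<in>?I. b s * row_act N y (H (fst s) * X ! snd s) q)"
        by (simp only: row_act_def sum_distrib_left mult.left_commute)
      also have "\<dots> = (\<Sum>s\<in>?I. b s * row_act N (?f (fst s)) (X ! snd s) q)"
        by (intro sum.cong refl arg_cong2[of _ _ _ _ "(*)"] row_act_mult[OF _ _ q])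
          (auto intro: Hc nc_level_nth[OF lev])
      finally show ?thesis .
    qed
    have "(\<Sum>q<N. (cmod (\<alpha> * y q + (\<Sum>s\<in>?I. \<beta> s * row_act N (?f (fst s)) (X ! snd s) q)))\<^sup>2)
        = sqnorm N (row_act N y (transfer X))"
      unfolding transfer_eq[OF X H] sqnorm_def by (intro sum.cong refl) (simp add: act)
    moreover have "(\<Sum>q<N. (cmod (\<gamma> l * y q + (\<Sum>s\<in>?I. \<delta> l s * row_act N (?f (fst s)) (X ! snd s) q)))\<^sup>2)
        = sqnorm N (?f l)" if "l < m" for l
    proof -
      have "H l = node N X H (\<gamma> l) (\<delta> l)" using H that by (simp add: is_state_def)
      then have "sqnorm N (?f l) = sqnorm N (row_act N y (node N X H (\<gamma> l) (\<delta> l)))" by simp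
      then show ?thesis by (simp add: sqnorm_def act)
    qed
    ultimately have "sqnorm N (row_act N y (transfer X)) + (\<Sum>l<m. sqnorm N (?f l))
        \<le> sqnorm N y + c * (\<Sum>k<m. sqnorm N (?f k))"
      using energy[OF lev c(3), of y ?f] by simp
    \<comment> \<open>Since c < 1, the state energies on the right are at most those on the left and
      can be cancelled.\<close>
    moreover have "c * (\<Sum>k<m. sqnorm N (?f k)) \<le> 1 * (\<Sum>k<m. sqnorm N (?f k))"
      using c by (intro mult_right_mono) (auto intro: sum_nonneg)
    ultimately show ?thesis by simp
  qed
  then show ?thesis
    by (intro op_norm_leI_row[of _ N]) (simp_all add: transfer_eq[OF X H])
qed

section \<open>Compatibility with direct sums and similarities\<close>

text \<open>The coefficients are scalars, and both the identity and the products H_k X_t decompose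
  along the blocks.\<close>

lemma node_dsum:
  assumes X: "X \<in> nc_level d a" and Y: "Y \<in> nc_level d b"
    and H: "\<And>k. k < m \<Longrightarrow> H k \<in> carrier_mat a a" and H': "\<And>k. k < m \<Longrightarrow> H' k \<in> carrier_mat b b"
  shows "node (a + b) (map2 mat_dsum X Y) (\<lambda>k. mat_dsum (H k) (H' k)) u v
    = mat_dsum (node a X H u v) (node b Y H' u v)"
proof (rule mat_dsum_eqI[OF node_carrier node_carrier node_carrier])
  fix i j assume ij: "i < a + b" "j < a + b"
  have "(mat_dsum (H (fst s)) (H' (fst s)) * map2 mat_dsum X Y ! snd s) $$ (i, j)
      = (if i < a then if j < a then (H (fst s) * X ! snd s) $$ (i, j) else 0
        else if j < a then 0 else (H' (fst s) * Y ! snd s) $$ (i - a, j - a))"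
    if s: "s \<in> {..<m} \<times> {..<d}" for s
  proof -
    have kt: "fst s < m" "snd s < d" using s by auto
    note c = H[OF kt(1)] nc_level_nth[OF X kt(2)] H'[OF kt(1)] nc_level_nth[OF Y kt(2)]
    show ?thesis
      unfolding map2_dsum_level(2)[OF X Y kt(2)] mat_dsum_mult[OF c]
      by (rule mat_dsum_index[OF mult_carrier_mat[OF c(1,2)] mult_carrier_mat[OF c(3,4)] ij])
  qed
  then have "node (a + b) (map2 mat_dsum X Y) (\<lambda>k. mat_dsum (H k) (H' k)) u v $$ (i, j)
      = u * (if i = j then 1 else 0) + (\<Sum>s\<in>{..<m} \<times> {..<d}. v s *
        (if i < a then if j < a then (H (fst s) * X ! snd s) $$ (i, j) else 0
        else if j < a then 0 else (H' (fst s) * Y ! snd s) $$ (i - a, j - a)))"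
    unfolding node_index[OF ij] by (intro arg_cong2[of _ _ _ _ "(+)"] sum.cong refl) simp
  also have "\<dots> = (if i < a then if j < a then node a X H u v $$ (i, j) else 0
      else if j < a then 0 else node b Y H' u v $$ (i - a, j - a))"
  proof -
    have "i - a < b" "j - a < b" if "\<not> i < a" "\<not> j < a" using ij that by auto
    moreover have "i - a = j - a \<longleftrightarrow> i = j" if "\<not> i < a" "\<not> j < a" using that by auto
    ultimately show ?thesis by (auto simp: node_index simp del: index_mult_mat)
  qed
  finally show "node (a + b) (map2 mat_dsum X Y) (\<lambda>k. mat_dsum (H k) (H' k)) u v $$ (i, j)
    = (if i < a then if j < a then node a X H u v $$ (i, j) else 0
      else if j < a then 0 else node b Y H' u v $$ (i - a, j - a))" .
qed

text \<open>The direct sum of two states is a state for the direct sum of the tuples, hence the one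
  that determines the transfer function there.\<close>

lemma transfer_dsum:
  assumes X: "X \<in> nc_ball_level d a" and Y: "Y \<in> nc_ball_level d b"
  shows "transfer (map2 mat_dsum X Y) = mat_dsum (transfer X) (transfer Y)"
proof -
  have lev: "X \<in> nc_level d a" "Y \<in> nc_level d b" using X Y by (simp_all add: nc_ball_level_iff)
  obtain H H' where H: "is_state a X H" and H': "is_state b Y H'"
    using is_state_exists X Y by blast
  have c: "H k \<in> carrier_mat a a" "H' k \<in> carrier_mat b b" if "k < m" for k
    using H H' that by (auto simp: is_state_def)
  have nd: "node (a + b) (map2 mat_dsum X Y) (\<lambda>k. mat_dsum (H k) (H' k)) u v
      = mat_dsum (node a X H u v) (node b Y H' u v)" for u v
    by (rule node_dsum[OF lev c])
  have "is_state (a + b) (map2 mat_dsum X Y) (\<lambda>k. mat_dsum (H k) (H' k))"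
    unfolding is_state_def nd
    using H H' c by (auto simp: is_state_def)
  from transfer_eq[OF nc_ball_level_dsum[OF X Y] this] show ?thesis
    unfolding nd transfer_eq[OF X H] transfer_eq[OF Y H'] .
qed

lemma node_similarity:
  assumes X: "X \<in> nc_level d N" and H: "\<And>k. k < m \<Longrightarrow> H k \<in> carrier_mat N N"
    and S: "S \<in> carrier_mat N N" and T: "T \<in> carrier_mat N N" and TS: "S * T = 1\<^sub>m N" "T * S = 1\<^sub>m N"
  shows "node N (map (\<lambda>A. T * A * S) X) (\<lambda>k. T * H k * S) u v = T * node N X H u v * S"
proof -
  let ?I = "{..<m} \<times> {..<d}" and ?F = "\<lambda>s. H (fst s) * X ! snd s"
  have node_alt: "node N X' H'' u v = u \<cdot>\<^sub>m 1\<^sub>m N + mat_sum N (\<lambda>s. v s \<cdot>\<^sub>m (H'' (fst s) * X' ! snd s)) ?I"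
    if X': "X' \<in> nc_level d N" and H'': "\<And>k. k < m \<Longrightarrow> H'' k \<in> carrier_mat N N" for X' H''
  proof (rule eq_matI)
    fix i j
    assume "i < dim_row (u \<cdot>\<^sub>m 1\<^sub>m N + mat_sum N (\<lambda>s. v s \<cdot>\<^sub>m (H'' (fst s) * X' ! snd s)) ?I)"
      "j < dim_col (u \<cdot>\<^sub>m 1\<^sub>m N + mat_sum N (\<lambda>s. v s \<cdot>\<^sub>m (H'' (fst s) * X' ! snd s)) ?I)"
    then have ij: "i < N" "j < N" by simp_all
    have "(\<Sum>s\<in>?I. (v s \<cdot>\<^sub>m (H'' (fst s) * X' ! snd s)) $$ (i, j)) = (\<Sum>s\<in>?I. v s * (H'' (fst s) * X' ! snd s) $$ (i, j))"
    proof (rule sum.cong[OF refl])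
      fix s assume "s \<in> ?I"
      then have "H'' (fst s) * X' ! snd s \<in> carrier_mat N N"
        using H'' nc_level_nth[OF X'] by (auto intro!: mult_carrier_mat[of _ N N _ N])
      then show "(v s \<cdot>\<^sub>m (H'' (fst s) * X' ! snd s)) $$ (i, j) = v s * (H'' (fst s) * X' ! snd s) $$ (i, j)"
        using ij by (simp del: index_mult_mat)
    qed
    then show "node N X' H'' u v $$ (i, j)
        = (u \<cdot>\<^sub>m 1\<^sub>m N + mat_sum N (\<lambda>s. v s \<cdot>\<^sub>m (H'' (fst s) * X' ! snd s)) ?I) $$ (i, j)"
      unfolding node_index[OF ij] using ij by simp
  qed (simp_all add: node_def)
  have len: "length X = d" using X by (simp add: nc_level_def)
  note car = mult_carrier_mat[of _ N N _ N] S T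
  have X': "map (\<lambda>A. T * A * S) X \<in> nc_level d N" using X car by (auto simp: nc_level_def)
  have F: "?F s \<in> carrier_mat N N" if "s \<in> ?I" for s
    using that H nc_level_nth[OF X] by (auto intro!: mult_carrier_mat[of _ N N _ N])
  have prod: "T * H (fst s) * S * map (\<lambda>A. T * A * S) X ! snd s = T * ?F s * S" if s: "s \<in> ?I" for s
  proof -
    have c: "H (fst s) \<in> carrier_mat N N" "X ! snd s \<in> carrier_mat N N"
      using s H nc_level_nth[OF X] by auto
    \<comment> \<open>The inner factor S T cancels, so conjugating state and tuple separately
      conjugates their product.\<close>
    have "T * H (fst s) * S * (T * X ! snd s * S) = T * H (fst s) * (S * T) * X ! snd s * S"
      using c car by (simp add: assoc_mult_mat[of _ N N _ N _ N] del: TS)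
    also have "\<dots> = T * ?F s * S" unfolding TS using c car by (simp add: assoc_mult_mat[of _ N N _ N _ N])
    finally show ?thesis using s len by auto
  qed
  have "T * mat_sum N (\<lambda>s. v s \<cdot>\<^sub>m ?F s) ?I * S = mat_sum N (\<lambda>s. T * (v s \<cdot>\<^sub>m ?F s) * S) ?I"
    using F car by (simp add: mat_mult_mat_sum mat_sum_mult_mat)
  also have "\<dots> = mat_sum N (\<lambda>s. v s \<cdot>\<^sub>m (T * H (fst s) * S * map (\<lambda>A. T * A * S) X ! snd s)) ?I"
  proof (rule mat_sum_cong)
    fix s assume s: "s \<in> ?I"
    show "T * (v s \<cdot>\<^sub>m ?F s) * S = v s \<cdot>\<^sub>m (T * H (fst s) * S * map (\<lambda>A. T * A * S) X ! snd s)"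
      unfolding prod[OF s] using F[OF s] car
      by (simp add: mult_smult_distrib[of _ N N _ N] mult_smult_assoc_mat[of _ N N _ N])
  qed
  finally have sum: "T * mat_sum N (\<lambda>s. v s \<cdot>\<^sub>m ?F s) ?I * S
      = mat_sum N (\<lambda>s. v s \<cdot>\<^sub>m (T * H (fst s) * S * map (\<lambda>A. T * A * S) X ! snd s)) ?I" .
  have one: "T * (u \<cdot>\<^sub>m 1\<^sub>m N) * S = u \<cdot>\<^sub>m 1\<^sub>m N"
    using car TS by (simp add: mult_smult_distrib[of _ N N _ N] mult_smult_assoc_mat[of _ N N _ N])
  have u1: "u \<cdot>\<^sub>m 1\<^sub>m N \<in> carrier_mat N N" by simp
  have alt: "node N X H u v = u \<cdot>\<^sub>m 1\<^sub>m N + mat_sum N (\<lambda>s. v s \<cdot>\<^sub>m ?F s) ?I"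
    by (rule node_alt[OF X H])
  have "T * node N X H u v * S = T * (u \<cdot>\<^sub>m 1\<^sub>m N) * S + T * mat_sum N (\<lambda>s. v s \<cdot>\<^sub>m ?F s) ?I * S"
    unfolding alt
    using S T by (simp add: mult_add_distrib_mat[OF T u1 mat_sum_carrier]
        add_mult_distrib_mat[OF mult_carrier_mat[OF T u1] mult_carrier_mat[OF T mat_sum_carrier] S])
  then show ?thesis
    unfolding one sum by (subst node_alt[OF X']) (use H car in auto)
qed

lemma nc_function_transfer: "nc_function d transfer"
  unfolding nc_function_def
proof (intro conjI allI ballI impI)
  fix N X assume X: "X \<in> nc_ball_level d N"
  then obtain H where "is_state N X H" using is_state_exists by blast
  then show "transfer X \<in> carrier_mat N N" by (simp add: transfer_eq[OF X])
next
  fix X Y assume "X \<in> nc_ball d" "Y \<in> nc_ball d"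
  then show "transfer (map2 mat_dsum X Y) = mat_dsum (transfer X) (transfer Y)"
    by (auto simp: nc_ball_def intro: transfer_dsum)
next
  fix N X and S T :: "complex mat"
  assume X: "X \<in> nc_ball_level d N" and S: "S \<in> carrier_mat N N" and T: "T \<in> carrier_mat N N"
    and *: "inverts_mat S T \<and> inverts_mat T S \<and> map (\<lambda>A. T * A * S) X \<in> nc_ball_level d N"
  have lev: "X \<in> nc_level d N" using X by (simp add: nc_ball_level_iff)
  have TS: "S * T = 1\<^sub>m N" "T * S = 1\<^sub>m N" using * S T by (auto simp: inverts_mat_def)
  obtain H where H: "is_state N X H" using is_state_exists[OF X] by blast
  have c: "H k \<in> carrier_mat N N" if "k < m" for k using H that by (auto simp: is_state_def)
  have ns: "node N (map (\<lambda>A. T * A * S) X) (\<lambda>k. T * H k * S) u v = T * node N X H u v * S" for u v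
    by (rule node_similarity[OF lev c S T TS])
  have "is_state N (map (\<lambda>A. T * A * S) X) (\<lambda>k. T * H k * S)"
    unfolding is_state_def ns
    using H c S T by (auto simp: is_state_def)
  from transfer_eq[OF conjunct2[OF conjunct2[OF *]] this]
  show "transfer (map (\<lambda>A. T * A * S) X) = T * transfer X * S"
    unfolding ns transfer_eq[OF X H] .
qed

lemma transfer_in_H_infty_1:
  assumes "nc_ball d \<noteq> {}"
  shows "transfer \<in> H_infty_1 d"
  by (rule contractive_nc_function_in_H_infty_1[OF nc_function_transfer _ assms])
    (auto simp: nc_ball_def intro: transfer_contractive)

end

theorem theorem5p5:
  fixes d n :: nat and Z0 :: "complex mat list" and W0 :: "complex mat"
  assumes "d \<ge> 1" and "n \<ge> 1"
    and "Z0 \<in> nc_ball_level d n"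
    and "W0 \<in> carrier_mat n n"
  shows "(\<exists>\<Phi>\<in>H_infty_1 d. \<Phi> Z0 = W0) \<longleftrightarrow>
    completely_positive n
      (\<lambda>P. szego_kernel d Z0 Z0 P - W0 * szego_kernel d Z0 Z0 P * mat_adjoint W0)"
proof
  assume "\<exists>\<Phi>\<in>H_infty_1 d. \<Phi> Z0 = W0"
  then obtain \<Phi> where \<Phi>: "\<Phi> \<in> H_infty_1 d" "\<Phi> Z0 = W0" by blast
  have f: "nc_function d \<Phi>" and bdd: "bdd_above ((\<lambda>Z. op_norm (\<Phi> Z)) ` nc_ball d)"
    and sup: "(SUP Z\<in>nc_ball d. op_norm (\<Phi> Z)) \<le> 1"
    using \<Phi> by (simp_all add: H_infty_1_def H_infty_def free_holomorphic_def)
  \<comment> \<open>Boundedness on the ball makes the supremum an upper bound for every single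
    value.\<close>
  have "op_norm (\<Phi> X) \<le> 1" if "X \<in> nc_ball d" for X
    using cSUP_upper[OF that bdd] sup by linarith
  from contraction_implies_completely_positive[OF f this assms(3,2)]
  show "completely_positive n
      (\<lambda>P. szego_kernel d Z0 Z0 P - W0 * szego_kernel d Z0 Z0 P * mat_adjoint W0)"
    by (simp add: \<Phi>(2))
next
  assume cp: "completely_positive n
      (\<lambda>P. szego_kernel d Z0 Z0 P - W0 * szego_kernel d Z0 Z0 P * mat_adjoint W0)"
  obtain m \<alpha> \<beta> \<gamma> \<delta> and H :: "nat \<Rightarrow> nat \<Rightarrow> nat \<Rightarrow> complex" where
    W: "\<And>i a. i < n \<Longrightarrow> a < n \<Longrightarrow> W0 $$ (i, a) = \<alpha> * (if i = a then 1 else 0)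
      + (\<Sum>s\<in>{..<m} \<times> {..<d}. \<beta> s * row_act n (H (fst s) i) (Z0 ! snd s) a)"
    and H: "\<And>l i a. l < m \<Longrightarrow> i < n \<Longrightarrow> a < n \<Longrightarrow> H l i a = \<gamma> l * (if i = a then 1 else 0)
      + (\<Sum>s\<in>{..<m} \<times> {..<d}. \<delta> l s * row_act n (H (fst s) i) (Z0 ! snd s) a)"
    and contr: "\<And>x0 x. (cmod (\<alpha> * x0 + (\<Sum>s\<in>{..<m} \<times> {..<d}. \<beta> s * x s)))\<^sup>2
      + (\<Sum>l<m. (cmod (\<gamma> l * x0 + (\<Sum>s\<in>{..<m} \<times> {..<d}. \<delta> l s * x s)))\<^sup>2)
      \<le> (cmod x0)\<^sup>2 + (\<Sum>s\<in>{..<m} \<times> {..<d}. (cmod (x s))\<^sup>2)"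
    by (rule pick_colligation[OF assms(3,4,2) cp]) blast
  interpret contractive_colligation d m \<alpha> \<beta> \<gamma> \<delta>
    by unfold_locales (use assms(1) contr in auto)
  have lev: "Z0 \<in> nc_level d n" using assms(3) by (simp add: nc_ball_level_iff)
  \<comment> \<open>The Kraus operators of the Pick map form the state at Z0, so uniqueness of
    states identifies the transfer function there with W0.\<close>
  define G where "G l = mat n n (\<lambda>(i, a). H l i a)" for l
  have G: "G l \<in> carrier_mat n n" for l by (simp add: G_def)
  have node: "node n Z0 G u v $$ (i, a) = u * (if i = a then 1 else 0)
      + (\<Sum>s\<in>{..<m} \<times> {..<d}. v s * row_act n (H (fst s) i) (Z0 ! snd s) a)"
    if ia: "i < n" "a < n" for u v i a
  proof -
    have "(G k * Z0 ! t) $$ (i, a) = row_act n (H k i) (Z0 ! t) a" if "t < d" for k t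
    proof -
      have "row_act n (\<lambda>p. G k $$ (i, p)) (Z0 ! t) = row_act n (H k i) (Z0 ! t)"
        using ia by (intro row_act_cong) (simp add: G_def)
      then show ?thesis by (simp only: row_mult_index[OF G nc_level_nth[OF lev that] ia])
    qed
    then show ?thesis
      unfolding node_index[OF ia] by (intro arg_cong2[of _ _ _ _ "(+)"] sum.cong refl) auto
  qed
  have "is_state n Z0 G"
    unfolding is_state_def
  proof (intro allI impI conjI G)
    fix l assume l: "l < m"
    show "G l = node n Z0 G (\<gamma> l) (\<delta> l)"
    proof (rule eq_matI)
      fix i a assume "i < dim_row (node n Z0 G (\<gamma> l) (\<delta> l))" "a < dim_col (node n Z0 G (\<gamma> l) (\<delta> l))"
      then have ia: "i < n" "a < n" by (simp_all only: carrier_matD[OF node_carrier])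
      show "G l $$ (i, a) = node n Z0 G (\<gamma> l) (\<delta> l) $$ (i, a)"
        unfolding node[OF ia] H[OF l ia, symmetric] using ia by (simp add: G_def)
    qed (simp_all only: carrier_matD[OF node_carrier] carrier_matD[OF G])
  qed
  moreover have "node n Z0 G \<alpha> \<beta> = W0"
  proof (rule eq_matI)
    fix i a assume "i < dim_row W0" "a < dim_col W0"
    then have ia: "i < n" "a < n" using assms(4) by auto
    show "node n Z0 G \<alpha> \<beta> $$ (i, a) = W0 $$ (i, a)"
      unfolding node[OF ia] W[OF ia] ..
  qed (simp_all only: carrier_matD[OF node_carrier] carrier_matD[OF assms(4)])
  ultimately have "transfer Z0 = W0" using transfer_eq[OF assms(3)] by simp
  moreover have "transfer \<in> H_infty_1 d"
    using assms(2,3) by (intro transfer_in_H_infty_1) (auto simp: nc_ball_def)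
  ultimately show "\<exists>\<Phi>\<in>H_infty_1 d. \<Phi> Z0 = W0" by blast
qed

end
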